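(* For $P$-almost all $\omega\in\Omega$ and for $\nu_\omega$-almost all $x\in K_\omega$, we have $$\underline{\mathrm{por}}(K_\omega,x)=\underline{\mathrm{por}}(\nu_\omega,x)=0,\qquad \overline{\mathrm{por}}(K_\omega,x)=\tfrac12\qquad\text{and}\qquad\overline{\mathrm{por}}(\nu_\omega,x)=1.$$
   Context: Mandelbrot percolation. $\mathbb N=\{1,2,\dots\}$. Fix integers $m\ge 1$, $k\ge 2$ and a probability $p$ with $k^{-m}<p\le 1$ (the range in which the limit set below is non-empty with positive probability). Let $I=\{1,\dots,k^m\}$ and $I^*=\bigcup_{i\ge 0}I^i$ (finite words, $I^0$ consisting of the empty word $\emptyset$), let $|\sigma|$ be the length of a word, $\eta|_i$ the prefix of length $i$ of $\eta\in I^*\cup I^{\mathbb N}$, $\sigma*\tau$ concatenation, and write $\sigma\prec\tau$ (or $\tau\succ\sigma$) if $\tau$ starts with $\sigma$. Let $J_\emptyset=[0,1]^m$; each closed cube $J_\sigma$ of side length $k^{-|\sigma|}$ is divided into $k^m$ closed $k$-adic subcubes $J_{\sigma*1},\dots,J_{\sigma*k^m}$ of side length $k^{-|\sigma|-1}$ (in a fixed enumeration). For $\eta\in I^{\mathbb N}$, $x(\eta)$ is the unique point of $\bigcap_{i\ge0}J_{\eta|_i}$. $\Omega$ is the set of functions $\omega:I^*\to\{c,n\}$ ($c$ = chosen, $n$ = neglected) with the product topology. $P$ is the Borel probability measure on $\Omega$ such that $\omega(\emptyset)=c$ almost surely and, going from each level to the next, if $\omega(\sigma)=c$ then each $\sigma*j$,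 $j\in I$, is chosen independently with probability $p$, while if $\omega(\sigma)=n$ then $\omega(\sigma*j)=n$ for all $j$. The limit set is $K_\omega=\bigcap_{i\ge0}\bigcup_{\sigma\in I^i,\ \omega(\sigma)=c}J_\sigma$. Natural measure. Let $d=\log(k^mp)/\log k$. For $\sigma\in I^*$ let $N_{j,\sigma}=\operatorname{card}\{\tau\in I^*: |\tau|=|\sigma|+j,\ \tau\succ\sigma,\ \omega(\tau)=c\}$ and let $X_\sigma(\omega)=\lim_{j\to\infty}N_{j,\sigma}k^{-jd}$ (a $P$-almost sure finite martingale limit). For $P$-almost every $\omega$, $\mu_\omega$ is the Borel measure on $I^{\mathbb N}$ with $\mu_\omega(\{\eta:\eta|_{|\sigma|}=\sigma\})=(\operatorname{diam}J_\emptyset)^dk^{-|\sigma|d}X_\sigma(\omega)$ for all $\sigma\in I^*$; the natural measure $\nu_\omega$ on $K_\omega$ is the image of $\mu_\omega$ under $\eta\mapsto x(\eta)$. Porosities. $B(x,r)$ is the open Euclidean ball in $\mathbb R^m$. For $A\subset\mathbb R^m$, $x\in\mathbb R^m$, $r>0$, $\mathrm{por}(A,x,r)=\sup\{\alpha\ge0: \text{there is }z\in\mathbb R^m\text{ with }B(z,\alpha r)\subset B(x,r)\setminus A\}$, and $\underline{\mathrm{por}}(A,x)=\liminf_{r\to0}\mathrm{por}(A,x,r)$, $\overline{\mathrm{por}}(A,x)=\limsup_{r\to0}\mathrm{por}(A,x,r)$. For a Radon measure $\mu$ on $\mathbb R^m$ and $r,\varepsilon>0$, $\mathrm{por}(\mu,x,r,\varepsilon)=\sup\{\alpha\ge0:\text{there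 is }z\in\mathbb R^m\text{ with }B(z,\alpha r)\subset B(x,r)\text{ and }\mu(B(z,\alpha r))\le\varepsilon\mu(B(x,r))\}$, and $\underline{\mathrm{por}}(\mu,x)=\lim_{\varepsilon\to0}\liminf_{r\to0}\mathrm{por}(\mu,x,r,\varepsilon)$, $\overline{\mathrm{por}}(\mu,x)=\lim_{\varepsilon\to0}\limsup_{r\to0}\mathrm{por}(\mu,x,r,\varepsilon)$.
   Formalization: The probability p is restricted to k^{-m} < p < 1: for p = 1 the limit set is the whole cube and the natural measure is a multiple of Lebesgue measure, so both upper porosities are 0 at interior points and the claim fails. *)

theory Defs
  imports "HOL-Probability.Probability" "HOL-Library.Sublist"
begin

text \<open>
  Mandelbrot percolation on the unit cube of \<open>real ^ 'm\<close>, with \<open>q = k ^ CARD('m)\<close> letters.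
  The letters are the numbers \<open>1, ..., q\<close>, finite words are lists, and \<open>\<sigma> * j\<close> is \<open>\<sigma> @ [j]\<close>.
  Infinite words are functions on \<open>nat\<close>, so positions are counted from \<open>0\<close> and the prefix of
  length \<open>i\<close> of \<open>\<eta>\<close> is \<open>map \<eta> [0..<i]\<close>.  A configuration \<open>\<omega>\<close> is a predicate on words:
  \<open>\<omega> \<sigma>\<close> means that \<open>\<sigma>\<close> is chosen.

  The retention probability \<open>p = 1\<close> has to be excluded when one asserts that the upper porosities
  are maximal: in that case the limit set is the whole cube, the natural measure is a multiple of
  Lebesgue measure, and all porosities vanish at interior points.
\<close>

definition words :: "nat \<Rightarrow> nat list set" where
  "words q = lists {1..q}"

definition words_at :: "nat \<Rightarrow> nat \<Rightarrow> nat list set" where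
  "words_at q i = {\<sigma> \<in> words q. length \<sigma> = i}"

text \<open>
  The enumeration of the subcubes: \<open>e j\<close> is the integer position of the \<open>j\<close>-th subcube in the
  \<open>k \<times> ... \<times> k\<close> grid into which every cube is divided.
\<close>

definition subcube_enumeration :: "nat \<Rightarrow> (nat \<Rightarrow> nat ^ 'm::finite) \<Rightarrow> bool" where
  "subcube_enumeration k e \<longleftrightarrow> bij_betw e {1..k ^ CARD('m)} {v. \<forall>i. v $ i < k}"

text \<open>The \<open>i\<close>-th coordinate of the lowest corner has base \<open>k\<close> digits \<open>e (\<sigma> ! l) $ i\<close>.\<close>

definition corner :: "nat \<Rightarrow> (nat \<Rightarrow> nat ^ 'm::finite) \<Rightarrow> nat list \<Rightarrow> real ^ 'm" where
  "corner k e \<sigma> = (\<chi> i. \<Sum>l<length \<sigma>. real (e (\<sigma> ! l) $ i) / real k ^ Suc l)"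

definition cube :: "nat \<Rightarrow> (nat \<Rightarrow> nat ^ 'm::finite) \<Rightarrow> nat list \<Rightarrow> (real ^ 'm) set" where
  "cube k e \<sigma> = cbox (corner k e \<sigma>) (corner k e \<sigma> + (\<chi> i. 1 / real k ^ length \<sigma>))"

lemma cube_Nil: "cube k e [] = cbox 0 (\<chi> i. 1)"
  by (simp add: cube_def corner_def flip: zero_vec_def)

lemma corner_snoc:
  "corner k e (\<sigma> @ [j]) = corner k e \<sigma> + (\<chi> i. real (e j $ i) / real k ^ Suc (length \<sigma>))"
  by (simp add: corner_def vec_eq_iff nth_append)

definition coding_point :: "nat \<Rightarrow> (nat \<Rightarrow> nat ^ 'm::finite) \<Rightarrow> (nat \<Rightarrow> nat) \<Rightarrow> real ^ 'm" where
  "coding_point k e \<eta> = (THE x. x \<in> (\<Inter>i. cube k e (map \<eta> [0..<i])))"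

definition limit_set ::
  "nat \<Rightarrow> (nat \<Rightarrow> nat ^ 'm::finite) \<Rightarrow> (nat list \<Rightarrow> bool) \<Rightarrow> (real ^ 'm) set" where
  "limit_set k e \<omega> = (\<Inter>i. \<Union>\<sigma>\<in>{\<sigma> \<in> words_at (k ^ CARD('m)) i. \<omega> \<sigma>}. cube k e \<sigma>)"

text \<open>
  As there are only countably many words, the product \<open>\<sigma>\<close>-algebra is the Borel \<open>\<sigma>\<close>-algebra of the
  product topology.  The last clause gives the transition from level \<open>i\<close> to level \<open>Suc i\<close>: for any
  configuration \<open>a\<close>, given that \<open>\<omega>\<close> agrees with \<open>a\<close> on the levels up to \<open>i\<close>, it agrees with \<open>a\<close>
  on the next level with a probability which is a product over the children \<open>\<sigma> @ [j]\<close>, where each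
  child of a chosen word is chosen with probability \<open>p\<close> and each child of a neglected word is
  neglected.
\<close>

definition percolation_measure :: "nat \<Rightarrow> real \<Rightarrow> (nat list \<Rightarrow> bool) measure \<Rightarrow> bool" where
  "percolation_measure q p P \<longleftrightarrow>
     prob_space P \<and>
     sets P = sets (Pi\<^sub>M (words q) (\<lambda>_. count_space (UNIV :: bool set))) \<and>
     (AE \<omega> in P. \<omega> []) \<and>
     (\<forall>i a. measure P {\<omega> \<in> space P. \<forall>\<sigma>\<in>words q. length \<sigma> \<le> Suc i \<longrightarrow> \<omega> \<sigma> = a \<sigma>} =
        measure P {\<omega> \<in> space P. \<forall>\<sigma>\<in>words q. length \<sigma> \<le> i \<longrightarrow> \<omega> \<sigma> = a \<sigma>} *
        (\<Prod>\<sigma>\<in>words_at q i. \<Prod>j\<in>{1..q}.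
           if a \<sigma> then (if a (\<sigma> @ [j]) then p else 1 - p)
           else (if a (\<sigma> @ [j]) then 0 else 1)))"

definition dim_exponent :: "'m::finite itself \<Rightarrow> nat \<Rightarrow> real \<Rightarrow> real" where
  "dim_exponent _ k p = ln (real k ^ CARD('m) * p) / ln (real k)"

definition num_descendants :: "nat \<Rightarrow> (nat list \<Rightarrow> bool) \<Rightarrow> nat \<Rightarrow> nat list \<Rightarrow> nat" where
  "num_descendants q \<omega> j \<sigma> =
     card {\<tau> \<in> words q. length \<tau> = length \<sigma> + j \<and> prefix \<sigma> \<tau> \<and> \<omega> \<tau>}"

definition martingale_limit ::
  "'m::finite itself \<Rightarrow> nat \<Rightarrow> real \<Rightarrow> (nat list \<Rightarrow> bool) \<Rightarrow> nat list \<Rightarrow> real" where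
  "martingale_limit M k p \<omega> \<sigma> =
     lim (\<lambda>j. real (num_descendants (k ^ CARD('m)) \<omega> j \<sigma>)
                * real k powr (- (real j * dim_exponent M k p)))"

definition cylinder :: "nat \<Rightarrow> nat list \<Rightarrow> (nat \<Rightarrow> nat) set" where
  "cylinder q \<sigma> = {\<eta> \<in> UNIV \<rightarrow> {1..q}. map \<eta> [0..<length \<sigma>] = \<sigma>}"

text \<open>
  For almost every \<open>\<omega>\<close> there is exactly one measure on the \<open>\<sigma>\<close>-algebra generated by the cylinders
  that has the prescribed values on them, and this is what \<^const>\<open>extend_measure\<close> selects; for the
  exceptional \<open>\<omega>\<close> the value is irrelevant.
\<close>

definition coding_measure ::
  "nat \<Rightarrow> real \<Rightarrow> (nat \<Rightarrow> nat ^ 'm::finite) \<Rightarrow> (nat list \<Rightarrow> bool) \<Rightarrow> (nat \<Rightarrow> nat) measure" where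
  "coding_measure k p e \<omega> =
     (let q = k ^ CARD('m); d = dim_exponent TYPE('m) k p in
      extend_measure (UNIV \<rightarrow> {1..q}) (words q) (cylinder q)
        (\<lambda>\<sigma>. ennreal (diameter (cube k e []) powr d * real k powr (- (real (length \<sigma>) * d))
                        * martingale_limit TYPE('m) k p \<omega> \<sigma>)))"

definition natural_measure ::
  "nat \<Rightarrow> real \<Rightarrow> (nat \<Rightarrow> nat ^ 'm::finite) \<Rightarrow> (nat list \<Rightarrow> bool) \<Rightarrow> (real ^ 'm) measure" where
  "natural_measure k p e \<omega> = distr (coding_measure k p e \<omega>) borel (coding_point k e)"

text \<open>
  All porosities lie in \<open>[0, 1]\<close>; they are taken in \<^typ>\<open>ereal\<close> so that \<^const>\<open>Liminf\<close> and
  \<^const>\<open>Limsup\<close> are available.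
\<close>

definition set_por :: "(real ^ 'm::finite) set \<Rightarrow> real ^ 'm \<Rightarrow> real \<Rightarrow> ereal" where
  "set_por A x r = (SUP \<alpha>\<in>{\<alpha>. 0 \<le> \<alpha> \<and> (\<exists>z. ball z (\<alpha> * r) \<subseteq> ball x r - A)}. ereal \<alpha>)"

definition lower_set_por :: "(real ^ 'm::finite) set \<Rightarrow> real ^ 'm \<Rightarrow> ereal" where
  "lower_set_por A x = Liminf (at_right 0) (\<lambda>r. set_por A x r)"

definition upper_set_por :: "(real ^ 'm::finite) set \<Rightarrow> real ^ 'm \<Rightarrow> ereal" where
  "upper_set_por A x = Limsup (at_right 0) (\<lambda>r. set_por A x r)"

definition measure_por ::
  "(real ^ 'm::finite) measure \<Rightarrow> real ^ 'm \<Rightarrow> real \<Rightarrow> real \<Rightarrow> ereal" where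
  "measure_por \<mu> x r \<epsilon> =
     (SUP \<alpha>\<in>{\<alpha>. 0 \<le> \<alpha> \<and> (\<exists>z. ball z (\<alpha> * r) \<subseteq> ball x r \<and>
                emeasure \<mu> (ball z (\<alpha> * r)) \<le> ennreal \<epsilon> * emeasure \<mu> (ball x r))}. ereal \<alpha>)"

definition lower_measure_por :: "(real ^ 'm::finite) measure \<Rightarrow> real ^ 'm \<Rightarrow> ereal" where
  "lower_measure_por \<mu> x =
     Lim (at_right 0) (\<lambda>\<epsilon>. Liminf (at_right 0) (\<lambda>r. measure_por \<mu> x r \<epsilon>))"

definition upper_measure_por :: "(real ^ 'm::finite) measure \<Rightarrow> real ^ 'm \<Rightarrow> ereal" where
  "upper_measure_por \<mu> x =
     Lim (at_right 0) (\<lambda>\<epsilon>. Limsup (at_right 0) (\<lambda>r. measure_por \<mu> x r \<epsilon>))"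

end

theory Submission
  imports Defs
begin

text \<open>
  Around almost every point for the natural measure, every local configuration that has positive
  probability inside a cube reappears at arbitrarily small scales.  Given this recurrence, all four
  porosities are read off from three configurations, each of which prescribes which descendants of
  a cube survive after \<open>n\<close> generations and how much limiting mass they carry, for a point in the
  descendant at the centre of the cube.

  If all descendants survive with comparable masses, every ball of radius \<open>\<alpha> r\<close> inside \<open>B(x, r)\<close>
  contains a whole descendant and hence a fixed proportion of the mass, so the lower porosity of
  the measure is zero.  A hole of the limit set has measure zero, so the lower porosity of the set
  is at most that of the measure.  If only the central descendant survives, the limit set looks
  like a point from a moderate distance and the holes beside \<open>x\<close> have relative size nearly
  \<open>1/2\<close>, which is the largest size for a point of the set.  If exactly two descendants
  survive, at distance about \<open>r\<close>, and the one that contains \<open>x\<close> carries a tiny mass compared with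
  the other, then nearly the whole ball \<open>B(x, r)\<close> is light, so the upper porosity of the measure
  is one.

  Recurrence could be derived from the ergodicity of the size-biased measure on pairs of a
  configuration and a code.  The argument below avoids this measure and works with the
  operator \<open>descend n\<close>, which sends a function \<open>f\<close> of the configuration to
  \<open>(q p)\<^bsup>-n\<^esup>\<close> times the sum of \<open>f\<close> over the surviving subtrees of generation \<open>n\<close>.  By the branching
  property (\<open>distr_graft\<close>) it preserves expectations, and on functions of mean zero it shrinks the
  second moment by the factor \<open>(q p)\<^bsup>-n\<^esup> < 1\<close> (\<open>descend_moments\<close>).  This contraction is used
  twice.  It makes the normalised population sizes converge almost surely and in mean to
  \<open>limit_mass\<close>, and it shows that every square integrable fixed point of the operator is a multiple
  of \<open>limit_mass\<close> (\<open>descend_fixed_mean_zero\<close>).  Now let \<open>g\<close> be the mass of the codes that never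
  meet a given configuration.  Dropping the first block of a code can only relax the condition, so
  \<open>g\<close> is at most its image under the operator.  Both have the same expectation, so \<open>g\<close> is a fixed
  point, \<open>g = b \<cdot> limit_mass\<close>, and the codes which meet the configuration at once and avoid it
  later have mass zero.  As the configuration has positive probability, this forces \<open>b = 0\<close>
  (\<open>avoiding_mass_vanishes\<close>).
\<close>

section \<open>Words and subtrees\<close>

\<comment> \<open>The simplifier would rewrite the set of letters \<open>{1..q}\<close> to \<open>{Suc 0..q}\<close>.\<close>
declare One_nat_def [simp del]

lemma Nil_in_words [simp]: "[] \<in> words q" by (simp add: words_def)

lemma Cons_in_words [simp]: "j # \<sigma> \<in> words q \<longleftrightarrow> j \<in> {1..q} \<and> \<sigma> \<in> words q" by (auto simp: words_def)

lemma append_in_words [simp]: "\<sigma> @ \<tau> \<in> words q \<longleftrightarrow> \<sigma> \<in> words q \<and> \<tau> \<in> words q" by (auto simp: words_def)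

lemma countable_words [simp]: "countable (words q)" by (simp add: words_def)

lemma words_at_0 [simp]: "words_at q 0 = {[]}" by (auto simp: words_at_def)

lemma words_at_Suc: "words_at q (Suc n) = (\<lambda>(j, \<sigma>). j # \<sigma>) ` ({1..q} \<times> words_at q n)"
  by (auto simp: words_at_def image_def length_Suc_conv)

lemma finite_words_at [simp]: "finite (words_at q n)"
  by (induction n) (auto simp: words_at_Suc)

lemma card_words_at: "card (words_at q n) = q ^ n"
proof (induction n)
  case (Suc n)
  have "card (words_at q (Suc n)) = card ({1..q} \<times> words_at q n)"
    unfolding words_at_Suc by (intro card_image) (auto simp: inj_on_def)
  thus ?case by (simp add: Suc card_cartesian_product)
qed auto

lemma finite_words_le: "finite {\<sigma> \<in> words q. length \<sigma> \<le> n}"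
proof -
  have "{\<sigma> \<in> words q. length \<sigma> \<le> n} = (\<Union>i\<le>n. words_at q i)" by (auto simp: words_at_def)
  thus ?thesis by simp
qed

lemma sum_words_at_Suc:
  "(\<Sum>\<tau>\<in>words_at q (Suc n). f \<tau>) = (\<Sum>j\<in>{1..q}. \<Sum>\<tau>\<in>words_at q n. f (j # \<tau>))"
proof -
  have "(\<Sum>\<tau>\<in>words_at q (Suc n). f \<tau>) = (\<Sum>x\<in>{1..q} \<times> words_at q n. f (case x of (j, \<sigma>) \<Rightarrow> j # \<sigma>))"
    unfolding words_at_Suc by (intro sum.reindex[unfolded o_def]) (auto simp: inj_on_def)
  thus ?thesis by (simp add: sum.cartesian_product case_prod_unfold)
qed

lemma prod_words_at_Suc:
  "(\<Prod>\<tau>\<in>words_at q (Suc n). f \<tau>) = (\<Prod>j\<in>{1..q}. \<Prod>\<tau>\<in>words_at q n. f (j # \<tau>))"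
proof -
  have "(\<Prod>\<tau>\<in>words_at q (Suc n). f \<tau>) = (\<Prod>x\<in>{1..q} \<times> words_at q n. f (case x of (j, \<sigma>) \<Rightarrow> j # \<sigma>))"
    unfolding words_at_Suc by (intro prod.reindex[unfolded o_def]) (auto simp: inj_on_def)
  thus ?thesis by (simp add: prod.cartesian_product case_prod_unfold)
qed

definition subtree :: "nat list \<Rightarrow> (nat list \<Rightarrow> bool) \<Rightarrow> nat list \<Rightarrow> bool" where
  "subtree \<sigma> \<omega> = (\<lambda>\<tau>. \<omega> (\<sigma> @ \<tau>))"

lemma subtree_apply: "subtree \<sigma> \<omega> \<tau> = \<omega> (\<sigma> @ \<tau>)" by (simp add: subtree_def)

lemma subtree_Nil [simp]: "subtree [] \<omega> = \<omega>" by (simp add: subtree_def)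

lemma subtree_subtree [simp]: "subtree \<tau> (subtree \<sigma> \<omega>) = subtree (\<sigma> @ \<tau>) \<omega>" by (simp add: subtree_def)

section \<open>The branching property\<close>

locale percolation =
  fixes q :: nat and p :: real and P :: "(nat list \<Rightarrow> bool) measure"
  assumes percolation: "percolation_measure q p P"
    and supercritical: "1 / real q < p" and subunit: "p < 1" and letters_pos: "0 < q"
begin

abbreviation configs :: "(nat list \<Rightarrow> bool) measure" where
  "configs \<equiv> Pi\<^sub>M (words q) (\<lambda>_. count_space (UNIV :: bool set))"

sublocale prob_space P
  using percolation by (simp add: percolation_measure_def)

lemma sets_P [measurable_cong]: "sets P = sets configs"
  using percolation by (simp add: percolation_measure_def)

lemma space_P: "space P = (words q \<rightarrow>\<^sub>E UNIV)"
  using sets_eq_imp_space_eq[OF sets_P] by (simp add: space_PiM)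

lemma AE_root: "AE \<omega> in P. \<omega> []"
  using percolation by (simp add: percolation_measure_def)

lemma p_pos: "0 < p"
  using supercritical letters_pos by (smt (verit) divide_nonneg_nonneg of_nat_0_le_iff)

lemma measurable_letter [measurable]: "\<sigma> \<in> words q \<Longrightarrow> (\<lambda>\<omega>. \<omega> \<sigma>) \<in> P \<rightarrow>\<^sub>M count_space UNIV"
  by measurable

lemma measurable_subtree [measurable]:
  assumes "\<sigma> \<in> words q"
  shows "subtree \<sigma> \<in> P \<rightarrow>\<^sub>M P"
proof -
  have "subtree \<sigma> \<in> P \<rightarrow>\<^sub>M configs"
  proof (rule measurable_PiM_single')
    fix \<tau> assume "\<tau> \<in> words q"
    hence "\<sigma> @ \<tau> \<in> words q" using assms by simp
    thus "(\<lambda>\<omega>. subtree \<sigma> \<omega> \<tau>) \<in> P \<rightarrow>\<^sub>M count_space UNIV"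
      by (subst subtree_apply) (rule measurable_letter)
  next
    show "(\<lambda>\<omega> i. subtree \<sigma> \<omega> i) \<in> space P \<rightarrow> (\<Pi>\<^sub>E i\<in>words q. space (count_space UNIV))"
      unfolding space_P using assms by (auto simp: PiE_def extensional_def subtree_def)
  qed
  thus ?thesis by (simp add: measurable_cong_sets[OF refl sets_P])
qed

lemma subtree_space: "\<sigma> \<in> words q \<Longrightarrow> \<omega> \<in> space P \<Longrightarrow> subtree \<sigma> \<omega> \<in> space P"
  using measurable_space[OF measurable_subtree] by blast

definition agreeing :: "nat \<Rightarrow> (nat list \<Rightarrow> bool) \<Rightarrow> (nat list \<Rightarrow> bool) set" where
  "agreeing i a = {\<omega> \<in> space P. \<forall>\<sigma>\<in>words q. length \<sigma> \<le> i \<longrightarrow> \<omega> \<sigma> = a \<sigma>}"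

lemma agreeing_sets [measurable]: "agreeing i a \<in> sets P"
proof -
  have "agreeing i a = {\<omega> \<in> space P. \<forall>\<sigma>\<in>{\<sigma>\<in>words q. length \<sigma> \<le> i}. \<omega> \<sigma> = a \<sigma>}"
    by (auto simp: agreeing_def)
  also have "\<dots> \<in> sets P"
    by (intro sets.sets_Collect_finite_All finite_words_le) measurable
  finally show ?thesis .
qed

definition transition :: "bool \<Rightarrow> bool \<Rightarrow> real" where
  "transition s t = (if s then (if t then p else 1 - p) else (if t then 0 else 1))"

definition weight :: "nat \<Rightarrow> (nat list \<Rightarrow> bool) \<Rightarrow> real" where
  "weight i a = (\<Prod>l<i. \<Prod>\<sigma>\<in>words_at q l. \<Prod>j\<in>{1..q}. transition (a \<sigma>) (a (\<sigma> @ [j])))"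

lemma weight_nonneg: "0 \<le> weight i a"
  unfolding weight_def transition_def using p_pos subunit by (intro prod_nonneg ballI) auto

text \<open>
  The transition probabilities telescope from the root, which is chosen almost surely.
\<close>

lemma prob_agreeing: "prob (agreeing i a) = (if a [] then weight i a else 0)"
proof (induction i)
  case 0
  have "AE \<omega> in P. \<omega> \<in> agreeing 0 a \<longleftrightarrow> a []"
    using AE_root AE_space by eventually_elim (auto simp: agreeing_def)
  hence "prob (agreeing 0 a) = prob (if a [] then space P else {})"
    by (intro finite_measure_eq_AE) (use AE_space in \<open>auto elim: eventually_elim2\<close>)
  thus ?case by (simp add: weight_def prob_space)
next
  case (Suc i)
  have "prob (agreeing (Suc i) a) = prob (agreeing i a) * (\<Prod>\<sigma>\<in>words_at q i. \<Prod>j\<in>{1..q}.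
           if a \<sigma> then (if a (\<sigma> @ [j]) then p else 1 - p)
           else (if a (\<sigma> @ [j]) then 0 else 1))"
    using percolation unfolding percolation_measure_def agreeing_def by blast
  thus ?case using Suc by (auto simp: weight_def transition_def)
qed

text \<open>
  Sorting the transitions by the first letter of the word turns the probability of a configuration
  into a product over the subtrees of the first generation.  This factorisation is the branching
  property at the level of single configurations.
\<close>

lemma weight_Suc:
  "weight (Suc i) a = (\<Prod>j\<in>{1..q}. transition (a []) (a [j]) * weight i (subtree [j] a))"
proof -
  have "weight (Suc i) a = (\<Prod>j\<in>{1..q}. transition (a []) (a [j])) *
     (\<Prod>l<i. \<Prod>\<sigma>\<in>words_at q (Suc l). \<Prod>j\<in>{1..q}. transition (a \<sigma>) (a (\<sigma> @ [j])))"
    unfolding weight_def prod.lessThan_Suc_shift by simp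
  also have "(\<Prod>l<i. \<Prod>\<sigma>\<in>words_at q (Suc l). \<Prod>j\<in>{1..q}. transition (a \<sigma>) (a (\<sigma> @ [j])))
    = (\<Prod>l<i. \<Prod>j\<in>{1..q}. \<Prod>\<sigma>\<in>words_at q l. \<Prod>j'\<in>{1..q}. transition (a (j # \<sigma>)) (a ((j # \<sigma>) @ [j'])))"
    by (simp add: prod_words_at_Suc)
  also have "\<dots> = (\<Prod>j\<in>{1..q}. weight i (subtree [j] a))"
    unfolding weight_def by (subst prod.swap) (simp add: subtree_apply)
  finally show ?thesis by (simp add: prod.distrib)
qed

text \<open>
  Below a neglected word the transitions are deterministic.
\<close>

lemma weight_neglected:
  assumes "\<not> a []"
  shows "weight i a = (if \<forall>\<sigma>\<in>words q. length \<sigma> \<le> i \<longrightarrow> \<not> a \<sigma> then 1 else 0)"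
  using assms
proof (induction i arbitrary: a)
  case 0 thus ?case by (auto simp: weight_def)
next
  case (Suc i)
  show ?case
  proof (cases "\<forall>\<sigma>\<in>words q. length \<sigma> \<le> Suc i \<longrightarrow> \<not> a \<sigma>")
    case True
    have "transition (a []) (a [j]) * weight i (subtree [j] a) = 1" if "j \<in> {1..q}" for j
    proof -
      have *: "\<not> a (j # \<tau>)" if "\<tau> \<in> words q" "length \<tau> \<le> i" for \<tau>
        using True that \<open>j \<in> _\<close> by auto
      have "\<not> a [j]" using *[of "[]"] by simp
      moreover have "weight i (subtree [j] a) = 1"
        using Suc.IH[of "subtree [j] a"] * \<open>\<not> a [j]\<close> by (auto simp: subtree_def)
      ultimately show ?thesis using Suc.prems by (simp add: transition_def)
    qed
    thus ?thesis using True by (simp add: weight_Suc)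
  next
    case False
    then obtain \<sigma> where \<sigma>: "\<sigma> \<in> words q" "length \<sigma> \<le> Suc i" "a \<sigma>" by auto
    with Suc.prems obtain j \<tau> where j: "\<sigma> = j # \<tau>" by (cases \<sigma>) auto
    have "transition (a []) (a [j]) * weight i (subtree [j] a) = 0"
    proof (cases "a [j]")
      case True thus ?thesis using Suc.prems by (simp add: transition_def)
    next
      case False
      hence "weight i (subtree [j] a) = 0"
        using Suc.IH[of "subtree [j] a"] \<sigma> j by (auto simp: subtree_def)
      thus ?thesis by simp
    qed
    moreover have "j \<in> {1..q}" using \<sigma> j by simp
    ultimately have "weight (Suc i) a = 0" unfolding weight_Suc by (intro prod_zero) auto
    thus ?thesis using False by auto
  qed
qed

abbreviation coin :: "bool measure" where "coin \<equiv> measure_pmf (bernoulli_pmf p)"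
abbreviation branch :: "((nat list \<Rightarrow> bool) \<times> bool) measure" where "branch \<equiv> P \<Otimes>\<^sub>M coin"
abbreviation branches :: "(nat \<Rightarrow> (nat list \<Rightarrow> bool) \<times> bool) measure" where
  "branches \<equiv> Pi\<^sub>M {1..q} (\<lambda>_. branch)"

text \<open>
  A pair of a configuration and a coin toss describes a subtree of the first generation: the
  configuration is kept if the coin shows \<open>True\<close>, and otherwise the subtree is empty.  The function
  \<open>graft\<close> attaches independent subtrees of this kind to a chosen root.
\<close>

definition prune :: "(nat list \<Rightarrow> bool) \<times> bool \<Rightarrow> nat list \<Rightarrow> bool" where
  "prune z = (\<lambda>\<tau>\<in>words q. snd z \<and> fst z \<tau>)"

definition graft :: "(nat \<Rightarrow> (nat list \<Rightarrow> bool) \<times> bool) \<Rightarrow> nat list \<Rightarrow> bool" where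
  "graft y = (\<lambda>\<sigma>\<in>words q. case \<sigma> of [] \<Rightarrow> True | j # \<tau> \<Rightarrow> prune (y j) \<tau>)"

lemma prob_space_branch: "prob_space branch"
  by (intro prob_space_pair prob_space_axioms measure_pmf.prob_space_axioms)

lemma product_prob_space_branch: "product_prob_space (\<lambda>_. branch)"
  by (simp add: product_prob_space_def product_prob_space_axioms_def product_sigma_finite_def
      prob_space_branch prob_space_imp_sigma_finite)

lemma space_branch: "space branch = (words q \<rightarrow>\<^sub>E UNIV) \<times> UNIV"
  by (simp add: space_pair_measure space_P)

lemma measurable_prune [measurable]: "prune \<in> branch \<rightarrow>\<^sub>M P"
proof -
  have "prune \<in> branch \<rightarrow>\<^sub>M configs"
    unfolding prune_def by measurable
  thus ?thesis by (simp add: measurable_cong_sets[OF refl sets_P])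
qed

lemma measurable_graft [measurable]: "graft \<in> branches \<rightarrow>\<^sub>M P"
proof -
  have "graft \<in> branches \<rightarrow>\<^sub>M configs"
    unfolding graft_def
  proof (rule measurable_restrict)
    fix \<sigma> assume \<sigma>: "\<sigma> \<in> words q"
    show "(\<lambda>y. case \<sigma> of [] \<Rightarrow> True | j # \<tau> \<Rightarrow> prune (y j) \<tau>) \<in> branches \<rightarrow>\<^sub>M count_space UNIV"
    proof (cases \<sigma>)
      case (Cons j \<tau>)
      have j: "j \<in> {1..q}" and \<tau>: "\<tau> \<in> words q" using \<sigma> Cons by auto
      have "(\<lambda>y. y j) \<in> branches \<rightarrow>\<^sub>M branch" using j by (rule measurable_component_singleton)
      hence "(\<lambda>y. prune (y j)) \<in> branches \<rightarrow>\<^sub>M P"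
        by (rule measurable_compose[OF _ measurable_prune])
      hence "(\<lambda>y. prune (y j) \<tau>) \<in> branches \<rightarrow>\<^sub>M count_space UNIV"
        by (rule measurable_compose[OF _ measurable_letter[OF \<tau>]])
      thus ?thesis using Cons by simp
    qed simp
  qed
  thus ?thesis by (simp add: measurable_cong_sets[OF refl sets_P])
qed

lemma emeasure_prune_agreeing:
  "emeasure branch {z \<in> space branch. prune z \<in> agreeing i b} = ennreal (transition True (b []) * weight i b)"
proof -
  define Z where "Z = (if \<forall>\<sigma>\<in>words q. length \<sigma> \<le> i \<longrightarrow> \<not> b \<sigma> then space P else {})"
  have Z: "Z \<in> sets P" by (auto simp: Z_def)
  have eq: "{z \<in> space branch. prune z \<in> agreeing i b} = agreeing i b \<times> {True} \<union> Z \<times> {False}"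
  proof (rule set_eqI)
    fix z :: "(nat list \<Rightarrow> bool) \<times> bool"
    obtain \<omega> t where z: "z = (\<omega>, t)" by (cases z)
    show "z \<in> {z \<in> space branch. prune z \<in> agreeing i b} \<longleftrightarrow> z \<in> agreeing i b \<times> {True} \<union> Z \<times> {False}"
      by (cases t) (auto simp: z agreeing_def Z_def space_P space_branch prune_def)
  qed
  have "emeasure branch (agreeing i b \<times> {True} \<union> Z \<times> {False}) =
     emeasure branch (agreeing i b \<times> {True}) + emeasure branch (Z \<times> {False})"
    by (intro plus_emeasure[symmetric]) (auto intro!: pair_measureI Z)
  also have "\<dots> = ennreal (prob (agreeing i b)) * ennreal p + emeasure P Z * ennreal (1 - p)"
    using Z p_pos subunit
    by (simp add: measure_pmf.emeasure_pair_measure_Times emeasure_eq_measure emeasure_pmf_single)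
  also have "\<dots> = ennreal (transition True (b []) * weight i b)"
  proof (cases "b []")
    case True
    hence "Z = {}" unfolding Z_def by auto
    thus ?thesis using True p_pos weight_nonneg[of i b]
      by (simp add: prob_agreeing transition_def ennreal_mult mult.commute)
  next
    case False
    thus ?thesis using subunit
      by (auto simp: prob_agreeing transition_def Z_def weight_neglected emeasure_space_1)
  qed
  finally show ?thesis by (simp add: eq)
qed

lemma graft_agreeing_iff:
  assumes "y \<in> space branches"
  shows "graft y \<in> agreeing (Suc i) a \<longleftrightarrow> a [] \<and> (\<forall>j\<in>{1..q}. prune (y j) \<in> agreeing i (subtree [j] a))"
proof -
  have g: "graft y \<in> space P" "prune (y j) \<in> space P" for j
    by (auto simp: graft_def prune_def space_P)
  show ?thesis
  proof safe
    assume G: "graft y \<in> agreeing (Suc i) a"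
    have *: "graft y \<sigma> = a \<sigma>" if "\<sigma> \<in> words q" "length \<sigma> \<le> Suc i" for \<sigma>
      using G that by (auto simp: agreeing_def)
    show "a []" using *[of "[]"] by (simp add: graft_def)
    fix j assume "j \<in> {1..q}"
    hence "prune (y j) \<tau> = a (j # \<tau>)" if "\<tau> \<in> words q" "length \<tau> \<le> i" for \<tau>
      using *[of "j # \<tau>"] that by (simp add: graft_def)
    thus "prune (y j) \<in> agreeing i (subtree [j] a)" using g by (auto simp: agreeing_def subtree_apply)
  next
    assume a: "a []" and *: "\<forall>j\<in>{1..q}. prune (y j) \<in> agreeing i (subtree [j] a)"
    have "graft y \<sigma> = a \<sigma>" if "\<sigma> \<in> words q" "length \<sigma> \<le> Suc i" for \<sigma>
    proof (cases \<sigma>)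
      case (Cons j \<tau>)
      thus ?thesis using that * by (auto simp: graft_def agreeing_def subtree_apply)
    qed (simp add: a graft_def)
    thus "graft y \<in> agreeing (Suc i) a" using g by (auto simp: agreeing_def)
  qed
qed

lemma emeasure_graft_agreeing:
  "emeasure (distr branches P graft) (agreeing (Suc i) a) = emeasure P (agreeing (Suc i) a)"
proof (cases "a []")
  case True
  interpret B: product_prob_space "\<lambda>_. branch" "{1..q}"
    by (rule product_prob_space_branch)
  have "emeasure (distr branches P graft) (agreeing (Suc i) a)
    = emeasure branches {y \<in> space branches. \<forall>j\<in>{1..q}. y j \<in> {z \<in> space branch. prune z \<in> agreeing i (subtree [j] a)}}"
    using True by (subst emeasure_distr[OF measurable_graft])
      (auto intro!: arg_cong[where f = "emeasure branches"] simp: graft_agreeing_iff,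
       auto simp: space_PiM PiE_iff)
  also have "\<dots> = (\<Prod>j\<in>{1..q}. emeasure branch {z \<in> space branch. prune z \<in> agreeing i (subtree [j] a)})"
    by (intro B.emeasure_PiM_Collect) auto
  also have "\<dots> = ennreal (\<Prod>j\<in>{1..q}. transition True (a [j]) * weight i (subtree [j] a))"
    unfolding emeasure_prune_agreeing subtree_apply append.simps using weight_nonneg p_pos subunit
    by (subst prod_ennreal) (auto simp: transition_def)
  also have "\<dots> = emeasure P (agreeing (Suc i) a)"
    using True by (simp add: emeasure_eq_measure prob_agreeing weight_Suc subtree_apply)
  finally show ?thesis .
next
  case False
  hence empty: "graft -` agreeing (Suc i) a \<inter> space branches = {}"
    by (auto simp: graft_agreeing_iff)
  have "emeasure (distr branches P graft) (agreeing (Suc i) a) = 0"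
    unfolding emeasure_distr[OF measurable_graft agreeing_sets] empty by simp
  thus ?thesis using False by (simp add: emeasure_eq_measure prob_agreeing)
qed

text \<open>
  The branching property: the percolation is reproduced by grafting independent pruned copies of
  itself.  A probability measure on the space of configurations is determined by its values on events
  that involve finitely many words.  Such an event is a finite disjoint union of events that fix all
  letters up to some level, and on those both sides give the product of transition
  probabilities.
\<close>

theorem distr_graft: "distr branches P graft = P"
proof -
  have fin: "finite_measure (distr branches P graft)"
    by (intro prob_space.finite_measure prob_space.prob_space_distr measurable_graft prob_space_PiM prob_space_branch)
  show ?thesis
  proof (rule measure_eqI_PiM_infinite[OF _ sets_P _ fin])
    show "sets (distr branches P graft) = sets configs" by (simp add: sets_P)
    fix A :: "nat list \<Rightarrow> bool set" and J assume J: "finite J" "J \<subseteq> words q"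
    define i where "i = Max (insert 0 (length ` J))"
    have i: "length \<sigma> \<le> i" if "\<sigma> \<in> J" for \<sigma> unfolding i_def using J that by (intro Max_ge) auto
    \<comment> \<open>The level is shifted by one because grafted configurations are compared at positive levels only.\<close>
    define W where "W = {\<sigma> \<in> words q. length \<sigma> \<le> Suc i}"
    define F where "F = {a \<in> W \<rightarrow>\<^sub>E UNIV. \<forall>\<sigma>\<in>J. a \<sigma> \<in> A \<sigma>}"
    have JW: "J \<subseteq> W" using J i by (force simp: W_def)
    have "finite (W \<rightarrow>\<^sub>E (UNIV :: bool set))"
      unfolding W_def by (intro finite_PiE finite_words_le) simp
    hence finF: "finite F" by (rule rev_finite_subset) (auto simp: F_def)
    have eq: "prod_emb (words q) (\<lambda>_. count_space UNIV) J (Pi\<^sub>E J A) = (\<Union>a\<in>F. agreeing (Suc i) a)"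
    proof (intro equalityI subsetI)
      fix \<omega> assume \<omega>: "\<omega> \<in> prod_emb (words q) (\<lambda>_. count_space UNIV) J (Pi\<^sub>E J A)"
      have "restrict \<omega> W \<in> F" using \<omega> JW by (auto simp: F_def prod_emb_def restrict_PiE_iff PiE_iff)
      moreover have "\<omega> \<in> agreeing (Suc i) (restrict \<omega> W)"
        using \<omega> by (auto simp: agreeing_def W_def prod_emb_def space_P)
      ultimately show "\<omega> \<in> (\<Union>a\<in>F. agreeing (Suc i) a)" by blast
    next
      fix \<omega> assume "\<omega> \<in> (\<Union>a\<in>F. agreeing (Suc i) a)"
      then obtain a where a: "a \<in> F" "\<omega> \<in> agreeing (Suc i) a" by auto
      have "\<omega> \<sigma> \<in> A \<sigma>" if "\<sigma> \<in> J" for \<sigma>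
        using a that JW by (auto simp: F_def agreeing_def W_def)
      thus "\<omega> \<in> prod_emb (words q) (\<lambda>_. count_space UNIV) J (Pi\<^sub>E J A)"
        using a by (auto simp: prod_emb_def agreeing_def space_P)
    qed
    have disj: "disjoint_family_on (agreeing (Suc i)) F"
    proof (unfold disjoint_family_on_def, intro ballI impI)
      fix a b assume ab: "a \<in> F" "b \<in> F" "a \<noteq> b"
      have "a = b" if "\<omega> \<in> agreeing (Suc i) a" "\<omega> \<in> agreeing (Suc i) b" for \<omega>
        using that ab by (intro PiE_ext[of a W "\<lambda>_. UNIV" b]) (auto simp: F_def agreeing_def W_def)
      thus "agreeing (Suc i) a \<inter> agreeing (Suc i) b = {}" using ab by auto
    qed
    have "emeasure (distr branches P graft) (\<Union>a\<in>F. agreeing (Suc i) a)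
        = (\<Sum>a\<in>F. emeasure (distr branches P graft) (agreeing (Suc i) a))"
      using finF disj by (intro sum_emeasure[symmetric]) auto
    also have "\<dots> = (\<Sum>a\<in>F. emeasure P (agreeing (Suc i) a))" by (simp only: emeasure_graft_agreeing)
    also have "\<dots> = emeasure P (\<Union>a\<in>F. agreeing (Suc i) a)"
      using finF disj by (intro sum_emeasure) auto
    finally show "emeasure (distr branches P graft) (prod_emb (words q) (\<lambda>_. count_space UNIV) J (Pi\<^sub>E J A))
       = emeasure P (prod_emb (words q) (\<lambda>_. count_space UNIV) J (Pi\<^sub>E J A))" by (simp only: eq)
  qed
qed

definition extinct :: "nat list \<Rightarrow> bool" where
  "extinct = (\<lambda>\<tau>\<in>words q. False)"

lemma extinct_space [simp]: "extinct \<in> space P"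
  by (auto simp: extinct_def space_P)

lemma not_extinct [simp]: "\<tau> \<in> words q \<Longrightarrow> \<not> extinct \<tau>"
  by (simp add: extinct_def)

lemma prune_True: "\<omega> \<in> space P \<Longrightarrow> prune (\<omega>, True) = \<omega>"
  by (auto simp: prune_def space_P fun_eq_iff PiE_def extensional_def)

lemma prune_False: "prune (\<omega>, False) = extinct"
  by (simp add: prune_def extinct_def)

lemma subtree_graft: "j \<in> {1..q} \<Longrightarrow> subtree [j] (graft y) = prune (y j)"
  by (auto simp: graft_def subtree_def prune_def fun_eq_iff)

lemma nn_integral_prune:
  assumes [measurable]: "u \<in> borel_measurable P"
  shows "(\<integral>\<^sup>+z. u (prune z) \<partial>branch) = ennreal p * (\<integral>\<^sup>+\<omega>. u \<omega> \<partial>P) + ennreal (1 - p) * u extinct"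
proof -
  have "(\<integral>\<^sup>+z. u (prune z) \<partial>branch) = (\<integral>\<^sup>+\<omega>. \<integral>\<^sup>+t. u (prune (\<omega>, t)) \<partial>coin \<partial>P)"
    by (intro measure_pmf.nn_integral_fst[symmetric]) measurable
  also have "\<dots> = (\<integral>\<^sup>+\<omega>. ennreal p * u \<omega> + ennreal (1 - p) * u extinct \<partial>P)"
    using p_pos subunit
    by (intro nn_integral_cong)
       (simp add: nn_integral_measure_pmf_finite[of "bernoulli_pmf p"] prune_True prune_False mult.commute UNIV_bool add.commute)
  also have "\<dots> = ennreal p * (\<integral>\<^sup>+\<omega>. u \<omega> \<partial>P) + ennreal (1 - p) * u extinct"
    by (simp add: nn_integral_add nn_integral_cmult emeasure_space_1)
  finally show ?thesis .
qed

text \<open>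
  The subtree at a word of length one has the law of the percolation with probability \<open>p\<close>, and is
  extinct otherwise.
\<close>

lemma nn_integral_subtree:
  assumes "j \<in> {1..q}" and [measurable]: "u \<in> borel_measurable P"
  shows "(\<integral>\<^sup>+\<omega>. u (subtree [j] \<omega>) \<partial>P) = ennreal p * (\<integral>\<^sup>+\<omega>. u \<omega> \<partial>P) + ennreal (1 - p) * u extinct"
proof -
  have [measurable]: "subtree [j] \<in> P \<rightarrow>\<^sub>M P" by (intro measurable_subtree) (use assms in auto)
  have [measurable]: "(\<lambda>y. y j) \<in> branches \<rightarrow>\<^sub>M branch" using assms by measurable
  have "(\<integral>\<^sup>+\<omega>. u (subtree [j] \<omega>) \<partial>P) = (\<integral>\<^sup>+\<omega>. u (subtree [j] \<omega>) \<partial>distr branches P graft)"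
    by (simp add: distr_graft)
  also have "\<dots> = (\<integral>\<^sup>+y. u (prune (y j)) \<partial>branches)"
    by (subst nn_integral_distr) (auto simp: subtree_graft[OF assms(1)])
  also have "\<dots> = (\<integral>\<^sup>+z. u (prune z) \<partial>distr branches branch (\<lambda>y. y j))"
    by (subst nn_integral_distr) auto
  also have "distr branches branch (\<lambda>y. y j) = branch"
    using assms prob_space_branch by (intro distr_PiM_component) auto
  finally show ?thesis by (simp add: nn_integral_prune)
qed

text \<open>
  Only chosen subtrees inherit almost sure properties, because an extinct subtree occurs with
  positive probability.
\<close>

lemma AE_subtree_chosen:
  assumes "j \<in> {1..q}" "AE \<omega> in P. Q \<omega>"
  shows "AE \<omega> in P. \<omega> [j] \<longrightarrow> Q (subtree [j] \<omega>)"
proof -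
  obtain N where N: "N \<in> sets P" "emeasure P N = 0" "{\<omega>\<in>space P. \<not> Q \<omega>} \<subseteq> N"
    using assms(2) by (auto elim: AE_E)
  have j: "[j] \<in> words q" using assms by simp
  have [measurable]: "subtree [j] \<in> P \<rightarrow>\<^sub>M P" by (intro measurable_subtree j)
  define u where "u = (\<lambda>\<omega>. indicator {\<omega> \<in> N. \<omega> []} \<omega> :: ennreal)"
  have "{\<omega> \<in> N. \<omega> []} = {\<omega> \<in> space P. \<omega> []} \<inter> N" using sets.sets_into_space[OF N(1)] by auto
  also have "\<dots> \<in> sets P" using measurable_letter[of "[]"] N by measurable
  finally have meas: "{\<omega> \<in> N. \<omega> []} \<in> sets P" .
  hence [measurable]: "u \<in> borel_measurable P" by (simp add: u_def)
  have "emeasure P {\<omega> \<in> N. \<omega> []} \<le> emeasure P N" using meas N by (intro emeasure_mono) auto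
  hence "(\<integral>\<^sup>+\<omega>. u \<omega> \<partial>P) = 0" using N by (simp add: u_def nn_integral_indicator[OF meas])
  moreover have "u extinct = 0" by (simp add: u_def)
  ultimately have "(\<integral>\<^sup>+\<omega>. u (subtree [j] \<omega>) \<partial>P) = 0" using nn_integral_subtree[of j u] assms(1) by simp
  hence "AE \<omega> in P. u (subtree [j] \<omega>) = 0" by (subst (asm) nn_integral_0_iff_AE) auto
  thus ?thesis using AE_space
  proof eventually_elim
    case (elim \<omega>)
    thus ?case using N(3) subtree_space[OF j, of \<omega>] by (auto simp: u_def indicator_def subtree_apply split: if_splits)
  qed
qed

definition hereditary :: "(nat list \<Rightarrow> bool) \<Rightarrow> bool" where
  "hereditary \<omega> \<longleftrightarrow> \<omega> [] \<and> (\<forall>\<sigma>\<in>words q. \<forall>\<tau>\<in>words q. \<omega> (\<sigma> @ \<tau>) \<longrightarrow> \<omega> \<sigma>)"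

text \<open>
  The event that a word is neglected while one of its descendants is chosen is pushed to the subtree
  of the first letter, and it does not contain the extinct configuration.
\<close>

lemma AE_hereditary: "AE \<omega> in P. hereditary \<omega>"
proof -
  have "AE \<omega> in P. \<omega> (\<sigma> @ \<tau>) \<longrightarrow> \<omega> \<sigma>" if "\<sigma> \<in> words q" "\<tau> \<in> words q" for \<sigma> \<tau>
    using that(1)
  proof (induction \<sigma>)
    case Nil
    show ?case using AE_root by eventually_elim simp
  next
    case (Cons j \<sigma>)
    hence j: "j \<in> {1..q}" and \<sigma> [simp]: "\<sigma> \<in> words q" by auto
    define A where "A = {\<omega> \<in> space P. \<omega> (\<sigma> @ \<tau>) \<and> \<not> \<omega> \<sigma>}"
    have [measurable]: "A \<in> sets P"
    proof -
      have [measurable]: "(\<lambda>\<omega>. \<omega> (\<sigma> @ \<tau>)) \<in> P \<rightarrow>\<^sub>M count_space UNIV" "(\<lambda>\<omega>. \<omega> \<sigma>) \<in> P \<rightarrow>\<^sub>M count_space UNIV"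
        using that by (auto intro!: measurable_letter)
      show ?thesis unfolding A_def by measurable
    qed
    have [measurable]: "subtree [j] \<in> P \<rightarrow>\<^sub>M P" by (intro measurable_subtree) (use j in auto)
    have "AE \<omega> in P. \<omega> \<notin> A" using Cons.IH[OF \<sigma>] by eventually_elim (auto simp: A_def)
    hence "(\<integral>\<^sup>+\<omega>. indicator A \<omega> \<partial>P) = 0" by (subst nn_integral_0_iff_AE) auto
    moreover have "extinct \<notin> A" using that by (auto simp: A_def)
    ultimately have "(\<integral>\<^sup>+\<omega>. indicator A (subtree [j] \<omega>) \<partial>P) = 0"
      by (subst nn_integral_subtree[OF j]) auto
    hence "AE \<omega> in P. (indicator A (subtree [j] \<omega>) :: ennreal) = 0"
      by (subst (asm) nn_integral_0_iff_AE) auto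
    thus ?case using AE_space
    proof eventually_elim
      case (elim \<omega>)
      thus ?case using subtree_space[of "[j]" \<omega>] j by (auto simp: A_def indicator_def subtree_apply split: if_splits)
    qed
  qed
  hence "AE \<omega> in P. \<forall>\<sigma>\<in>words q. \<forall>\<tau>\<in>words q. \<omega> (\<sigma> @ \<tau>) \<longrightarrow> \<omega> \<sigma>"
    unfolding AE_ball_countable[OF countable_words] by blast
  thus ?thesis using AE_root by eventually_elim (auto simp: hereditary_def)
qed

lemma hereditaryD: "hereditary \<omega> \<Longrightarrow> \<omega> (\<sigma> @ \<tau>) \<Longrightarrow> \<sigma> \<in> words q \<Longrightarrow> \<tau> \<in> words q \<Longrightarrow> \<omega> \<sigma>"
  by (auto simp: hereditary_def)

lemma hereditary_subtree:
  assumes "hereditary \<omega>" "\<sigma> \<in> words q" "\<omega> \<sigma>"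
  shows "hereditary (subtree \<sigma> \<omega>)"
  unfolding hereditary_def
proof (intro conjI ballI impI)
  fix \<sigma>' \<tau> assume *: "\<sigma>' \<in> words q" "\<tau> \<in> words q" "subtree \<sigma> \<omega> (\<sigma>' @ \<tau>)"
  have "\<omega> (\<sigma> @ \<sigma>')"
    by (rule hereditaryD[OF assms(1), of _ \<tau>]) (use * assms in \<open>auto simp: subtree_apply\<close>)
  thus "subtree \<sigma> \<omega> \<sigma>'" by (simp add: subtree_apply)
qed (use assms in \<open>auto simp: subtree_apply\<close>)

text \<open>
  Almost sure properties hold for all chosen subtrees simultaneously, as there are countably many
  words.  This is what allows pointwise recursions along the tree.
\<close>

lemma AE_all_subtrees:
  assumes "AE \<omega> in P. Q \<omega>"
  shows "AE \<omega> in P. \<forall>\<sigma>\<in>words q. \<omega> \<sigma> \<longrightarrow> Q (subtree \<sigma> \<omega>)"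
proof -
  have "AE \<omega> in P. \<omega> \<sigma> \<longrightarrow> Q (subtree \<sigma> \<omega>)" if "\<sigma> \<in> words q" for \<sigma>
    using that
  proof (induction \<sigma>)
    case Nil
    show ?case using assms by eventually_elim simp
  next
    case (Cons j \<sigma>)
    hence "j \<in> {1..q}" "\<sigma> \<in> words q" by auto
    from AE_subtree_chosen[OF this(1) Cons.IH[OF this(2)]] AE_hereditary
    show ?case
    proof eventually_elim
      case (elim \<omega>)
      thus ?case using hereditaryD[OF elim(2), of "[j]" \<sigma>] \<open>j \<in> _\<close> \<open>\<sigma> \<in> _\<close> by (auto simp: subtree_apply)
    qed
  qed
  thus ?thesis by (simp add: AE_ball_countable)
qed

lemma integral_child:
  fixes f :: "(nat list \<Rightarrow> bool) \<Rightarrow> real"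
  assumes j: "j \<in> {1..q}" and f: "integrable P f"
  shows "integrable P (\<lambda>\<omega>. if \<omega> [j] then f (subtree [j] \<omega>) else 0)"
    and "(\<integral>\<omega>. (if \<omega> [j] then f (subtree [j] \<omega>) else 0) \<partial>P) = p * (\<integral>\<omega>. f \<omega> \<partial>P)"
proof -
  have [measurable]: "subtree [j] \<in> P \<rightarrow>\<^sub>M P" by (intro measurable_subtree) (use j in auto)
  have [measurable]: "(\<lambda>\<omega>. \<omega> [j]) \<in> P \<rightarrow>\<^sub>M count_space UNIV" "(\<lambda>\<omega>. \<omega> []) \<in> P \<rightarrow>\<^sub>M count_space UNIV"
    using j by (auto intro!: measurable_letter)
  have [measurable]: "f \<in> borel_measurable P" using f by simp
  \<comment> \<open>Restricted to the event that \<open>j\<close> is chosen, the law of its subtree is \<open>p\<close> times the law of the percolation.\<close>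
  define D where "D = density P (\<lambda>\<omega>. ennreal (if \<omega> [j] then 1 else 0))"
  have [measurable_cong]: "sets D = sets P" by (simp add: D_def)
  have eq: "distr D P (subtree [j]) = density P (\<lambda>_. ennreal p)"
  proof (rule measure_eqI)
    fix A assume "A \<in> sets (distr D P (subtree [j]))"
    hence [measurable]: "A \<in> sets P" by simp
    have root: "AE \<omega> in P. \<omega> []" by (rule AE_root)
    have "emeasure (distr D P (subtree [j])) A = emeasure D (subtree [j] -` A \<inter> space P)"
      by (subst emeasure_distr) (auto simp: D_def)
    also have "\<dots> = (\<integral>\<^sup>+\<omega>. ennreal (if \<omega> [j] then 1 else 0) * indicator (subtree [j] -` A \<inter> space P) \<omega> \<partial>P)"
      unfolding D_def by (intro emeasure_density) measurable
    also have "\<dots> = (\<integral>\<^sup>+\<omega>. (\<lambda>\<omega>. if \<omega> [] then indicator A \<omega> else 0) (subtree [j] \<omega>) \<partial>P)"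
      by (intro nn_integral_cong) (auto simp: indicator_def subtree_apply)
    also have "\<dots> = ennreal p * (\<integral>\<^sup>+\<omega>. (if \<omega> [] then indicator A \<omega> else 0) \<partial>P)"
      by (subst nn_integral_subtree[OF j]) auto
    also have "(\<integral>\<^sup>+\<omega>. (if \<omega> [] then indicator A \<omega> else 0) \<partial>P) = (\<integral>\<^sup>+\<omega>. indicator A \<omega> \<partial>P)"
      using root by (intro nn_integral_cong_AE) (auto elim!: eventually_mono)
    finally show "emeasure (distr D P (subtree [j])) A = emeasure (density P (\<lambda>_. ennreal p)) A"
      by (simp add: emeasure_density nn_integral_cmult)
  qed simp
  have "integrable (distr D P (subtree [j])) f"
    unfolding eq using f p_pos by (subst integrable_density) auto
  hence "integrable D (\<lambda>\<omega>. f (subtree [j] \<omega>))"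
    by (rule integrable_distr[rotated]) (simp add: D_def)
  hence *: "integrable P (\<lambda>\<omega>. (if \<omega> [j] then 1 else 0) *\<^sub>R f (subtree [j] \<omega>))"
    unfolding D_def by (subst (asm) integrable_density) auto
  have if_eq: "(\<lambda>\<omega>. (if \<omega> [j] then 1 else 0) *\<^sub>R f (subtree [j] \<omega>)) = (\<lambda>\<omega>. if \<omega> [j] then f (subtree [j] \<omega>) else 0)"
    by auto
  show "integrable P (\<lambda>\<omega>. if \<omega> [j] then f (subtree [j] \<omega>) else 0)" using * by (simp only: if_eq)
  have "(\<integral>\<omega>. f \<omega> \<partial>distr D P (subtree [j])) = (\<integral>\<omega>. f (subtree [j] \<omega>) \<partial>D)"
    by (rule integral_distr) (auto simp: D_def)
  also have "\<dots> = (\<integral>\<omega>. (if \<omega> [j] then 1 else 0) *\<^sub>R f (subtree [j] \<omega>) \<partial>P)"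
    unfolding D_def by (rule integral_density) auto
  finally show "(\<integral>\<omega>. (if \<omega> [j] then f (subtree [j] \<omega>) else 0) \<partial>P) = p * (\<integral>\<omega>. f \<omega> \<partial>P)"
    unfolding if_eq eq using p_pos by (simp add: integral_density)
qed

text \<open>
  Distinct subtrees are functions of distinct coordinates of the product measure in
  \<open>distr_graft\<close>, hence independent.
\<close>

lemma integral_two_children:
  fixes f :: "(nat list \<Rightarrow> bool) \<Rightarrow> real"
  assumes ij: "i \<in> {1..q}" "j \<in> {1..q}" "i \<noteq> j" and f: "integrable P f"
  defines "c \<equiv> (\<lambda>j \<omega>. if \<omega> [j] then f (subtree [j] \<omega>) else 0)"
  shows "integrable P (\<lambda>\<omega>. c i \<omega> * c j \<omega>)"
    and "(\<integral>\<omega>. c i \<omega> * c j \<omega> \<partial>P) = (p * (\<integral>\<omega>. f \<omega> \<partial>P))\<^sup>2"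
proof -
  interpret B: product_prob_space "\<lambda>_. branch" "{1..q}"
    by (rule product_prob_space_branch)
  define u where "u = (\<lambda>z. if prune z [] then f (prune z) else 0)"
  have [measurable]: "f \<in> borel_measurable P" using f by simp
  have [measurable]: "(\<lambda>\<omega>. \<omega> []) \<in> P \<rightarrow>\<^sub>M count_space UNIV" by (auto intro!: measurable_letter)
  have u_meas [measurable]: "u \<in> borel_measurable branch" unfolding u_def by measurable
  have proj [measurable]: "(\<lambda>y. y k) \<in> branches \<rightarrow>\<^sub>M branch" if "k \<in> {1..q}" for k using that by measurable
  have sub [measurable]: "subtree [k] \<in> P \<rightarrow>\<^sub>M P" if "k \<in> {1..q}" for k
    by (intro measurable_subtree) (use that in auto)
  have lett [measurable]: "(\<lambda>\<omega>. \<omega> [k]) \<in> P \<rightarrow>\<^sub>M count_space UNIV" if "k \<in> {1..q}" for k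
    using that by (auto intro!: measurable_letter)
  have c_meas [measurable]: "c k \<in> borel_measurable P" if k: "k \<in> {1..q}" for k
    unfolding c_def using lett[OF k] measurable_compose[OF sub[OF k] \<open>f \<in> borel_measurable P\<close>] by measurable
  have c_graft: "c k (graft y) = u (y k)" if "k \<in> {1..q}" for k y
  proof -
    have "graft y [k] = prune (y k) []"
      using fun_cong[OF subtree_graft[OF that, of y], of "[]"] by (simp only: subtree_apply append.simps)
    thus ?thesis by (simp add: c_def u_def subtree_graft[OF that])
  qed
  have dist: "distr branches branch (\<lambda>y. y k) = branch" if "k \<in> {1..q}" for k
    using that prob_space_branch by (intro distr_PiM_component) auto
  have u_int: "integrable branch u" and u_val: "integral\<^sup>L branch u = p * (\<integral>\<omega>. f \<omega> \<partial>P)"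
  proof -
    have "integrable (distr branches P graft) (c i)"
      unfolding distr_graft c_def by (rule integral_child(1)[OF ij(1) f])
    hence "integrable branches (\<lambda>y. c i (graft y))" by (rule integrable_distr[OF measurable_graft])
    hence "integrable (distr branches branch (\<lambda>y. y i)) u"
      by (subst integrable_distr_eq[OF proj[OF ij(1)] u_meas]) (simp add: c_graft[OF ij(1)])
    thus "integrable branch u" unfolding dist[OF ij(1)] .
    have "(\<integral>\<omega>. c i \<omega> \<partial>P) = (\<integral>\<omega>. c i \<omega> \<partial>distr branches P graft)" by (simp add: distr_graft)
    also have "\<dots> = (\<integral>y. u (y i) \<partial>branches)"
      by (subst integral_distr[OF measurable_graft c_meas[OF ij(1)]]) (simp add: c_graft[OF ij(1)])
    also have "\<dots> = integral\<^sup>L (distr branches branch (\<lambda>y. y i)) u"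
      by (rule integral_distr[OF proj[OF ij(1)] u_meas, symmetric])
    finally show "integral\<^sup>L branch u = p * (\<integral>\<omega>. f \<omega> \<partial>P)"
      using integral_child(2)[OF ij(1) f] unfolding dist[OF ij(1)] c_def by simp
  qed
  define g where "g = (\<lambda>k z. if k = i \<or> k = j then u z else 1)"
  have g_int: "integrable branch (g k)" for k
    using u_int prob_space.finite_measure[OF prob_space_branch]
    by (cases "k = i \<or> k = j") (auto simp: g_def[abs_def] finite_measure.integrable_const)
  have split: "(\<Prod>k\<in>{1..q}. h k) = h i * h j"
    if "\<And>k. k \<noteq> i \<Longrightarrow> k \<noteq> j \<Longrightarrow> h k = 1" for h :: "nat \<Rightarrow> real"
  proof -
    have "(\<Prod>k\<in>{1..q}. h k) = (\<Prod>k\<in>{i, j}. h k)"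
      using ij that by (intro prod.mono_neutral_right) auto
    thus ?thesis using ij by simp
  qed
  have prod_eq: "(\<Prod>k\<in>{1..q}. g k (y k)) = c i (graft y) * c j (graft y)" for y
    by (subst split) (simp_all add: g_def c_graft[OF ij(1)] c_graft[OF ij(2)])
  have int: "integrable branches (\<lambda>y. c i (graft y) * c j (graft y))"
    unfolding prod_eq[symmetric] by (rule B.product_integrable_prod) (auto simp: g_int)
  have "integrable (distr branches P graft) (\<lambda>\<omega>. c i \<omega> * c j \<omega>)"
    using int by (subst integrable_distr_eq) (auto intro!: borel_measurable_times c_meas ij)
  thus "integrable P (\<lambda>\<omega>. c i \<omega> * c j \<omega>)" by (simp add: distr_graft)
  have "(\<integral>\<omega>. c i \<omega> * c j \<omega> \<partial>P) = (\<integral>\<omega>. c i \<omega> * c j \<omega> \<partial>distr branches P graft)"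
    by (simp add: distr_graft)
  also have "\<dots> = (\<integral>y. c i (graft y) * c j (graft y) \<partial>branches)"
    by (subst integral_distr) (auto intro!: borel_measurable_times c_meas ij)
  also have "\<dots> = (\<Prod>k\<in>{1..q}. integral\<^sup>L branch (g k))"
    unfolding prod_eq[symmetric] by (rule B.product_integral_prod) (auto simp: g_int)
  also have "\<dots> = integral\<^sup>L branch (g i) * integral\<^sup>L branch (g j)"
    by (rule split) (simp add: g_def prob_space.prob_space[OF prob_space_branch])
  also have "\<dots> = (p * (\<integral>\<omega>. f \<omega> \<partial>P))\<^sup>2"
    by (simp add: g_def u_val power2_eq_square)
  finally show "(\<integral>\<omega>. c i \<omega> * c j \<omega> \<partial>P) = (p * (\<integral>\<omega>. f \<omega> \<partial>P))\<^sup>2" .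
qed

text \<open>
  Since \<open>p < 1\<close>, a subtree is extinct with positive probability, so it can be confined either to an
  event of positive probability or to any event that contains the extinct configuration.
\<close>

lemma prob_subtrees_pos:
  assumes H: "\<And>j. j \<in> {1..q} \<Longrightarrow> H j \<in> sets P"
    and pos: "\<And>j. j \<in> {1..q} \<Longrightarrow> 0 < prob (H j) \<or> extinct \<in> H j"
  shows "0 < prob {\<omega> \<in> space P. \<forall>j\<in>{1..q}. subtree [j] \<omega> \<in> H j}"
proof -
  interpret B: product_prob_space "\<lambda>_. branch" "{1..q}"
    by (rule product_prob_space_branch)
  have sub: "subtree [k] \<in> P \<rightarrow>\<^sub>M P" if "k \<in> {1..q}" for k
    by (intro measurable_subtree) (use that in auto)
  have A: "{\<omega> \<in> space P. \<forall>j\<in>{1..q}. subtree [j] \<omega> \<in> H j} \<in> sets P"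
  proof (rule sets.sets_Collect_finite_All)
    fix j assume j: "j \<in> {1..q}"
    note [measurable] = sub[OF j] H[OF j]
    show "{\<omega> \<in> space P. subtree [j] \<omega> \<in> H j} \<in> sets P" by measurable
  qed simp
  have "emeasure P {\<omega> \<in> space P. \<forall>j\<in>{1..q}. subtree [j] \<omega> \<in> H j}
      = emeasure (distr branches P graft) {\<omega> \<in> space P. \<forall>j\<in>{1..q}. subtree [j] \<omega> \<in> H j}"
    by (simp add: distr_graft)
  also have "\<dots> = emeasure branches {y \<in> space branches. \<forall>j\<in>{1..q}. y j \<in> {z \<in> space branch. prune z \<in> H j}}"
  proof (subst emeasure_distr[OF measurable_graft A], rule arg_cong[where f = "emeasure branches"])
    show "graft -` {\<omega> \<in> space P. \<forall>j\<in>{1..q}. subtree [j] \<omega> \<in> H j} \<inter> space branches =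
        {y \<in> space branches. \<forall>j\<in>{1..q}. y j \<in> {z \<in> space branch. prune z \<in> H j}}"
      (is "?L = ?R")
    proof (rule set_eqI)
      fix y
      have "y \<in> ?L \<longleftrightarrow> y \<in> space branches \<and> (\<forall>j\<in>{1..q}. prune (y j) \<in> H j)"
        using measurable_space[OF measurable_graft, of y] subtree_graft[of _ y]
        unfolding vimage_eq Int_iff mem_Collect_eq by metis
      also have "\<dots> \<longleftrightarrow> y \<in> ?R"
        using PiE_mem[of y "{1..q}" "\<lambda>_. space branch"]
        unfolding mem_Collect_eq space_PiM by metis
      finally show "y \<in> ?L \<longleftrightarrow> y \<in> ?R" .
    qed
  qed
  also have "\<dots> = (\<Prod>j\<in>{1..q}. emeasure branch {z \<in> space branch. prune z \<in> H j})"
  proof (rule B.emeasure_PiM_Collect)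
    fix j assume j: "j \<in> {1..q}"
    note [measurable] = H[OF j]
    show "{z \<in> space branch. prune z \<in> H j} \<in> sets branch" by measurable
  qed auto
  also have "\<dots> > 0"
  proof -
    have "emeasure branch {z \<in> space branch. prune z \<in> H j} \<noteq> 0" if j: "j \<in> {1..q}" for j
    proof -
      note [measurable] = H[OF j]
      have "emeasure branch {z \<in> space branch. prune z \<in> H j} = (\<integral>\<^sup>+z. indicator (H j) (prune z) \<partial>branch)"
        by (subst nn_integral_indicator[symmetric], measurable, intro nn_integral_cong) (simp add: indicator_def)
      also have "\<dots> = ennreal p * emeasure P (H j) + ennreal (1 - p) * indicator (H j) extinct"
        by (subst nn_integral_prune) auto
      also have "\<dots> \<noteq> 0"
        using pos[OF j] p_pos subunit by (auto simp: emeasure_eq_measure)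
      finally show ?thesis .
    qed
    thus ?thesis by (auto simp: zero_less_iff_neq_zero)
  qed
  finally show ?thesis by (simp add: emeasure_eq_measure)
qed

section \<open>The averaging operator\<close>

text \<open>
  The reciprocal of the expected number of children.  It equals \<open>k\<^bsup>-d\<^esup>\<close> for the dimension \<open>d\<close> of
  the limit set, so it is the factor by which the natural measure scales from one level to the
  next.
\<close>

definition rate :: real where "rate = 1 / (real q * p)"

lemma rate_pos: "0 < rate" using p_pos letters_pos by (simp add: rate_def)
lemma rate_less_1: "rate < 1"
  using supercritical p_pos letters_pos by (simp add: rate_def field_simps)
lemma rate_mult: "rate * (real q * p) = 1" using p_pos letters_pos by (simp add: rate_def)

text \<open>
  Almost surely, the \<open>n\<close>-th power of the operator that sums a function over the chosen subtrees
  of the first generation and multiplies by \<open>rate\<close>.  On the constant function one it gives the normalised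
  population sizes.
\<close>

definition descend :: "nat \<Rightarrow> ((nat list \<Rightarrow> bool) \<Rightarrow> real) \<Rightarrow> (nat list \<Rightarrow> bool) \<Rightarrow> real" where
  "descend n f \<omega> = rate ^ n * (\<Sum>\<tau>\<in>words_at q n. if \<omega> \<tau> then f (subtree \<tau> \<omega>) else 0)"

lemma words_at_words: "\<tau> \<in> words_at q n \<Longrightarrow> \<tau> \<in> words q" by (simp add: words_at_def)

lemma descend_0: "descend 0 f \<omega> = (if \<omega> [] then f \<omega> else 0)"
  by (simp add: descend_def)

lemma descend_Suc: "descend (Suc n) f \<omega> = rate * (\<Sum>j\<in>{1..q}. descend n f (subtree [j] \<omega>))"
  by (simp add: descend_def sum_words_at_Suc sum_distrib_left subtree_apply mult.assoc cong: if_cong)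

lemma descend_neglected:
  assumes "hereditary \<omega>" "\<sigma> \<in> words q" "\<not> \<omega> \<sigma>"
  shows "descend n f (subtree \<sigma> \<omega>) = 0"
proof -
  have "\<not> \<omega> (\<sigma> @ \<tau>)" if "\<tau> \<in> words_at q n" for \<tau>
    using hereditaryD[OF assms(1), of \<sigma> \<tau>] assms that words_at_words by blast
  thus ?thesis by (auto simp: descend_def subtree_apply intro!: sum.neutral)
qed

lemma descend_cong:
  assumes "\<And>\<tau>. \<tau> \<in> words_at q n \<Longrightarrow> \<omega> \<tau> \<Longrightarrow> f (subtree \<tau> \<omega>) = g (subtree \<tau> \<omega>)"
  shows "descend n f \<omega> = descend n g \<omega>"
  unfolding descend_def using assms by (intro arg_cong2[where f = "(*)"] sum.cong refl) auto

lemma descend_diff: "descend n (\<lambda>\<omega>. f \<omega> - g \<omega>) \<omega> = descend n f \<omega> - descend n g \<omega>"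
  unfolding descend_def right_diff_distrib[symmetric] sum_subtractf[symmetric]
  by (intro arg_cong2[where f = "(*)"] sum.cong refl) auto

lemma descend_cmult: "descend n (\<lambda>\<omega>. b * f \<omega>) \<omega> = b * descend n f \<omega>"
  unfolding descend_def by (auto simp: sum_distrib_left intro!: sum.cong)

lemma descend_tendsto:
  assumes "\<And>\<tau>. \<tau> \<in> words_at q n \<Longrightarrow> \<omega> \<tau> \<Longrightarrow> (\<lambda>m. f m (subtree \<tau> \<omega>)) \<longlonglongrightarrow> g (subtree \<tau> \<omega>)"
  shows "(\<lambda>m. descend n (f m) \<omega>) \<longlonglongrightarrow> descend n g \<omega>"
  unfolding descend_def using assms by (intro tendsto_intros) auto

text \<open>
  The semigroup property needs heredity: a word of level \<open>n + m\<close> contributes on the left only if its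
  prefix of length \<open>n\<close> is chosen as well.
\<close>

lemma descend_descend:
  assumes "hereditary \<omega>"
  shows "descend n (descend m f) \<omega> = descend (n + m) f \<omega>"
  using assms
proof (induction n arbitrary: \<omega>)
  case 0
  thus ?case by (simp add: descend_0 hereditary_def)
next
  case (Suc n)
  have "descend n (descend m f) (subtree [j] \<omega>) = descend (n + m) f (subtree [j] \<omega>)" if "j \<in> {1..q}" for j
  proof (cases "\<omega> [j]")
    case True
    thus ?thesis using that Suc by (intro Suc.IH hereditary_subtree) auto
  next
    case False
    thus ?thesis using that Suc.prems by (simp add: descend_neglected)
  qed
  thus ?case by (simp add: descend_Suc)
qed

lemma measurable_descend [measurable]:
  assumes [measurable]: "f \<in> borel_measurable P"
  shows "descend n f \<in> borel_measurable P"
proof -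
  have "(\<lambda>\<omega>. if \<omega> \<tau> then f (subtree \<tau> \<omega>) else 0) \<in> borel_measurable P" if "\<tau> \<in> words_at q n" for \<tau>
  proof -
    note [measurable] = measurable_letter[OF words_at_words[OF that]] measurable_subtree[OF words_at_words[OF that]]
    show ?thesis by measurable
  qed
  thus ?thesis unfolding descend_def[abs_def] by (intro borel_measurable_times borel_measurable_sum) auto
qed

definition L2 :: "((nat list \<Rightarrow> bool) \<Rightarrow> real) \<Rightarrow> bool" where
  "L2 f \<longleftrightarrow> f \<in> borel_measurable P \<and> integrable P (\<lambda>\<omega>. (f \<omega>)\<^sup>2)"

abbreviation second_moment :: "((nat list \<Rightarrow> bool) \<Rightarrow> real) \<Rightarrow> real" where
  "second_moment f \<equiv> expectation (\<lambda>\<omega>. (f \<omega>)\<^sup>2)"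

lemma L2_measurable: "L2 f \<Longrightarrow> f \<in> borel_measurable P" by (simp add: L2_def)
lemma L2_integrable: "L2 f \<Longrightarrow> integrable P f"
  unfolding L2_def using square_integrable_imp_integrable by blast

lemma L2_const: "L2 (\<lambda>_. c)" by (simp add: L2_def)

lemma L2_bound:
  assumes "L2 g" "f \<in> borel_measurable P" "AE \<omega> in P. \<bar>f \<omega>\<bar> \<le> \<bar>g \<omega>\<bar>"
  shows "L2 f"
proof -
  have "AE \<omega> in P. norm ((f \<omega>)\<^sup>2) \<le> norm ((g \<omega>)\<^sup>2)"
    using assms(3) by eventually_elim (simp add: abs_le_square_iff)
  thus ?thesis using assms by (auto simp: L2_def intro: Bochner_Integration.integrable_bound)
qed

lemma L2_diff:
  assumes "L2 f" "L2 g" shows "L2 (\<lambda>\<omega>. f \<omega> - g \<omega>)"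
proof -
  have [measurable]: "f \<in> borel_measurable P" "g \<in> borel_measurable P" using assms by (auto simp: L2_def)
  have "integrable P (\<lambda>\<omega>. 2 * (f \<omega>)\<^sup>2 + 2 * (g \<omega>)\<^sup>2)" using assms by (auto simp: L2_def)
  moreover have "AE \<omega> in P. norm ((f \<omega> - g \<omega>)\<^sup>2) \<le> norm (2 * (f \<omega>)\<^sup>2 + 2 * (g \<omega>)\<^sup>2)"
  proof (intro AE_I2)
    fix \<omega>
    have "(f \<omega> - g \<omega>)\<^sup>2 + (f \<omega> + g \<omega>)\<^sup>2 = 2 * (f \<omega>)\<^sup>2 + 2 * (g \<omega>)\<^sup>2"
      by (simp add: power2_eq_square algebra_simps)
    moreover have "0 \<le> (f \<omega> + g \<omega>)\<^sup>2" "0 \<le> (f \<omega> - g \<omega>)\<^sup>2" by simp_all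
    ultimately show "norm ((f \<omega> - g \<omega>)\<^sup>2) \<le> norm (2 * (f \<omega>)\<^sup>2 + 2 * (g \<omega>)\<^sup>2)"
      unfolding real_norm_def by linarith
  qed
  ultimately have "integrable P (\<lambda>\<omega>. (f \<omega> - g \<omega>)\<^sup>2)"
    by (intro Bochner_Integration.integrable_bound[where g = "\<lambda>\<omega>. (f \<omega> - g \<omega>)\<^sup>2"]) measurable
  thus ?thesis by (simp add: L2_def)
qed

lemma L2_cmult: "L2 f \<Longrightarrow> L2 (\<lambda>\<omega>. c * f \<omega>)" by (auto simp: L2_def power_mult_distrib)

lemma AE_descend_Suc: "AE \<omega> in P. descend (Suc n) f \<omega> = rate * (\<Sum>j\<in>{1..q}. if \<omega> [j] then descend n f (subtree [j] \<omega>) else 0)"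
  using AE_hereditary
proof eventually_elim
  case (elim \<omega>)
  thus ?case unfolding descend_Suc
    by (intro arg_cong2[where f = "(*)"] sum.cong refl) (simp add: descend_neglected)
qed

text \<open>
  In the square of the sum the diagonal terms contribute \<open>q p\<close> times the second moment of \<open>f\<close>, and
  the off-diagonal terms factorise by independence and contribute at most the squared mean.
\<close>

lemma child_sum:
  assumes f: "L2 f"
  defines "T \<equiv> \<lambda>\<omega>. rate * (\<Sum>j\<in>{1..q}. if \<omega> [j] then f (subtree [j] \<omega>) else 0)"
  shows "integrable P (\<lambda>\<omega>. (T \<omega>)\<^sup>2)" "expectation T = expectation f"
    "second_moment T \<le> rate * second_moment f + (expectation f)\<^sup>2"
proof -
  define c where "c = (\<lambda>j \<omega>. if \<omega> [j] then f (subtree [j] \<omega>) else 0)"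
  have fi: "integrable P f" by (rule L2_integrable[OF f])
  have f2: "integrable P (\<lambda>\<omega>. (f \<omega>)\<^sup>2)" using f by (simp add: L2_def)
  have "expectation T = rate * (\<Sum>j\<in>{1..q}. expectation (c j))"
    unfolding T_def c_def by (subst Bochner_Integration.integral_mult_right_zero, subst Bochner_Integration.integral_sum)
      (use integral_child(1)[OF _ fi] in auto)
  also have "\<dots> = rate * (\<Sum>j\<in>{1..q}. p * expectation f)"
    unfolding c_def by (intro arg_cong2[where f = "(*)"] sum.cong refl integral_child(2) fi)
  also have "\<dots> = rate * (real q * p) * expectation f" by simp
  also have "\<dots> = expectation f" by (simp only: rate_mult mult_1)
  finally show "expectation T = expectation f" .
  define A where "A = p * second_moment f"
  define B where "B = (p * expectation f)\<^sup>2"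
  have sq: "c i \<omega> * c i \<omega> = (if \<omega> [i] then (f (subtree [i] \<omega>))\<^sup>2 else 0)" for i \<omega>
    by (simp add: c_def power2_eq_square)
  have int: "integrable P (\<lambda>\<omega>. c i \<omega> * c j \<omega>)" if "i \<in> {1..q}" "j \<in> {1..q}" for i j
  proof (cases "i = j")
    case True
    thus ?thesis using integral_child(1)[OF that(1) f2] by (simp only: sq)
  next
    case False
    show ?thesis unfolding c_def by (rule integral_two_children(1)[OF that False fi])
  qed
  have val: "expectation (\<lambda>\<omega>. c i \<omega> * c j \<omega>) = (if i = j then A else B)" if "i \<in> {1..q}" "j \<in> {1..q}" for i j
  proof (cases "i = j")
    case True
    show ?thesis unfolding True[symmetric] sq A_def using integral_child(2)[OF that(1) f2] by simp
  next
    case False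
    thus ?thesis using integral_two_children(2)[OF that False fi] unfolding c_def B_def by simp
  qed
  have T2: "(T \<omega>)\<^sup>2 = rate\<^sup>2 * (\<Sum>i\<in>{1..q}. \<Sum>j\<in>{1..q}. c i \<omega> * c j \<omega>)" for \<omega>
    unfolding T_def c_def power_mult_distrib by (simp only: power2_eq_square sum_product)
  show "integrable P (\<lambda>\<omega>. (T \<omega>)\<^sup>2)"
    unfolding T2 by (intro integrable_mult_right Bochner_Integration.integrable_sum int)
  have "second_moment T = rate\<^sup>2 * (\<Sum>i\<in>{1..q}. \<Sum>j\<in>{1..q}. if i = j then A else B)"
  proof -
    have "expectation (\<lambda>\<omega>. \<Sum>i\<in>{1..q}. \<Sum>j\<in>{1..q}. c i \<omega> * c j \<omega>)
       = (\<Sum>i\<in>{1..q}. expectation (\<lambda>\<omega>. \<Sum>j\<in>{1..q}. c i \<omega> * c j \<omega>))"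
      by (intro Bochner_Integration.integral_sum Bochner_Integration.integrable_sum int)
    also have "\<dots> = (\<Sum>i\<in>{1..q}. \<Sum>j\<in>{1..q}. expectation (\<lambda>\<omega>. c i \<omega> * c j \<omega>))"
      by (intro sum.cong refl Bochner_Integration.integral_sum int)
    also have "\<dots> = (\<Sum>i\<in>{1..q}. \<Sum>j\<in>{1..q}. if i = j then A else B)"
      by (intro sum.cong refl val)
    finally show ?thesis unfolding T2 by simp
  qed
  also have "\<dots> \<le> rate\<^sup>2 * (\<Sum>i\<in>{1..q}. \<Sum>j\<in>{1..q}. (if i = j then A else 0) + B)"
    by (intro mult_left_mono sum_mono) (auto simp: A_def B_def p_pos less_imp_le)
  also have "\<dots> = rate\<^sup>2 * (real q * A + (real q)\<^sup>2 * B)"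
    by (simp add: sum.distrib power2_eq_square algebra_simps)
  also have "\<dots> = rate * (rate * (real q * p)) * second_moment f + (rate * (real q * p))\<^sup>2 * (expectation f)\<^sup>2"
    by (simp add: A_def B_def power2_eq_square algebra_simps)
  also have "\<dots> = rate * second_moment f + (expectation f)\<^sup>2"
    by (simp only: rate_mult) simp
  finally show "second_moment T \<le> rate * second_moment f + (expectation f)\<^sup>2" .
qed

lemma descend_Suc_moments:
  assumes "L2 (descend n f)"
  shows "L2 (descend (Suc n) f)" "expectation (descend (Suc n) f) = expectation (descend n f)"
    "second_moment (descend (Suc n) f) \<le>
       rate * second_moment (descend n f) + (expectation (descend n f))\<^sup>2"
proof -
  define T where "T = (\<lambda>\<omega>. rate * (\<Sum>j\<in>{1..q}. if \<omega> [j] then descend n f (subtree [j] \<omega>) else 0))"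
  have eq: "AE \<omega> in P. descend (Suc n) f \<omega> = T \<omega>" unfolding T_def by (rule AE_descend_Suc)
  have meas_child: "(\<lambda>\<omega>. if \<omega> [j] then descend n f (subtree [j] \<omega>) else 0) \<in> borel_measurable P" if "j \<in> {1..q}" for j
    using integral_child(1)[OF that L2_integrable[OF assms]] by simp
  have T_meas [measurable]: "T \<in> borel_measurable P"
    unfolding T_def by (intro borel_measurable_times borel_measurable_sum meas_child) auto
  have D_meas [measurable]: "descend (Suc n) f \<in> borel_measurable P"
  proof -
    have "(\<lambda>\<omega>. descend n f (subtree [j] \<omega>)) \<in> borel_measurable P" if "j \<in> {1..q}" for j
      by (rule measurable_compose[OF measurable_subtree L2_measurable[OF assms]]) (use that in auto)
    thus ?thesis unfolding descend_Suc[abs_def] by (intro borel_measurable_times borel_measurable_sum) auto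
  qed
  have eq2: "AE \<omega> in P. (descend (Suc n) f \<omega>)\<^sup>2 = (T \<omega>)\<^sup>2" using eq by eventually_elim simp
  have c: "integrable P (\<lambda>\<omega>. (T \<omega>)\<^sup>2)" "expectation T = expectation (descend n f)"
    "second_moment T \<le>
       rate * second_moment (descend n f) + (expectation (descend n f))\<^sup>2"
    unfolding T_def by (rule child_sum[OF assms])+
  have "integrable P (\<lambda>\<omega>. (descend (Suc n) f \<omega>)\<^sup>2)"
    using c(1) by (subst integrable_cong_AE[OF _ _ eq2]) auto
  thus "L2 (descend (Suc n) f)" by (simp add: L2_def)
  show "expectation (descend (Suc n) f) = expectation (descend n f)"
    using c(2) integral_cong_AE[OF D_meas T_meas eq] by simp
  have "second_moment (descend (Suc n) f) = second_moment T"
    by (rule integral_cong_AE[OF _ _ eq2]) auto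
  thus "second_moment (descend (Suc n) f) \<le>
       rate * second_moment (descend n f) + (expectation (descend n f))\<^sup>2" using c(3) by simp
qed

lemma AE_descend_0: "AE \<omega> in P. descend 0 f \<omega> = f \<omega>"
  using AE_root by eventually_elim (simp add: descend_0)

lemma descend_moments:
  assumes f: "L2 f"
  shows L2_descend: "L2 (descend n f)" and expectation_descend: "expectation (descend n f) = expectation f"
    and "expectation f = 0 \<Longrightarrow> second_moment (descend n f) \<le> rate ^ n * second_moment f"
proof (induction n)
  case 0
  note [measurable] = L2_measurable[OF f]
  {
    case 1
    have "AE \<omega> in P. \<bar>descend 0 f \<omega>\<bar> \<le> \<bar>f \<omega>\<bar>" using AE_descend_0[of f] by eventually_elim simp
    thus ?case by (intro L2_bound[OF f] measurable_descend L2_measurable[OF f])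
  next
    case 2
    show ?case by (rule integral_cong_AE) (use AE_descend_0[of f] in auto)
  next
    case 3
    have "AE \<omega> in P. (descend 0 f \<omega>)\<^sup>2 = (f \<omega>)\<^sup>2" using AE_descend_0[of f] by eventually_elim simp
    hence "second_moment (descend 0 f) = second_moment f"
      by (rule integral_cong_AE[rotated 2]) measurable
    thus ?case by simp
  }
next
  case (Suc n)
  {
    case 1 show ?case by (rule descend_Suc_moments(1)[OF Suc(1)])
  next
    case 2 show ?case using descend_Suc_moments(2)[OF Suc(1)] Suc(2) by simp
  next
    case 3
    have "second_moment (descend (Suc n) f) \<le> rate * second_moment (descend n f)"
      using descend_Suc_moments(3)[OF Suc(1)] Suc(2) 3 by simp
    also have "\<dots> \<le> rate * (rate ^ n * second_moment f)"
      using Suc(3)[OF 3] rate_pos by (intro mult_left_mono) auto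
    finally show ?case by simp
  }
qed

text \<open>
  On functions of mean zero the operator is a strict contraction in the second moment, so it has
  no fixed point there other than zero.
\<close>

lemma descend_fixed_mean_zero:
  assumes h: "L2 h" "expectation h = 0" and n: "0 < n" and fixed: "AE \<omega> in P. h \<omega> = descend n h \<omega>"
  shows "AE \<omega> in P. h \<omega> = 0"
proof -
  have [measurable]: "h \<in> borel_measurable P" using h by (simp add: L2_def)
  have "second_moment h = second_moment (descend n h)"
  proof (rule integral_cong_AE)
    show "AE \<omega> in P. (h \<omega>)\<^sup>2 = (descend n h \<omega>)\<^sup>2" using fixed by eventually_elim simp
  qed measurable
  also have "\<dots> \<le> rate ^ n * second_moment h" by (rule descend_moments(3)[OF h])
  finally have le: "second_moment h \<le> rate ^ n * second_moment h" .
  have r: "rate ^ n < 1" using rate_pos rate_less_1 n by (simp add: power_less_one_iff)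
  have "0 \<le> second_moment h" by simp
  hence "second_moment h = 0"
  proof -
    have "(1 - rate ^ n) * second_moment h \<le> 0" using le by (simp add: algebra_simps)
    hence "second_moment h \<le> 0" using r by (simp add: mult_le_0_iff)
    thus ?thesis using \<open>0 \<le> second_moment h\<close> by (rule antisym)
  qed
  moreover have "integrable P (\<lambda>\<omega>. (h \<omega>)\<^sup>2)" using h by (simp add: L2_def)
  ultimately have "AE \<omega> in P. (h \<omega>)\<^sup>2 = 0"
    by (subst (asm) integral_nonneg_eq_0_iff_AE) auto
  thus ?thesis by eventually_elim simp
qed

section \<open>The limiting mass\<close>

definition population :: "nat \<Rightarrow> (nat list \<Rightarrow> bool) \<Rightarrow> real" where
  "population n = descend n (\<lambda>_. 1)"

text \<open>
  Where the population sizes diverge, \<^const>\<open>lim\<close> is arbitrary; the truncation keeps the function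
  nonnegative at those configurations too.
\<close>

definition limit_mass :: "(nat list \<Rightarrow> bool) \<Rightarrow> real" where
  "limit_mass \<omega> = max 0 (lim (\<lambda>n. population n \<omega>))"

lemma population_nonneg: "0 \<le> population n \<omega>"
  unfolding population_def descend_def using rate_pos by (auto intro!: mult_nonneg_nonneg sum_nonneg)

lemma limit_mass_nonneg: "0 \<le> limit_mass \<omega>" by (simp add: limit_mass_def)

lemma measurable_population [measurable]: "population n \<in> borel_measurable P"
  unfolding population_def by measurable

lemma measurable_limit_mass [measurable]: "limit_mass \<in> borel_measurable P"
  unfolding limit_mass_def[abs_def] by measurable

lemma limit_massI:
  assumes "(\<lambda>n. population n \<omega>) \<longlonglongrightarrow> l"
  shows "limit_mass \<omega> = l"
proof -
  have "0 \<le> l" using assms population_nonneg by (intro LIMSEQ_le_const) auto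
  thus ?thesis using limI[OF assms] by (simp add: limit_mass_def)
qed

text \<open>
  The increment from level \<open>n\<close> to level \<open>n + 1\<close> is the operator \<open>descend n\<close> applied to the first
  increment, which has mean zero.  Its second moment is therefore at most a constant times
  \<open>rate ^ n\<close>, and the increments are almost surely absolutely summable with summable
  expectations.
\<close>

lemma population_converges:
  shows AE_population_tendsto: "AE \<omega> in P. (\<lambda>n. population n \<omega>) \<longlonglongrightarrow> limit_mass \<omega>"
    and expectation_limit_mass: "expectation limit_mass = 1"
proof -
  define D where "D = (\<lambda>\<omega>. descend 1 (\<lambda>_. 1) \<omega> - descend 0 (\<lambda>_. 1) \<omega>)"
  have L2D: "L2 D" unfolding D_def by (intro L2_diff L2_descend L2_const)
  have ED: "expectation D = 0"
    unfolding D_def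
    by (subst Bochner_Integration.integral_diff)
       (auto intro!: L2_integrable L2_descend L2_const simp: expectation_descend[OF L2_const] prob_space)
  define \<Delta> where "\<Delta> n = descend n D" for n
  have L2\<Delta>: "L2 (\<Delta> n)" for n unfolding \<Delta>_def by (rule L2_descend[OF L2D])
  note [measurable] = L2_measurable[OF L2\<Delta>]
  have int\<Delta>: "integrable P (\<Delta> n)" for n by (rule L2_integrable[OF L2\<Delta>])
  define t where "t = sqrt rate"
  have t: "0 < t" "t < 1" "t\<^sup>2 = rate" using rate_pos rate_less_1 by (auto simp: t_def real_sqrt_lt_1_iff)
  define V where "V = second_moment D"
  have bound: "expectation (\<lambda>\<omega>. norm (\<Delta> n \<omega>)) \<le> t ^ n * ((1 + V) / 2)" for n
  proof -
    have int2: "integrable P (\<lambda>\<omega>. (\<Delta> n \<omega>)\<^sup>2)" using L2\<Delta> by (simp add: L2_def)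
    have "expectation (\<lambda>\<omega>. norm (\<Delta> n \<omega>)) \<le> expectation (\<lambda>\<omega>. (t ^ n + (\<Delta> n \<omega>)\<^sup>2 / t ^ n) / 2)"
    proof (rule integral_mono)
      show "integrable P (\<lambda>\<omega>. norm (\<Delta> n \<omega>))" using int\<Delta> by simp
      show "integrable P (\<lambda>\<omega>. (t ^ n + (\<Delta> n \<omega>)\<^sup>2 / t ^ n) / 2)" using int2 by simp
      fix \<omega>
      \<comment> \<open>The weight \<open>t ^ n\<close> balances the two terms, since the second moment of \<open>\<Delta> n\<close> is of order \<open>t ^ (2 * n)\<close>.\<close>
      have "0 \<le> (\<bar>\<Delta> n \<omega>\<bar> - t ^ n)\<^sup>2" by simp
      hence "2 * \<bar>\<Delta> n \<omega>\<bar> * t ^ n \<le> (t ^ n)\<^sup>2 + (\<Delta> n \<omega>)\<^sup>2"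
        by (simp add: power2_diff algebra_simps)
      thus "norm (\<Delta> n \<omega>) \<le> (t ^ n + (\<Delta> n \<omega>)\<^sup>2 / t ^ n) / 2"
        using t(1) by (simp add: field_simps power2_eq_square)
    qed
    also have "\<dots> = (t ^ n + second_moment (\<Delta> n) / t ^ n) / 2"
      using int2 by (simp add: prob_space)
    also have "\<dots> \<le> (t ^ n + (rate ^ n * V) / t ^ n) / 2"
      using descend_moments(3)[OF L2D ED, of n] t(1)
      by (intro divide_right_mono add_left_mono) (auto simp: V_def \<Delta>_def)
    also have "rate ^ n = t ^ n * t ^ n" unfolding t(3)[symmetric] by (simp add: power2_eq_square power_mult_distrib)
    finally show ?thesis using t(1) by (simp add: field_simps)
  qed
  have sum_bound: "summable (\<lambda>n. t ^ n * ((1 + V) / 2))"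
    using t by (intro summable_mult2 summable_geometric) auto
  have sum_E: "summable (\<lambda>n. expectation (\<lambda>\<omega>. norm (\<Delta> n \<omega>)))"
    by (rule summable_comparison_test'[OF sum_bound]) (use bound in simp)
  have "(\<integral>\<^sup>+\<omega>. (\<Sum>n. ennreal (norm (\<Delta> n \<omega>))) \<partial>P) = (\<Sum>n. \<integral>\<^sup>+\<omega>. ennreal (norm (\<Delta> n \<omega>)) \<partial>P)"
    by (rule nn_integral_suminf) measurable
  also have "\<dots> = (\<Sum>n. ennreal (expectation (\<lambda>\<omega>. norm (\<Delta> n \<omega>))))"
    using int\<Delta> by (intro suminf_cong nn_integral_eq_integral) auto
  also have "\<dots> \<noteq> \<infinity>" using sum_E by (simp add: ennreal_suminf_neq_top)
  finally have "AE \<omega> in P. (\<Sum>n. ennreal (norm (\<Delta> n \<omega>))) \<noteq> \<infinity>"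
    by (intro nn_integral_PInf_AE) auto
  hence AE_sum: "AE \<omega> in P. summable (\<lambda>n. norm (\<Delta> n \<omega>))"
    by eventually_elim (auto intro!: summable_suminf_not_top)
  have AE_lim: "AE \<omega> in P. (\<lambda>n. population n \<omega>) \<longlonglongrightarrow> 1 + (\<Sum>n. \<Delta> n \<omega>)"
    using AE_sum AE_hereditary
  proof eventually_elim
    case (elim \<omega>)
    have "\<Delta> n \<omega> = population (Suc n) \<omega> - population n \<omega>" for n
      unfolding \<Delta>_def D_def descend_diff population_def
      using descend_descend[OF elim(2), of n 1 "\<lambda>_. 1"] descend_descend[OF elim(2), of n 0 "\<lambda>_. 1"]
      by (simp add: Suc_eq_plus1)
    hence "(\<Sum>i<n. \<Delta> i \<omega>) = population n \<omega> - population 0 \<omega>" for n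
      using sum_lessThan_telescope[of "\<lambda>n. population n \<omega>" n] by simp
    moreover have "population 0 \<omega> = 1" using elim(2) by (simp add: population_def descend_0 hereditary_def)
    ultimately have "population n \<omega> = 1 + (\<Sum>i<n. \<Delta> i \<omega>)" for n by (simp add: algebra_simps)
    thus ?case using summable_LIMSEQ[OF summable_norm_cancel[OF elim(1)]] by (auto intro: tendsto_intros)
  qed
  show "AE \<omega> in P. (\<lambda>n. population n \<omega>) \<longlonglongrightarrow> limit_mass \<omega>"
    using AE_lim by eventually_elim (use limit_massI in auto)
  have eq: "AE \<omega> in P. limit_mass \<omega> = 1 + (\<Sum>n. \<Delta> n \<omega>)"
    using AE_lim by eventually_elim (rule limit_massI)
  have "(\<lambda>n. expectation (\<Delta> n)) sums expectation (\<lambda>\<omega>. \<Sum>n. \<Delta> n \<omega>)"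
    by (rule sums_integral[OF int\<Delta> AE_sum sum_E])
  hence "expectation (\<lambda>\<omega>. \<Sum>n. \<Delta> n \<omega>) = 0"
    by (simp add: \<Delta>_def expectation_descend[OF L2D] ED sums_iff)
  moreover have "expectation limit_mass = expectation (\<lambda>\<omega>. 1 + (\<Sum>n. \<Delta> n \<omega>))"
    by (rule integral_cong_AE[OF _ _ eq]) measurable
  moreover have "integrable P (\<lambda>\<omega>. \<Sum>n. \<Delta> n \<omega>)"
    by (rule integrable_suminf[OF int\<Delta> AE_sum sum_E])
  ultimately show "expectation limit_mass = 1" by (simp add: prob_space)
qed

text \<open>
  The second moments of the population sizes satisfy \<open>a\<^bsub>n+1\<^esub> \<le> rate * a\<^bsub>n\<^esub> + 1\<close> and are bounded
  by the fixed point of this recursion; the bound passes to the limit by Fatou's lemma.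
\<close>

lemma L2_limit_mass: "L2 limit_mass"
proof -
  have L2p: "L2 (population n)" for n unfolding population_def by (rule L2_descend[OF L2_const])
  define K where "K = 1 / (1 - rate)"
  have K: "rate * K + 1 = K" "1 \<le> K" using rate_pos rate_less_1 by (auto simp: K_def field_simps)
  have bound: "second_moment (population n) \<le> K" for n
  proof (induction n)
    case 0
    have "AE \<omega> in P. (population 0 \<omega>)\<^sup>2 = 1" using AE_root by eventually_elim (simp add: population_def descend_0)
    hence "second_moment (population 0) = expectation (\<lambda>\<omega>. 1)"
      by (rule integral_cong_AE[rotated 2]) measurable
    thus ?case using K by (simp add: prob_space)
  next
    case (Suc n)
    have "second_moment (population (Suc n)) \<le> rate * second_moment (population n) + 1"
      using descend_Suc_moments(3)[OF L2p[unfolded population_def], of n]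
      by (simp add: population_def expectation_descend[OF L2_const] prob_space)
    also have "\<dots> \<le> rate * K + 1" using Suc rate_pos by (intro add_right_mono mult_left_mono) auto
    finally show ?case using K by simp
  qed
  have "(\<integral>\<^sup>+\<omega>. ennreal (norm ((limit_mass \<omega>)\<^sup>2)) \<partial>P) = (\<integral>\<^sup>+\<omega>. liminf (\<lambda>n. ennreal ((population n \<omega>)\<^sup>2)) \<partial>P)"
  proof (rule nn_integral_cong_AE)
    show "AE \<omega> in P. ennreal (norm ((limit_mass \<omega>)\<^sup>2)) = liminf (\<lambda>n. ennreal ((population n \<omega>)\<^sup>2))"
      using AE_population_tendsto
    proof eventually_elim
      case (elim \<omega>)
      have "(\<lambda>n. ennreal ((population n \<omega>)\<^sup>2)) \<longlonglongrightarrow> ennreal ((limit_mass \<omega>)\<^sup>2)"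
        using elim by (intro tendsto_intros)
      thus ?case using lim_imp_Liminf[OF trivial_limit_sequentially] by fastforce
    qed
  qed
  also have "\<dots> \<le> liminf (\<lambda>n. \<integral>\<^sup>+\<omega>. ennreal ((population n \<omega>)\<^sup>2) \<partial>P)"
    by (rule nn_integral_liminf) measurable
  also have "\<dots> \<le> liminf (\<lambda>n. ennreal K)"
  proof (intro Liminf_mono always_eventually allI)
    fix n
    have "(\<integral>\<^sup>+\<omega>. ennreal ((population n \<omega>)\<^sup>2) \<partial>P) = ennreal (second_moment (population n))"
      using L2p by (intro nn_integral_eq_integral) (auto simp: L2_def)
    thus "(\<integral>\<^sup>+\<omega>. ennreal ((population n \<omega>)\<^sup>2) \<partial>P) \<le> ennreal K" using bound by (simp add: ennreal_leI)
  qed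
  also have "\<dots> = ennreal K" by (simp add: Liminf_const)
  also have "\<dots> < \<infinity>" by simp
  finally have "integrable P (\<lambda>\<omega>. (limit_mass \<omega>)\<^sup>2)" by (intro integrableI_bounded) auto
  thus ?thesis by (simp add: L2_def)
qed

lemma AE_limit_mass_descend: "AE \<omega> in P. \<forall>n. limit_mass \<omega> = descend n limit_mass \<omega>"
  using AE_population_tendsto AE_all_subtrees[OF AE_population_tendsto] AE_hereditary
proof eventually_elim
  case (elim \<omega>)
  show ?case
  proof
    fix n
    have "(\<lambda>m. descend n (population m) \<omega>) \<longlonglongrightarrow> descend n limit_mass \<omega>"
      using elim(2) words_at_words by (intro descend_tendsto) auto
    moreover have "descend n (population m) \<omega> = population (m + n) \<omega>" for m
      unfolding population_def by (simp add: descend_descend[OF elim(3)] add.commute)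
    ultimately have "(\<lambda>m. population (m + n) \<omega>) \<longlonglongrightarrow> descend n limit_mass \<omega>" by simp
    thus "limit_mass \<omega> = descend n limit_mass \<omega>"
      using LIMSEQ_unique[OF LIMSEQ_ignore_initial_segment[OF elim(1), of n]] by simp
  qed
qed

text \<open>
  As the limiting mass has mean one, it is not almost surely zero, so it lies in some compact
  interval of positive numbers with positive probability.
\<close>

lemma limit_mass_range:
  obtains c C where "0 < c" "c \<le> C" "0 < prob {\<omega> \<in> space P. c \<le> limit_mass \<omega> \<and> limit_mass \<omega> \<le> C}"
proof -
  define A where "A n = {\<omega> \<in> space P. 1 / real (Suc n) \<le> limit_mass \<omega> \<and> limit_mass \<omega> \<le> real (Suc n)}" for n
  have "\<exists>n. 0 < prob (A n)"
  proof (rule ccontr)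
    assume "\<not> ?thesis"
    hence "prob (A n) = 0" for n by (simp add: zero_less_measure_iff)
    hence "AE \<omega> in P. \<forall>n. \<omega> \<notin> A n"
      unfolding AE_all_countable by (subst prob_eq_0[symmetric]) (auto simp: A_def)
    hence "AE \<omega> in P. limit_mass \<omega> = 0" using AE_space
    proof eventually_elim
      case (elim \<omega>)
      show ?case
      proof (rule ccontr)
        assume "limit_mass \<omega> \<noteq> 0"
        hence pos: "0 < limit_mass \<omega>" using limit_mass_nonneg[of \<omega>] by simp
        obtain n where n: "max (limit_mass \<omega>) (1 / limit_mass \<omega>) < real n" using reals_Archimedean2 by blast
        hence "limit_mass \<omega> \<le> real (Suc n)" "1 / limit_mass \<omega> \<le> real (Suc n)" by auto
        hence "\<omega> \<in> A n" using pos elim(2) by (simp add: A_def field_simps)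
        thus False using elim(1) by blast
      qed
    qed
    hence "expectation limit_mass = expectation (\<lambda>_. 0)" by (intro integral_cong_AE) auto
    thus False by (simp add: expectation_limit_mass)
  qed
  then obtain n where n: "0 < prob (A n)" by blast
  show thesis by (rule that[OF _ _ n[unfolded A_def]]) (auto simp: field_simps)
qed

section \<open>Local configurations of positive probability\<close>

definition pattern :: "nat \<Rightarrow> nat list set \<Rightarrow> (nat list \<Rightarrow> (nat list \<Rightarrow> bool) set) \<Rightarrow> (nat list \<Rightarrow> bool) set" where
  "pattern n S H = {\<omega> \<in> space P. \<forall>\<tau>\<in>words_at q n. (\<omega> \<tau> \<longleftrightarrow> \<tau> \<in> S) \<and> (\<tau> \<in> S \<longrightarrow> subtree \<tau> \<omega> \<in> H \<tau>)}"

lemma measurable_pattern: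
  assumes "\<And>\<tau>. \<tau> \<in> S \<Longrightarrow> H \<tau> \<in> sets P"
  shows "pattern n S H \<in> sets P"
  unfolding pattern_def
proof (rule sets.sets_Collect_finite_All)
  fix \<tau> assume "\<tau> \<in> words_at q n"
  note \<tau> = words_at_words[OF this]
  note [measurable] = measurable_letter[OF \<tau>] measurable_subtree[OF \<tau>]
  show "{\<omega> \<in> space P. (\<omega> \<tau> \<longleftrightarrow> \<tau> \<in> S) \<and> (\<tau> \<in> S \<longrightarrow> subtree \<tau> \<omega> \<in> H \<tau>)} \<in> sets P"
  proof (cases "\<tau> \<in> S")
    case True
    note [measurable] = assms[OF True]
    have "{\<omega> \<in> space P. (\<omega> \<tau> \<longleftrightarrow> \<tau> \<in> S) \<and> (\<tau> \<in> S \<longrightarrow> subtree \<tau> \<omega> \<in> H \<tau>)} =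
        {\<omega> \<in> space P. \<omega> \<tau> \<and> subtree \<tau> \<omega> \<in> H \<tau>}" using True by auto
    also have "\<dots> \<in> sets P" using \<tau> by measurable
    finally show ?thesis .
  next
    case False
    hence "{\<omega> \<in> space P. (\<omega> \<tau> \<longleftrightarrow> \<tau> \<in> S) \<and> (\<tau> \<in> S \<longrightarrow> subtree \<tau> \<omega> \<in> H \<tau>)} =
        {\<omega> \<in> space P. \<not> \<omega> \<tau>}" by auto
    also have "\<dots> \<in> sets P" using \<tau> by measurable
    finally show ?thesis .
  qed
qed simp

text \<open>
  Subtrees whose first letter occurs in \<open>S\<close> are handled by induction, and those whose first letter
  does not occur in \<open>S\<close> are required to contain no chosen word of the level in question, which the
  extinct configuration satisfies.
\<close>

lemma prob_pattern_pos:
  assumes "S \<noteq> {}" "S \<subseteq> words_at q n"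
    and "\<And>\<tau>. \<tau> \<in> S \<Longrightarrow> H \<tau> \<in> sets P" "\<And>\<tau>. \<tau> \<in> S \<Longrightarrow> 0 < prob (H \<tau>)"
  shows "0 < prob (pattern n S H)"
  using assms
proof (induction n arbitrary: S H)
  case 0
  hence S: "S = {[]}" by auto
  have H: "H [] \<in> sets P" "0 < prob (H [])" using 0 S by auto
  have "AE \<omega> in P. \<omega> \<in> pattern 0 S H \<longleftrightarrow> \<omega> \<in> H []"
    using AE_root AE_space by eventually_elim (auto simp: pattern_def S)
  hence "prob (pattern 0 S H) = prob (H [])"
    using H S by (intro finite_measure_eq_AE measurable_pattern) auto
  thus ?case using H by simp
next
  case (Suc n)
  define S' where "S' j = {\<tau>. j # \<tau> \<in> S}" for j
  define H' where "H' j = pattern n (S' j) (\<lambda>\<tau>. H (j # \<tau>))" for j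
  have S': "S' j \<subseteq> words_at q n" for j using Suc.prems(2) by (auto simp: S'_def words_at_def)
  have meas: "H' j \<in> sets P" for j
    unfolding H'_def by (rule measurable_pattern) (use Suc.prems in \<open>auto simp: S'_def\<close>)
  have "0 < prob {\<omega> \<in> space P. \<forall>j\<in>{1..q}. subtree [j] \<omega> \<in> H' j}"
  proof (rule prob_subtrees_pos[OF meas])
    fix j assume "j \<in> {1..q}"
    show "0 < prob (H' j) \<or> extinct \<in> H' j"
    proof (cases "S' j = {}")
      case True
      hence "extinct \<in> H' j" using words_at_words by (auto simp: H'_def pattern_def)
      thus ?thesis ..
    next
      case False
      have "0 < prob (H' j)"
        unfolding H'_def by (rule Suc.IH[OF False S']) (use Suc.prems in \<open>auto simp: S'_def\<close>)
      thus ?thesis ..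
    qed
  qed
  also have "{\<omega> \<in> space P. \<forall>j\<in>{1..q}. subtree [j] \<omega> \<in> H' j} = pattern (Suc n) S H"
  proof (intro set_eqI)
    fix \<omega>
    show "\<omega> \<in> {\<omega> \<in> space P. \<forall>j\<in>{1..q}. subtree [j] \<omega> \<in> H' j} \<longleftrightarrow> \<omega> \<in> pattern (Suc n) S H"
      using subtree_space[of "[_]" \<omega>]
      by (auto simp: H'_def pattern_def words_at_Suc subtree_apply S'_def)
  qed
  finally show ?case .
qed

text \<open>
  If the tree is reduced to a single line for \<open>n\<close> generations, its limiting mass is that of the
  surviving subtree multiplied by \<open>rate ^ n\<close>.
\<close>

lemma limit_mass_small:
  assumes "0 < \<delta>"
  shows "0 < prob {\<omega> \<in> space P. 0 < limit_mass \<omega> \<and> limit_mass \<omega> \<le> \<delta>}"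
proof -
  obtain c C where c: "0 < c" "c \<le> C" "0 < prob {\<omega> \<in> space P. c \<le> limit_mass \<omega> \<and> limit_mass \<omega> \<le> C}"
    by (rule limit_mass_range)
  define H where "H = {\<omega> \<in> space P. c \<le> limit_mass \<omega> \<and> limit_mass \<omega> \<le> C}"
  have H: "H \<in> sets P" unfolding H_def by measurable
  obtain n where n: "rate ^ n < \<delta> / C"
    using real_arch_pow_inv[of "\<delta> / C" rate] rate_less_1 assms c by auto
  define \<tau> where "\<tau> = replicate n (1::nat)"
  have \<tau>: "\<tau> \<in> words_at q n" using letters_pos by (auto simp: \<tau>_def words_at_def words_def)
  have pos: "0 < prob (pattern n {\<tau>} (\<lambda>_. H))"
    by (rule prob_pattern_pos) (use \<tau> H c in \<open>auto simp: H_def\<close>)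
  have "AE \<omega> in P. \<omega> \<in> pattern n {\<tau>} (\<lambda>_. H) \<longrightarrow> \<omega> \<in> {\<omega> \<in> space P. 0 < limit_mass \<omega> \<and> limit_mass \<omega> \<le> \<delta>}"
    using AE_limit_mass_descend
  proof eventually_elim
    case (elim \<omega>)
    show ?case
    proof
      assume \<omega>: "\<omega> \<in> pattern n {\<tau>} (\<lambda>_. H)"
      have "(\<Sum>\<tau>'\<in>words_at q n. if \<omega> \<tau>' then limit_mass (subtree \<tau>' \<omega>) else 0) =
          (\<Sum>\<tau>'\<in>{\<tau>}. if \<omega> \<tau>' then limit_mass (subtree \<tau>' \<omega>) else 0)"
        using \<omega> \<tau> by (intro sum.mono_neutral_right) (auto simp: pattern_def)
      also have "\<dots> = limit_mass (subtree \<tau> \<omega>)" using \<omega> \<tau> by (auto simp: pattern_def)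
      finally have "descend n limit_mass \<omega> = rate ^ n * limit_mass (subtree \<tau> \<omega>)"
        unfolding descend_def by simp
      hence eq: "limit_mass \<omega> = rate ^ n * limit_mass (subtree \<tau> \<omega>)" using elim by metis
      have h: "c \<le> limit_mass (subtree \<tau> \<omega>)" "limit_mass (subtree \<tau> \<omega>) \<le> C"
        using \<omega> \<tau> by (auto simp: pattern_def H_def)
      have "rate ^ n * limit_mass (subtree \<tau> \<omega>) \<le> (\<delta> / C) * C"
        using n h c rate_pos assms by (intro mult_mono) auto
      hence "limit_mass \<omega> \<le> \<delta>" using c eq by simp
      moreover have "0 < limit_mass \<omega>" using eq h c rate_pos by simp
      ultimately show "\<omega> \<in> {\<omega> \<in> space P. 0 < limit_mass \<omega> \<and> limit_mass \<omega> \<le> \<delta>}"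
        using \<omega> by (simp add: pattern_def)
    qed
  qed
  hence "prob (pattern n {\<tau>} (\<lambda>_. H)) \<le> prob {\<omega> \<in> space P. 0 < limit_mass \<omega> \<and> limit_mass \<omega> \<le> \<delta>}"
    by (intro finite_measure_mono_AE) auto
  thus ?thesis using pos by simp
qed

section \<open>Almost every code meets every configuration\<close>

text \<open>
  The mass of the codes, cut into blocks of length \<open>n\<close>, none of whose first \<open>N\<close> blocks is \<open>\<tau>\<^sub>0\<close>
  starting from a configuration in \<open>G\<close>.
\<close>

primrec avoiding_mass :: "nat \<Rightarrow> nat list \<Rightarrow> (nat list \<Rightarrow> bool) set \<Rightarrow> nat \<Rightarrow> (nat list \<Rightarrow> bool) \<Rightarrow> real" where
  "avoiding_mass n \<tau>\<^sub>0 G 0 \<omega> = limit_mass \<omega>"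
| "avoiding_mass n \<tau>\<^sub>0 G (Suc N) \<omega> = rate ^ n *
     (\<Sum>\<tau>\<in>words_at q n. if \<omega> \<tau> \<and> \<not> (\<tau> = \<tau>\<^sub>0 \<and> \<omega> \<in> G) then avoiding_mass n \<tau>\<^sub>0 G N (subtree \<tau> \<omega>) else 0)"

lemma avoiding_mass_Suc:
  assumes "\<tau>\<^sub>0 \<in> words_at q n" "\<omega> \<in> G \<Longrightarrow> \<omega> \<tau>\<^sub>0"
  shows "avoiding_mass n \<tau>\<^sub>0 G (Suc N) \<omega> = descend n (avoiding_mass n \<tau>\<^sub>0 G N) \<omega> -
     (if \<omega> \<in> G then rate ^ n * avoiding_mass n \<tau>\<^sub>0 G N (subtree \<tau>\<^sub>0 \<omega>) else 0)"
proof -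
  let ?g = "\<lambda>\<tau>. avoiding_mass n \<tau>\<^sub>0 G N (subtree \<tau> \<omega>)"
  have "(\<Sum>\<tau>\<in>words_at q n. if \<omega> \<tau> \<and> \<not> (\<tau> = \<tau>\<^sub>0 \<and> \<omega> \<in> G) then ?g \<tau> else 0)
      = (\<Sum>\<tau>\<in>words_at q n. (if \<omega> \<tau> then ?g \<tau> else 0) - (if \<tau> = \<tau>\<^sub>0 then if \<omega> \<in> G then ?g \<tau>\<^sub>0 else 0 else 0))"
    using assms(2) by (intro sum.cong refl) auto
  also have "\<dots> = (\<Sum>\<tau>\<in>words_at q n. if \<omega> \<tau> then ?g \<tau> else 0) - (if \<omega> \<in> G then ?g \<tau>\<^sub>0 else 0)"
    using assms(1) by (simp add: sum_subtractf)
  finally show ?thesis by (simp add: descend_def right_diff_distrib)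
qed

lemma avoiding_mass_nonneg: "0 \<le> avoiding_mass n \<tau>\<^sub>0 G N \<omega>"
proof (induction N arbitrary: \<omega>)
  case (Suc N)
  have "0 \<le> rate ^ n" using rate_pos by simp
  thus ?case unfolding avoiding_mass.simps(2) using Suc by (intro mult_nonneg_nonneg sum_nonneg) auto
qed (simp add: limit_mass_nonneg)

text \<open>
  The masses decrease to a limit \<open>g\<close>, and their recursion becomes \<open>g = descend n g - d\<close>, where \<open>d\<close>
  is the mass of the codes that meet the configuration in the first block and avoid it
  afterwards.  The operator preserves expectations, so \<open>d\<close> has mean zero and, being nonnegative,
  vanishes.  Thus \<open>g\<close> is a fixed point and \<open>g = b \<cdot> limit_mass\<close> with \<open>b\<close> the mean of \<open>g\<close>.  On \<open>G\<close>
  the defect \<open>d\<close> equals \<open>rate ^ n \<cdot> b\<close> times the positive limiting mass at \<open>\<tau>\<^sub>0\<close>, which leaves only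
  \<open>b = 0\<close>.
\<close>

lemma avoiding_mass_vanishes:
  assumes n: "0 < n" and \<tau>0: "\<tau>\<^sub>0 \<in> words_at q n" and G: "G \<in> sets P" "0 < prob G"
    and G_sub: "\<And>\<omega>. \<omega> \<in> G \<Longrightarrow> \<omega> \<tau>\<^sub>0 \<and> 0 < limit_mass (subtree \<tau>\<^sub>0 \<omega>)"
  shows "AE \<omega> in P. (\<lambda>N. avoiding_mass n \<tau>\<^sub>0 G N \<omega>) \<longlonglongrightarrow> 0"
proof -
  let ?g = "avoiding_mass n \<tau>\<^sub>0 G"
  note [measurable] = G(1) measurable_subtree[OF words_at_words[OF \<tau>0]]
  have Suc_eq: "?g (Suc N) \<omega> = descend n (?g N) \<omega> - (if \<omega> \<in> G then rate ^ n * ?g N (subtree \<tau>\<^sub>0 \<omega>) else 0)" for N \<omega>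
    by (rule avoiding_mass_Suc[OF \<tau>0]) (use G_sub in blast)
  have meas [measurable]: "?g N \<in> borel_measurable P" for N
  proof (induction N)
    case (Suc N)
    note [measurable] = Suc
    show ?case unfolding Suc_eq[abs_def] by measurable
  qed simp
  have decr: "AE \<omega> in P. ?g (Suc N) \<omega> \<le> ?g N \<omega>" for N
  proof (induction N)
    case 0
    show ?case using AE_limit_mass_descend
    proof eventually_elim
      case (elim \<omega>)
      have "0 \<le> (if \<omega> \<in> G then rate ^ n * ?g 0 (subtree \<tau>\<^sub>0 \<omega>) else 0)"
        using rate_pos limit_mass_nonneg by auto
      moreover have "descend n (?g 0) \<omega> = limit_mass \<omega>"
        using elim by (metis (no_types, lifting) avoiding_mass.simps(1) descend_cong)
      ultimately show ?case unfolding Suc_eq by simp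
    qed
  next
    case (Suc N)
    show ?case using AE_all_subtrees[OF Suc]
    proof eventually_elim
      case (elim \<omega>)
      show ?case unfolding avoiding_mass.simps(2)[of n \<tau>\<^sub>0 G _ \<omega>]
        using elim words_at_words rate_pos by (intro mult_left_mono sum_mono) auto
    qed
  qed
  define g where "g \<omega> = lim (\<lambda>N. ?g N \<omega>)" for \<omega>
  have [measurable]: "g \<in> borel_measurable P" unfolding g_def[abs_def] by measurable
  have "AE \<omega> in P. \<forall>N. ?g (Suc N) \<omega> \<le> ?g N \<omega>" using decr by (simp add: AE_all_countable)
  hence lim: "AE \<omega> in P. (\<lambda>N. ?g N \<omega>) \<longlonglongrightarrow> g \<omega> \<and> 0 \<le> g \<omega> \<and> g \<omega> \<le> limit_mass \<omega>"
  proof eventually_elim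
    case (elim \<omega>)
    have dec: "decseq (\<lambda>N. ?g N \<omega>)" using elim by (intro decseq_SucI) auto
    obtain L where L: "(\<lambda>N. ?g N \<omega>) \<longlonglongrightarrow> L"
      by (rule decseq_convergent[OF dec, of 0]) (simp add: avoiding_mass_nonneg)
    hence "g \<omega> = L" unfolding g_def by (rule limI)
    moreover have "0 \<le> L" using L avoiding_mass_nonneg by (intro LIMSEQ_le_const) auto
    moreover have "L \<le> limit_mass \<omega>" using decseq_ge[OF dec L, of 0] by simp
    ultimately show ?case using L by simp
  qed
  have L2g: "L2 g"
  proof (rule L2_bound[OF L2_limit_mass])
    show "AE \<omega> in P. \<bar>g \<omega>\<bar> \<le> \<bar>limit_mass \<omega>\<bar>" using lim by eventually_elim auto
  qed measurable
  define d where "d \<omega> = (if \<omega> \<in> G then rate ^ n * g (subtree \<tau>\<^sub>0 \<omega>) else 0)" for \<omega>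
  have [measurable]: "d \<in> borel_measurable P" unfolding d_def[abs_def] by measurable
  have eq_d: "AE \<omega> in P. d \<omega> = descend n g \<omega> - g \<omega> \<and> 0 \<le> d \<omega>"
    using lim AE_all_subtrees[OF lim]
  proof eventually_elim
    case (elim \<omega>)
    have "(\<lambda>N. ?g (Suc N) \<omega>) \<longlonglongrightarrow> descend n g \<omega> - d \<omega>"
      unfolding Suc_eq
    proof (intro tendsto_diff descend_tendsto)
      show "(\<lambda>N. ?g N (subtree \<tau> \<omega>)) \<longlonglongrightarrow> g (subtree \<tau> \<omega>)" if "\<tau> \<in> words_at q n" "\<omega> \<tau>" for \<tau>
        using elim(2) that words_at_words by auto
      show "(\<lambda>N. if \<omega> \<in> G then rate ^ n * ?g N (subtree \<tau>\<^sub>0 \<omega>) else 0) \<longlonglongrightarrow> d \<omega>"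
        using elim(2) words_at_words[OF \<tau>0] G_sub[of \<omega>] by (auto simp: d_def intro!: tendsto_intros)
    qed
    moreover have "(\<lambda>N. ?g (Suc N) \<omega>) \<longlonglongrightarrow> g \<omega>" by (rule LIMSEQ_Suc[OF conjunct1[OF elim(1)]])
    ultimately have "g \<omega> = descend n g \<omega> - d \<omega>" by (rule LIMSEQ_unique[symmetric])
    moreover have "0 \<le> d \<omega>"
      using elim(2) words_at_words[OF \<tau>0] G_sub[of \<omega>] rate_pos by (auto simp: d_def)
    ultimately show ?case by simp
  qed
  have int_diff: "integrable P (\<lambda>\<omega>. descend n g \<omega> - g \<omega>)"
    by (intro Bochner_Integration.integrable_diff L2_integrable L2_descend L2g)
  have d_ae: "AE \<omega> in P. d \<omega> = descend n g \<omega> - g \<omega>" using eq_d by eventually_elim simp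
  have "integrable P d" using int_diff by (subst integrable_cong_AE[OF _ _ d_ae]) measurable
  moreover have "expectation d = 0"
  proof -
    have "expectation d = expectation (\<lambda>\<omega>. descend n g \<omega> - g \<omega>)" by (rule integral_cong_AE[OF _ _ d_ae]) measurable
    also have "\<dots> = expectation (descend n g) - expectation g"
      by (intro Bochner_Integration.integral_diff L2_integrable L2_descend L2g)
    finally show ?thesis by (simp add: expectation_descend[OF L2g])
  qed
  moreover have "AE \<omega> in P. 0 \<le> d \<omega>" using eq_d by eventually_elim simp
  ultimately have d0: "AE \<omega> in P. d \<omega> = 0" by (simp add: integral_nonneg_eq_0_iff_AE)
  define b where "b = expectation g"
  have "AE \<omega> in P. g \<omega> - b * limit_mass \<omega> = 0"
  proof (rule descend_fixed_mean_zero[OF _ _ n])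
    show "L2 (\<lambda>\<omega>. g \<omega> - b * limit_mass \<omega>)" by (intro L2_diff L2_cmult L2g L2_limit_mass)
    have "expectation (\<lambda>\<omega>. g \<omega> - b * limit_mass \<omega>) = expectation g - expectation (\<lambda>\<omega>. b * limit_mass \<omega>)"
      by (intro Bochner_Integration.integral_diff L2_integrable L2_cmult L2g L2_limit_mass)
    thus "expectation (\<lambda>\<omega>. g \<omega> - b * limit_mass \<omega>) = 0" by (simp add: b_def expectation_limit_mass)
    show "AE \<omega> in P. g \<omega> - b * limit_mass \<omega> = descend n (\<lambda>\<omega>. g \<omega> - b * limit_mass \<omega>) \<omega>"
      using d0 d_ae AE_limit_mass_descend
    proof eventually_elim
      case (elim \<omega>)
      have "g \<omega> = descend n g \<omega>" "limit_mass \<omega> = descend n limit_mass \<omega>" using elim by auto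
      thus ?case unfolding descend_diff descend_cmult by simp
    qed
  qed
  hence gb: "AE \<omega> in P. g \<omega> = b * limit_mass \<omega>" by eventually_elim simp
  have "b = 0"
  proof (rule ccontr)
    assume b: "b \<noteq> 0"
    have "AE \<omega> in P. \<omega> \<notin> G" using d0 AE_all_subtrees[OF gb]
    proof eventually_elim
      case (elim \<omega>)
      show ?case
      proof
        assume "\<omega> \<in> G"
        hence "d \<omega> = rate ^ n * (b * limit_mass (subtree \<tau>\<^sub>0 \<omega>))"
          using elim(2) words_at_words[OF \<tau>0] G_sub[of \<omega>] by (simp add: d_def)
        thus False using elim(1) b rate_pos G_sub[OF \<open>\<omega> \<in> G\<close>] by simp
      qed
    qed
    hence "prob G = 0" using G(1) by (simp add: prob_eq_0)
    thus False using G(2) by simp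
  qed
  show ?thesis using gb lim by eventually_elim (simp add: \<open>b = 0\<close>)
qed

end

section \<open>Geometry of the subcubes\<close>

lemma ball_shift_subset:
  fixes x u :: "'a::real_normed_vector"
  assumes "norm u = 1" "0 \<le> t" "t + \<rho> \<le> r"
  shows "ball (x + t *\<^sub>R u) \<rho> \<subseteq> ball x r"
proof
  fix y assume "y \<in> ball (x + t *\<^sub>R u) \<rho>"
  hence "dist (x + t *\<^sub>R u) y < \<rho>" by simp
  moreover have "dist x (x + t *\<^sub>R u) = t" using assms by (simp add: dist_norm)
  ultimately show "y \<in> ball x r" using assms dist_triangle[of x y "x + t *\<^sub>R u"] by simp
qed

locale subdivided_cube =
  fixes k :: nat and e :: "nat \<Rightarrow> nat ^ 'm::finite" and q :: nat
  assumes two_le_k: "2 \<le> k" and enumeration: "subcube_enumeration k e" and q_eq: "q = k ^ CARD('m)"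
begin

definition open_cube :: "nat list \<Rightarrow> (real ^ 'm) set" where
  "open_cube \<sigma> = box (corner k e \<sigma>) (corner k e \<sigma> + (\<chi> i. 1 / real k ^ length \<sigma>))"

lemma k_pos: "0 < k" using two_le_k by simp

lemma mem_cube:
  "x \<in> cube k e \<sigma> \<longleftrightarrow> (\<forall>i. corner k e \<sigma> $ i \<le> x $ i \<and> x $ i \<le> corner k e \<sigma> $ i + 1 / real k ^ length \<sigma>)"
  by (simp add: cube_def mem_box_cart)

lemma mem_open_cube:
  "x \<in> open_cube \<sigma> \<longleftrightarrow> (\<forall>i. corner k e \<sigma> $ i < x $ i \<and> x $ i < corner k e \<sigma> $ i + 1 / real k ^ length \<sigma>)"
  by (simp add: open_cube_def mem_box_cart)

lemma open_cube_subset_cube: "open_cube \<sigma> \<subseteq> cube k e \<sigma>"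
  by (auto simp: mem_cube mem_open_cube less_imp_le)

lemma corner_in_cube: "corner k e \<sigma> \<in> cube k e \<sigma>" by (simp add: mem_cube)

lemma digit_less: "j \<in> {1..q} \<Longrightarrow> e j $ i < k"
  using enumeration unfolding q_eq subcube_enumeration_def bij_betw_def by blast

lemma digit_inj: "j \<in> {1..q} \<Longrightarrow> j' \<in> {1..q} \<Longrightarrow> e j = e j' \<Longrightarrow> j = j'"
  using enumeration unfolding q_eq subcube_enumeration_def bij_betw_def inj_on_def by blast

lemma digit_surj:
  assumes "\<forall>i. v $ i < k" obtains j where "j \<in> {1..q}" "e j = v"
proof -
  have "v \<in> e ` {1..q}"
    using assms enumeration unfolding q_eq subcube_enumeration_def bij_betw_def by simp
  thus ?thesis using that by blast
qed

lemma corner_snoc_nth: "corner k e (\<sigma> @ [j]) $ i = corner k e \<sigma> $ i + real (e j $ i) / real k ^ Suc (length \<sigma>)"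
  by (simp add: corner_snoc)

lemma side_Suc: "1 / real k ^ n = real k / real k ^ Suc n"
  using k_pos by simp

lemma digit_bound:
  assumes "j \<in> {1..q}"
  shows "real (e j $ i) / real k ^ Suc n + 1 / real k ^ Suc n \<le> 1 / real k ^ n"
proof -
  have "real (e j $ i) + 1 \<le> real k" using digit_less[OF assms, of i] by linarith
  thus ?thesis unfolding side_Suc[of n] add_divide_distrib[symmetric] by (intro divide_right_mono) auto
qed

lemma cube_snoc_subset:
  assumes "j \<in> {1..q}"
  shows "cube k e (\<sigma> @ [j]) \<subseteq> cube k e \<sigma>" "open_cube (\<sigma> @ [j]) \<subseteq> open_cube \<sigma>"
proof -
  have "0 \<le> real (e j $ i) / real k ^ Suc (length \<sigma>)" for i by simp
  note * = this digit_bound[OF assms, of _ "length \<sigma>"]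
  show "cube k e (\<sigma> @ [j]) \<subseteq> cube k e \<sigma>"
  proof
    fix x assume x: "x \<in> cube k e (\<sigma> @ [j])"
    have "corner k e \<sigma> $ i \<le> x $ i \<and> x $ i \<le> corner k e \<sigma> $ i + 1 / real k ^ length \<sigma>" for i
    proof -
      have "corner k e (\<sigma> @ [j]) $ i \<le> x $ i" "x $ i \<le> corner k e (\<sigma> @ [j]) $ i + 1 / real k ^ Suc (length \<sigma>)"
        using x by (auto simp: mem_cube)
      thus ?thesis using *[of i] unfolding corner_snoc_nth by linarith
    qed
    thus "x \<in> cube k e \<sigma>" by (simp add: mem_cube)
  qed
  show "open_cube (\<sigma> @ [j]) \<subseteq> open_cube \<sigma>"
  proof
    fix x assume x: "x \<in> open_cube (\<sigma> @ [j])"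
    have "corner k e \<sigma> $ i < x $ i \<and> x $ i < corner k e \<sigma> $ i + 1 / real k ^ length \<sigma>" for i
    proof -
      have "corner k e (\<sigma> @ [j]) $ i < x $ i" "x $ i < corner k e (\<sigma> @ [j]) $ i + 1 / real k ^ Suc (length \<sigma>)"
        using x by (auto simp: mem_open_cube)
      thus ?thesis using *[of i] unfolding corner_snoc_nth by linarith
    qed
    thus "x \<in> open_cube \<sigma>" by (simp add: mem_open_cube)
  qed
qed

lemma cube_append_subset: "\<tau> \<in> words q \<Longrightarrow> cube k e (\<sigma> @ \<tau>) \<subseteq> cube k e \<sigma>"
proof (induction \<tau> rule: rev_induct)
  case (snoc j \<tau>)
  thus ?case using cube_snoc_subset(1)[of j "\<sigma> @ \<tau>"] by auto
qed simp

text \<open>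
  In each coordinate the digit is the integer part of the rescaled position.
\<close>

lemma cube_snoc_cover:
  assumes x: "x \<in> cube k e \<sigma>"
  obtains j where "j \<in> {1..q}" "x \<in> cube k e (\<sigma> @ [j])"
proof -
  define s where "s = real k ^ Suc (length \<sigma>)"
  have s: "0 < s" using k_pos by (simp add: s_def)
  define y where "y i = (x $ i - corner k e \<sigma> $ i) * s" for i
  have y: "0 \<le> y i" "y i \<le> real k" for i
  proof -
    have "corner k e \<sigma> $ i \<le> x $ i" "x $ i \<le> corner k e \<sigma> $ i + 1 / real k ^ length \<sigma>"
      using x by (auto simp: mem_cube)
    hence "0 \<le> x $ i - corner k e \<sigma> $ i" "x $ i - corner k e \<sigma> $ i \<le> real k / s"
      unfolding s_def side_Suc[symmetric] by auto
    thus "0 \<le> y i" "y i \<le> real k" using s by (auto simp: y_def field_simps)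
  qed
  \<comment> \<open>The minimum takes care of points on the upper faces of the cube, where the integer part is \<open>k\<close>.\<close>
  define v :: "nat ^ 'm" where "v = (\<chi> i. min (nat \<lfloor>y i\<rfloor>) (k - 1))"
  have v: "real (v $ i) \<le> y i" "y i \<le> real (v $ i) + 1" for i
  proof -
    have "real (nat \<lfloor>y i\<rfloor>) = of_int \<lfloor>y i\<rfloor>" using y(1)[of i] by simp
    hence *: "real (nat \<lfloor>y i\<rfloor>) \<le> y i" "y i < real (nat \<lfloor>y i\<rfloor>) + 1" by linarith+
    have "real (v $ i) = min (real (nat \<lfloor>y i\<rfloor>)) (real k - 1)"
      using k_pos by (simp add: v_def of_nat_min of_nat_diff)
    thus "real (v $ i) \<le> y i" "y i \<le> real (v $ i) + 1" using * y(2)[of i] by linarith+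
  qed
  have "v $ i < k" for i
  proof -
    have "v $ i \<le> k - 1" by (simp add: v_def)
    thus ?thesis using k_pos by linarith
  qed
  then obtain j where j: "j \<in> {1..q}" "e j = v" using digit_surj by blast
  have "x \<in> cube k e (\<sigma> @ [j])"
    unfolding mem_cube corner_snoc_nth
  proof (intro allI)
    fix i
    have "real (v $ i) / s \<le> x $ i - corner k e \<sigma> $ i" "x $ i - corner k e \<sigma> $ i \<le> (real (v $ i) + 1) / s"
      using v[of i] s unfolding y_def by (simp_all add: field_simps)
    thus "corner k e \<sigma> $ i + real (e j $ i) / real k ^ Suc (length \<sigma>) \<le> x $ i \<and>
         x $ i \<le> corner k e \<sigma> $ i + real (e j $ i) / real k ^ Suc (length \<sigma>) + 1 / real k ^ length (\<sigma> @ [j])"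
      by (simp add: j s_def add_divide_distrib)
  qed
  thus ?thesis using that j by blast
qed

lemma cube_cover:
  assumes "x \<in> cube k e \<sigma>"
  obtains \<tau> where "\<tau> \<in> words_at q n" "x \<in> cube k e (\<sigma> @ \<tau>)"
proof -
  have "\<exists>\<tau>\<in>words_at q n. x \<in> cube k e (\<sigma> @ \<tau>)"
  proof (induction n)
    case 0 thus ?case using assms by simp
  next
    case (Suc n)
    then obtain \<tau> where \<tau>: "\<tau> \<in> words_at q n" "x \<in> cube k e (\<sigma> @ \<tau>)" by blast
    obtain j where j: "j \<in> {1..q}" "x \<in> cube k e ((\<sigma> @ \<tau>) @ [j])" by (rule cube_snoc_cover[OF \<tau>(2)])
    thus ?case using \<tau> by (intro bexI[of _ "\<tau> @ [j]"]) (auto simp: words_at_def)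
  qed
  thus ?thesis using that by blast
qed

text \<open>
  Either the prefixes of the words differ and induction applies, or only the last letters differ, and then some coordinate of their corners differs by at least one side length.
\<close>

lemma open_cube_disjoint:
  assumes "\<sigma> \<in> words q" "\<sigma>' \<in> words q" "length \<sigma> = length \<sigma>'" "\<sigma> \<noteq> \<sigma>'"
  shows "open_cube \<sigma> \<inter> cube k e \<sigma>' = {}"
  using assms
proof (induction \<sigma> arbitrary: \<sigma>' rule: rev_induct)
  case (snoc j \<sigma>)
  then obtain \<rho> j' where \<sigma>': "\<sigma>' = \<rho> @ [j']" by (cases \<sigma>' rule: rev_cases) auto
  have w: "\<sigma> \<in> words q" "\<rho> \<in> words q" "j \<in> {1..q}" "j' \<in> {1..q}" "length \<sigma> = length \<rho>"
    using snoc.prems \<sigma>' by auto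
  show ?case
  proof (cases "\<sigma> = \<rho>")
    case False
    thus ?thesis using snoc.IH[OF w(1,2,5) False] cube_snoc_subset[OF w(3), of \<sigma>] cube_snoc_subset[OF w(4), of \<rho>] \<sigma>' by blast
  next
    case True
    hence "j \<noteq> j'" using snoc.prems \<sigma>' by auto
    hence "e j \<noteq> e j'" using digit_inj w by blast
    then obtain i where i: "e j $ i \<noteq> e j' $ i" by (auto simp: vec_eq_iff)
    define s where "s = real k ^ Suc (length \<rho>)"
    have s: "0 < s" using k_pos by (simp add: s_def)
    have False if x: "x \<in> open_cube (\<sigma> @ [j])" "x \<in> cube k e \<sigma>'" for x
    proof -
      have *: "corner k e \<rho> $ i + real (e j $ i) / s < x $ i" "x $ i < corner k e \<rho> $ i + real (e j $ i) / s + 1 / s"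
        using x(1) unfolding mem_open_cube corner_snoc_nth True by (auto simp: s_def)
      have **: "corner k e \<rho> $ i + real (e j' $ i) / s \<le> x $ i" "x $ i \<le> corner k e \<rho> $ i + real (e j' $ i) / s + 1 / s"
        using x(2) unfolding \<sigma>' mem_cube corner_snoc_nth by (auto simp: s_def)
      have "real (e j' $ i) / s < (real (e j $ i) + 1) / s" "real (e j $ i) / s < (real (e j' $ i) + 1) / s"
        using * ** unfolding add_divide_distrib by linarith+
      hence "real (e j' $ i) < real (e j $ i) + 1" "real (e j $ i) < real (e j' $ i) + 1"
        using s by (auto simp: divide_less_cancel)
      thus False using i by linarith
    qed
    thus ?thesis by blast
  qed
qed simp

lemma cube_diam:
  assumes "x \<in> cube k e \<sigma>" "y \<in> cube k e \<sigma>"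
  shows "\<bar>x $ i - y $ i\<bar> \<le> 1 / real k ^ length \<sigma>" "norm (x - y) \<le> real CARD('m) / real k ^ length \<sigma>"
proof -
  have *: "\<bar>x $ i - y $ i\<bar> \<le> 1 / real k ^ length \<sigma>" for i
  proof -
    have "corner k e \<sigma> $ i \<le> x $ i" "x $ i \<le> corner k e \<sigma> $ i + 1 / real k ^ length \<sigma>"
      "corner k e \<sigma> $ i \<le> y $ i" "y $ i \<le> corner k e \<sigma> $ i + 1 / real k ^ length \<sigma>"
      using assms by (auto simp: mem_cube)
    thus ?thesis by linarith
  qed
  thus "\<bar>x $ i - y $ i\<bar> \<le> 1 / real k ^ length \<sigma>" .
  have "norm (x - y) \<le> (\<Sum>i\<in>UNIV. \<bar>(x - y) $ i\<bar>)" by (rule norm_le_l1_cart)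
  also have "\<dots> \<le> (\<Sum>i\<in>(UNIV::'m set). 1 / real k ^ length \<sigma>)" using * by (intro sum_mono) simp
  finally show "norm (x - y) \<le> real CARD('m) / real k ^ length \<sigma>" by simp
qed

lemma side_tendsto_0: "(\<lambda>n. c / real k ^ n) \<longlonglongrightarrow> 0"
proof -
  have "(\<lambda>n. c * (1 / real k) ^ n) \<longlonglongrightarrow> c * 0"
    using two_le_k by (intro tendsto_mult_left LIMSEQ_realpow_zero) auto
  thus ?thesis by (simp add: power_divide)
qed

lemma prefix_cubes_decreasing:
  assumes "\<eta> \<in> UNIV \<rightarrow> {1..q}" "n \<le> n'"
  shows "cube k e (map \<eta> [0..<n']) \<subseteq> cube k e (map \<eta> [0..<n])"
proof -
  have "[0..<n'] = [0..<n] @ [n..<n']" using assms(2) upt_add_eq_append[of 0 n "n' - n"] by simp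
  moreover have "map \<eta> [n..<n'] \<in> words q"
    using Pi_mem[OF assms(1) UNIV_I] by (auto simp: words_def simp del: atLeastAtMost_iff)
  ultimately show ?thesis using cube_append_subset[of "map \<eta> [n..<n']" "map \<eta> [0..<n]"] by simp
qed

text \<open>
  The cubes are nested and compact, and their diameters tend to zero.
\<close>

lemma coding_point_in_cube:
  assumes \<eta>: "\<eta> \<in> UNIV \<rightarrow> {1..q}"
  shows "coding_point k e \<eta> \<in> cube k e (map \<eta> [0..<n])"
proof -
  define F where "F n = cube k e (map \<eta> [0..<n])" for n
  have "\<Inter>(range F) \<noteq> {}"
  proof (rule compact_nest)
    show "compact (F n)" for n by (simp add: F_def cube_def compact_cbox)
    show "F n \<noteq> {}" for n using corner_in_cube by (auto simp: F_def)
    show "F n \<subseteq> F m" if "m \<le> n" for m n unfolding F_def by (rule prefix_cubes_decreasing[OF \<eta> that])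
  qed
  then obtain x where x: "x \<in> (\<Inter>i. cube k e (map \<eta> [0..<i]))" by (auto simp: F_def)
  have uniq: "y = x" if y: "y \<in> (\<Inter>i. cube k e (map \<eta> [0..<i]))" for y
  proof -
    have "norm (y - x) \<le> real CARD('m) / real k ^ n" for n
      using cube_diam(2)[of y "map \<eta> [0..<n]" x] x y by simp
    hence "norm (y - x) \<le> 0"
      by (intro LIMSEQ_le_const[OF side_tendsto_0[of "real CARD('m)"]]) blast
    thus ?thesis by simp
  qed
  have "coding_point k e \<eta> \<in> (\<Inter>i. cube k e (map \<eta> [0..<i]))"
    unfolding coding_point_def by (rule theI[where P = "\<lambda>x. x \<in> (\<Inter>i. cube k e (map \<eta> [0..<i]))", OF x uniq])
  thus ?thesis by blast
qed

lemma corner_tendsto_coding_point: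
  assumes \<eta>: "\<eta> \<in> UNIV \<rightarrow> {1..q}"
  shows "(\<lambda>n. corner k e (map \<eta> [0..<n])) \<longlonglongrightarrow> coding_point k e \<eta>"
proof -
  have "norm (corner k e (map \<eta> [0..<n]) - coding_point k e \<eta>) \<le> real CARD('m) / real k ^ n" for n
    using cube_diam(2)[OF corner_in_cube coding_point_in_cube[OF \<eta>], of n] by simp
  hence "(\<lambda>n. corner k e (map \<eta> [0..<n]) - coding_point k e \<eta>) \<longlonglongrightarrow> 0"
    by (intro Lim_null_comparison[OF _ side_tendsto_0[of "real CARD('m)"]]) auto
  thus ?thesis by (simp add: LIM_zero_iff)
qed

lemma corner_append: "corner k e (\<sigma> @ \<tau>) = corner k e \<sigma> + (1 / real k ^ length \<sigma>) *\<^sub>R corner k e \<tau>"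
proof (induction \<tau> rule: rev_induct)
  case Nil
  show ?case by (simp add: corner_def vec_eq_iff)
next
  case (snoc j \<tau>)
  show ?case
    unfolding vec_eq_iff append_assoc[symmetric] corner_snoc_nth snoc
    by (simp add: corner_snoc_nth vector_add_component vector_scaleR_component algebra_simps power_add)
qed

lemma scaled_in_cube:
  assumes "x \<in> cube k e \<tau>"
  shows "corner k e \<sigma> + (1 / real k ^ length \<sigma>) *\<^sub>R x \<in> cube k e (\<sigma> @ \<tau>)"
  unfolding mem_cube corner_append
proof
  fix i
  define s where "s = real k ^ length \<sigma>"
  have s: "0 < s" using k_pos by (simp add: s_def)
  have "corner k e \<tau> $ i \<le> x $ i" "x $ i \<le> corner k e \<tau> $ i + 1 / real k ^ length \<tau>"
    using assms by (auto simp: mem_cube)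
  hence "corner k e \<tau> $ i / s \<le> x $ i / s" "x $ i / s \<le> (corner k e \<tau> $ i + 1 / real k ^ length \<tau>) / s"
    using s by (auto intro!: divide_right_mono)
  thus "(corner k e \<sigma> + (1 / real k ^ length \<sigma>) *\<^sub>R corner k e \<tau>) $ i \<le> (corner k e \<sigma> + (1 / real k ^ length \<sigma>) *\<^sub>R x) $ i \<and>
    (corner k e \<sigma> + (1 / real k ^ length \<sigma>) *\<^sub>R x) $ i \<le>
    (corner k e \<sigma> + (1 / real k ^ length \<sigma>) *\<^sub>R corner k e \<tau>) $ i + 1 / real k ^ length (\<sigma> @ \<tau>)"
    by (simp add: s_def power_add add_divide_distrib mult.commute)
qed

text \<open>
  Words whose cube contains the centre of the unit cube.  Inside a cube \<open>\<sigma>\<close>, a point of the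
  cube \<open>\<sigma> @ \<tau>\<close> is then close to the centre of \<open>\<sigma>\<close>, and balls around it stay away from the
  boundary.
\<close>

definition midpoint_word :: "nat list \<Rightarrow> bool" where
  "midpoint_word \<tau> \<longleftrightarrow> (\<chi> i. 1/2) \<in> cube k e \<tau>"

lemma unit_cube_word:
  assumes "\<And>i. 0 \<le> x $ i \<and> x $ i \<le> 1"
  obtains \<tau> where "\<tau> \<in> words_at q n" "x \<in> cube k e \<tau>"
proof -
  have "x \<in> cube k e []" using assms by (simp add: mem_cube corner_def)
  then obtain \<tau> where "\<tau> \<in> words_at q n" "x \<in> cube k e ([] @ \<tau>)" by (rule cube_cover)
  thus ?thesis using that by simp
qed

lemma ball_subset_open_cube:
  assumes \<tau>: "midpoint_word \<tau>" and x: "x \<in> cube k e (\<sigma> @ \<tau>)"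
    and small: "1 / real k ^ length \<tau> \<le> 1 / 4" and r: "r \<le> 1 / real k ^ length \<sigma> / 4"
  shows "ball x r \<subseteq> open_cube \<sigma>"
proof
  fix y assume y: "y \<in> ball x r"
  define s where "s = 1 / real k ^ length \<sigma>"
  have s: "0 < s" using k_pos by (simp add: s_def)
  define c where "c = corner k e \<sigma> + s *\<^sub>R (\<chi> i. 1/2)"
  have c: "c \<in> cube k e (\<sigma> @ \<tau>)" unfolding c_def s_def using \<tau> by (intro scaled_in_cube) (simp add: midpoint_word_def)
  show "y \<in> open_cube \<sigma>"
    unfolding mem_open_cube
  proof
    fix i
    have "\<bar>x $ i - c $ i\<bar> \<le> 1 / real k ^ length (\<sigma> @ \<tau>)" by (rule cube_diam(1)[OF x c])
    also have "\<dots> = s * (1 / real k ^ length \<tau>)" by (simp add: s_def power_add)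
    also have "\<dots> \<le> s * (1 / 4)" using small s by (intro mult_left_mono) auto
    finally have 1: "\<bar>x $ i - c $ i\<bar> \<le> s / 4" by simp
    have "\<bar>(y - x) $ i\<bar> \<le> norm (y - x)" by (rule component_le_norm_cart)
    also have "\<dots> < r" using y by (simp add: dist_norm norm_minus_commute)
    finally have 2: "\<bar>y $ i - x $ i\<bar> < s / 4" using r by (simp add: s_def)
    have 3: "c $ i = corner k e \<sigma> $ i + s / 2" by (simp add: c_def)
    show "corner k e \<sigma> $ i < y $ i \<and> y $ i < corner k e \<sigma> $ i + 1 / real k ^ length \<sigma>"
      unfolding s_def[symmetric] using 1 2 3 by linarith
  qed
qed

text \<open>
  A cube around \<open>z\<close> whose diameter is less than the radius lies in the ball.
\<close>

lemma ball_contains_cube: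
  assumes \<alpha>: "real CARD('m) / real k ^ n < \<rho>" and z: "z \<in> cube k e \<sigma>"
  obtains \<tau> where "\<tau> \<in> words_at q n" "cube k e (\<sigma> @ \<tau>) \<subseteq> ball z (\<rho> / real k ^ length \<sigma>)"
proof -
  obtain \<tau> where \<tau>: "\<tau> \<in> words_at q n" "z \<in> cube k e (\<sigma> @ \<tau>)" by (rule cube_cover[OF z])
  have "y \<in> ball z (\<rho> / real k ^ length \<sigma>)" if "y \<in> cube k e (\<sigma> @ \<tau>)" for y
  proof -
    have "norm (z - y) \<le> real CARD('m) / real k ^ length (\<sigma> @ \<tau>)" by (rule cube_diam(2)[OF \<tau>(2) that])
    also have "\<dots> = (real CARD('m) / real k ^ n) / real k ^ length \<sigma>"
      using \<tau> by (simp add: words_at_def power_add)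
    also have "\<dots> < \<rho> / real k ^ length \<sigma>" using \<alpha> k_pos by (intro divide_strict_right_mono) auto
    finally show ?thesis by (simp add: dist_norm)
  qed
  thus ?thesis using that \<tau> by blast
qed

text \<open>
  In units of \<open>r\<close> the cube has diameter at most \<open>4 \<kappa>\<close>.  Moving from \<open>x\<close> along a coordinate axis
  until the ball touches the sphere of radius \<open>r\<close> leaves room for a ball of radius
  \<open>(1 - 4 \<kappa>) r / 2\<close> beyond the cube.
\<close>

lemma hole_next_to_cube:
  assumes x: "x \<in> cube k e (\<sigma> @ \<tau>)" and \<tau>: "length \<tau> = n"
    and \<kappa>: "\<kappa> = real CARD('m) / real k ^ n" "4 * \<kappa> \<le> 1" and r: "r = 1 / real k ^ length \<sigma> / 4"
  shows "\<exists>z. ball z ((1 - 4 * \<kappa>) / 2 * r) \<subseteq> ball x r - cube k e (\<sigma> @ \<tau>)"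
proof -
  define \<alpha> where "\<alpha> = (1 - 4 * \<kappa>) / 2"
  have r0: "0 < r" using k_pos by (simp add: r)
  have \<kappa>0: "0 \<le> \<kappa>" by (simp add: \<kappa>)
  define u :: "real ^ 'm" where "u = axis (SOME i. True) 1"
  have u: "norm u = 1" by (simp add: u_def)
  define t where "t = r - \<alpha> * r"
  have t0: "0 \<le> t" unfolding t_def \<alpha>_def using r0 \<kappa>0 by (simp add: field_simps)
  define z where "z = x + t *\<^sub>R u"
  have "ball z (\<alpha> * r) \<subseteq> ball x r" unfolding z_def by (rule ball_shift_subset[OF u t0]) (simp add: t_def)
  moreover have "y \<notin> ball z (\<alpha> * r)" if y: "y \<in> cube k e (\<sigma> @ \<tau>)" for y
  proof -
    have "norm (x - y) \<le> real CARD('m) / real k ^ length (\<sigma> @ \<tau>)" by (rule cube_diam(2)[OF x y])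
    also have "\<dots> = 4 * \<kappa> * r" by (simp add: \<kappa> r \<tau> power_add)
    finally have "norm (x - y) \<le> 4 * \<kappa> * r" .
    moreover have "dist x z = t" using u t0 by (simp add: z_def dist_norm)
    moreover have "dist x z \<le> dist x y + dist y z" by (rule dist_triangle)
    ultimately have "t - 4 * \<kappa> * r \<le> dist z y" by (simp add: dist_norm dist_commute norm_minus_commute)
    moreover have "t - 4 * \<kappa> * r = \<alpha> * r" by (simp add: t_def \<alpha>_def field_simps)
    ultimately show ?thesis by simp
  qed
  ultimately show ?thesis unfolding \<alpha>_def by blast
qed

text \<open>
  The two cubes contain points at distance exactly one eighth of the side of \<open>\<sigma>\<close>, and their diameters
  are at most \<open>\<kappa>\<close> sides.  With \<open>3 \<kappa>\<close> added to the radius, \<open>B(x, r)\<close> contains the second cube,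
  which then lies within \<open>5 \<kappa>\<close> sides of the sphere of radius \<open>r\<close>.  A ball of radius
  \<open>(1 - 20 \<kappa>) r\<close> that touches this sphere on the opposite side misses the cube, because
  \<open>2 \<cdot> 20 \<kappa> r\<close> is at least \<open>5 \<kappa>\<close> sides.
\<close>

lemma ball_missing_cube:
  fixes i\<^sub>0 :: 'm
  assumes \<tau>1: "midpoint_word \<tau>\<^sub>1" and \<tau>2: "(\<chi> i. 1/2) + (1/8) *\<^sub>R axis i\<^sub>0 1 \<in> cube k e \<tau>\<^sub>2"
    and len: "length \<tau>\<^sub>1 = n" "length \<tau>\<^sub>2 = n"
    and x: "x \<in> cube k e (\<sigma> @ \<tau>\<^sub>1)"
    and \<kappa>: "\<kappa> = real CARD('m) / real k ^ n"
    and r: "r = (1/8 + 3 * \<kappa>) / real k ^ length \<sigma>"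
  shows "cube k e (\<sigma> @ \<tau>\<^sub>2) \<subseteq> ball x r"
    and "\<exists>z. ball z ((1 - 20 * \<kappa>) * r) \<subseteq> ball x r - cube k e (\<sigma> @ \<tau>\<^sub>2)"
proof -
  define s where "s = 1 / real k ^ length \<sigma>"
  have s: "0 < s" using k_pos by (simp add: s_def)
  have \<kappa>0: "0 < \<kappa>" using k_pos by (simp add: \<kappa>)
  have r_eq: "r = s / 8 + 3 * (\<kappa> * s)" by (simp add: r s_def add_divide_distrib)
  have \<kappa>s: "0 < \<kappa> * s" using s \<kappa>0 by simp
  define u :: "real ^ 'm" where "u = axis i\<^sub>0 1"
  have u: "norm u = 1" by (simp add: u_def)
  define c1 where "c1 = corner k e \<sigma> + s *\<^sub>R (\<chi> i. 1/2)"
  define c2 where "c2 = corner k e \<sigma> + s *\<^sub>R ((\<chi> i. 1/2) + (1/8) *\<^sub>R u)"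
  have c1: "c1 \<in> cube k e (\<sigma> @ \<tau>\<^sub>1)" unfolding c1_def s_def using \<tau>1 by (intro scaled_in_cube) (simp add: midpoint_word_def)
  have c2: "c2 \<in> cube k e (\<sigma> @ \<tau>\<^sub>2)" unfolding c2_def s_def u_def by (rule scaled_in_cube[OF \<tau>2])
  have c12: "c2 - c1 = (s / 8) *\<^sub>R u" by (simp add: c1_def c2_def algebra_simps)
  have d1: "norm (c1 - x) \<le> \<kappa> * s" using cube_diam(2)[OF c1 x] by (simp add: \<kappa> s_def len power_add mult.commute)
  have d2: "norm (y - c2) \<le> \<kappa> * s" if "y \<in> cube k e (\<sigma> @ \<tau>\<^sub>2)" for y
    using cube_diam(2)[OF that c2] by (simp add: \<kappa> s_def len power_add mult.commute)
  show "cube k e (\<sigma> @ \<tau>\<^sub>2) \<subseteq> ball x r"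
  proof
    fix y assume y: "y \<in> cube k e (\<sigma> @ \<tau>\<^sub>2)"
    have "norm (y - x) = norm ((y - c2) + (c1 - x) + (c2 - c1))" by simp
    also have "\<dots> \<le> norm (y - c2) + norm (c1 - x) + norm (c2 - c1)"
      by (intro order_trans[OF norm_triangle_ineq] add_right_mono norm_triangle_ineq)
    also have "norm (c2 - c1) = s / 8" using s u by (simp add: c12)
    finally have "norm (y - x) < r" using d1 d2[OF y] \<kappa>s r_eq by linarith
    thus "y \<in> ball x r" by (simp add: dist_norm norm_minus_commute)
  qed
  define t where "t = 20 * \<kappa> * r"
  have "s / 8 \<le> r" using \<kappa>s r_eq by linarith
  hence t: "20 * \<kappa> * (s / 8) \<le> t" unfolding t_def using \<kappa>0 by (intro mult_left_mono) auto
  hence t0: "0 \<le> t" using \<kappa>s by simp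
  define z where "z = x + t *\<^sub>R (- u)"
  have \<rho>: "(1 - 20 * \<kappa>) * r = r - t" by (simp add: t_def algebra_simps)
  have "ball z (r - t) \<subseteq> ball x r" unfolding z_def by (rule ball_shift_subset) (use u t0 in auto)
  moreover have "y \<notin> ball z (r - t)" if y: "y \<in> cube k e (\<sigma> @ \<tau>\<^sub>2)" for y
  proof -
    have "(y - z) $ i\<^sub>0 = (y - c2) $ i\<^sub>0 + (c1 - x) $ i\<^sub>0 + (c2 - c1) $ i\<^sub>0 + t"
      by (simp add: z_def u_def)
    moreover have "(c2 - c1) $ i\<^sub>0 = s / 8" unfolding c12 by (simp add: u_def)
    moreover have "\<bar>(y - c2) $ i\<^sub>0\<bar> \<le> \<kappa> * s" using component_le_norm_cart[of "y - c2" i\<^sub>0] d2[OF y] by linarith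
    moreover have "\<bar>(c1 - x) $ i\<^sub>0\<bar> \<le> \<kappa> * s" using component_le_norm_cart[of "c1 - x" i\<^sub>0] d1 by linarith
    moreover have "5 * (\<kappa> * s) \<le> 2 * t" using t by simp
    ultimately have "r - t \<le> (y - z) $ i\<^sub>0" using r_eq by linarith
    also have "\<dots> \<le> norm (y - z)" using component_le_norm_cart[of "y - z" i\<^sub>0] by linarith
    finally show ?thesis by (simp add: dist_norm norm_minus_commute)
  qed
  ultimately show "\<exists>z. ball z ((1 - 20 * \<kappa>) * r) \<subseteq> ball x r - cube k e (\<sigma> @ \<tau>\<^sub>2)"
    unfolding \<rho> by blast
qed

end

section \<open>The natural measure\<close>

locale mandelbrot = percolation q p P + subdivided_cube k e q
  for q :: nat and p :: real and P :: "(nat list \<Rightarrow> bool) measure"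
    and k :: nat and e :: "nat \<Rightarrow> nat ^ 'm::finite"
begin

lemma k_powr_dim: "real k powr (- (real j * dim_exponent TYPE('m) k p)) = rate ^ j"
proof -
  define A where "A = real q * p"
  have A: "0 < A" using p_pos letters_pos by (simp add: A_def)
  have "ln (real k) \<noteq> 0" using two_le_k by simp
  hence "- (real j * dim_exponent TYPE('m) k p) * ln (real k) = real j * (- ln A)"
    by (simp add: dim_exponent_def A_def q_eq)
  hence "real k powr (- (real j * dim_exponent TYPE('m) k p)) = exp (real j * (- ln A))"
    using k_pos by (simp add: powr_def)
  also have "\<dots> = exp (- ln A) ^ j" by (rule exp_of_nat_mult)
  also have "exp (- ln A) = rate" using A by (simp add: exp_minus rate_def A_def inverse_eq_divide)
  finally show ?thesis .
qed

lemma num_descendants_eq: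
  assumes "\<sigma> \<in> words q"
  shows "real (num_descendants q \<omega> j \<sigma>) * rate ^ j = population j (subtree \<sigma> \<omega>)"
proof -
  have "{\<tau> \<in> words q. length \<tau> = length \<sigma> + j \<and> prefix \<sigma> \<tau> \<and> \<omega> \<tau>} = (@) \<sigma> ` {\<tau> \<in> words_at q j. \<omega> (\<sigma> @ \<tau>)}"
    using assms by (auto simp: words_at_def prefix_def)
  hence "num_descendants q \<omega> j \<sigma> = card {\<tau> \<in> words_at q j. \<omega> (\<sigma> @ \<tau>)}"
    unfolding num_descendants_def by (simp add: card_image inj_on_def)
  also have "real \<dots> = (\<Sum>\<tau>\<in>words_at q j. if \<omega> (\<sigma> @ \<tau>) then 1 else 0)"
    by (simp add: sum.If_cases Int_def)
  finally show ?thesis by (simp add: population_def descend_def subtree_apply mult.commute)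
qed

definition typical :: "(nat list \<Rightarrow> bool) \<Rightarrow> bool" where
  "typical \<omega> \<longleftrightarrow> hereditary \<omega> \<and>
     (\<forall>\<sigma>\<in>words q. \<omega> \<sigma> \<longrightarrow> (\<lambda>n. population n (subtree \<sigma> \<omega>)) \<longlonglongrightarrow> limit_mass (subtree \<sigma> \<omega>))"

lemma AE_typical: "AE \<omega> in P. typical \<omega>"
  using AE_hereditary AE_all_subtrees[OF AE_population_tendsto]
  by eventually_elim (simp add: typical_def)

lemma population_neglected:
  assumes "hereditary \<omega>" "\<sigma> \<in> words q" "\<not> \<omega> \<sigma>"
  shows "population n (subtree \<sigma> \<omega>) = 0"
  unfolding population_def by (rule descend_neglected[OF assms])

lemma limit_mass_neglected:
  assumes "hereditary \<omega>" "\<sigma> \<in> words q" "\<not> \<omega> \<sigma>"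
  shows "limit_mass (subtree \<sigma> \<omega>) = 0"
  by (rule limit_massI) (simp add: population_neglected[OF assms])

lemma martingale_limit_eq:
  assumes "typical \<omega>" "\<sigma> \<in> words q"
  shows "martingale_limit TYPE('m) k p \<omega> \<sigma> = limit_mass (subtree \<sigma> \<omega>)"
proof -
  have "(\<lambda>n. population n (subtree \<sigma> \<omega>)) \<longlonglongrightarrow> limit_mass (subtree \<sigma> \<omega>)"
  proof (cases "\<omega> \<sigma>")
    case False
    thus ?thesis using assms by (simp add: typical_def limit_mass_neglected population_neglected)
  qed (use assms in \<open>auto simp: typical_def\<close>)
  thus ?thesis
    unfolding martingale_limit_def k_powr_dim q_eq[symmetric] num_descendants_eq[OF assms(2)] by (rule limI)
qed

definition total :: real where
  "total = diameter (cube k e []) powr dim_exponent TYPE('m) k p"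

lemma total_pos: "0 < total"
proof -
  have b: "bounded (cube k e [])" by (simp add: cube_def)
  have "0 \<in> cube k e []" "(\<chi> i. 1) \<in> cube k e []" by (auto simp: mem_cube corner_def)
  hence "dist (0 :: real ^ 'm) (\<chi> i. 1) \<le> diameter (cube k e [])" by (intro diameter_bounded_bound b)
  moreover have "(0 :: real ^ 'm) \<noteq> (\<chi> i. 1)" by (auto simp: vec_eq_iff)
  ultimately have "0 < diameter (cube k e [])" by (smt (verit) zero_less_dist_iff)
  thus ?thesis by (simp add: total_def)
qed

definition cell_mass :: "(nat list \<Rightarrow> bool) \<Rightarrow> nat list \<Rightarrow> real" where
  "cell_mass \<omega> \<sigma> = total * rate ^ length \<sigma> * limit_mass (subtree \<sigma> \<omega>)"

lemma cell_mass_nonneg: "0 \<le> cell_mass \<omega> \<sigma>"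
  using total_pos rate_pos limit_mass_nonneg by (simp add: cell_mass_def)

lemma cell_mass_neglected: "hereditary \<omega> \<Longrightarrow> \<sigma> \<in> words q \<Longrightarrow> \<not> \<omega> \<sigma> \<Longrightarrow> cell_mass \<omega> \<sigma> = 0"
  by (simp add: cell_mass_def limit_mass_neglected)

abbreviation \<mu> :: "(nat list \<Rightarrow> bool) \<Rightarrow> (nat \<Rightarrow> nat) measure" where
  "\<mu> \<equiv> coding_measure k p e"

abbreviation \<nu> :: "(nat list \<Rightarrow> bool) \<Rightarrow> (real ^ 'm) measure" where
  "\<nu> \<equiv> natural_measure k p e"

abbreviation codes :: "(nat \<Rightarrow> nat) set" where "codes \<equiv> UNIV \<rightarrow> {1..q}"

lemma cylinder_sub: "cylinder q ` words q \<subseteq> Pow codes" by (auto simp: cylinder_def)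

lemma coding_measure_unfold:
  "\<mu> \<omega> = extend_measure codes (words q) (cylinder q)
     (\<lambda>\<sigma>. ennreal (total * real k powr (- (real (length \<sigma>) * dim_exponent TYPE('m) k p)) * martingale_limit TYPE('m) k p \<omega> \<sigma>))"
  by (simp add: coding_measure_def Let_def total_def q_eq)

lemma space_coding_measure: "space (\<mu> \<omega>) = codes"
  unfolding coding_measure_unfold by (rule space_extend_measure[OF cylinder_sub])

lemma sets_coding_measure: "sets (\<mu> \<omega>) = sigma_sets codes (cylinder q ` words q)"
  unfolding coding_measure_unfold by (rule sets_extend_measure[OF cylinder_sub])

lemma cylinder_sets [measurable]: "\<sigma> \<in> words q \<Longrightarrow> cylinder q \<sigma> \<in> sets (\<mu> \<omega>)"
  unfolding sets_coding_measure by (intro sigma_sets.Basic) auto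

text \<open>
  The nondegenerate case: the cylinders carry the masses that the martingale limits prescribe.
\<close>

definition charged :: "(nat list \<Rightarrow> bool) \<Rightarrow> bool" where
  "charged \<omega> \<longleftrightarrow> (\<forall>\<sigma>\<in>words q.
     emeasure (\<mu> \<omega>) (cylinder q \<sigma>) = ennreal (cell_mass \<omega> \<sigma>))"

lemma chargedD:
  "charged \<omega> \<Longrightarrow> \<sigma> \<in> words q \<Longrightarrow>
     emeasure (\<mu> \<omega>) (cylinder q \<sigma>) = ennreal (cell_mass \<omega> \<sigma>)"
  by (simp add: charged_def)

text \<open>
  If a measure with the prescribed values on the cylinders exists, then \<^const>\<open>extend_measure\<close>
  selects one; otherwise it yields the null measure, for which every almost everywhere statement
  holds.
\<close>

lemma coding_measure_cases:
  assumes "typical \<omega>"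
  obtains "emeasure (\<mu> \<omega>) codes = 0"
    | "charged \<omega>"
proof -
  define v where "v = (\<lambda>\<sigma>. ennreal (total * real k powr (- (real (length \<sigma>) * dim_exponent TYPE('m) k p)) * martingale_limit TYPE('m) k p \<omega> \<sigma>))"
  have v: "v \<sigma> = ennreal (cell_mass \<omega> \<sigma>)" if "\<sigma> \<in> words q" for \<sigma>
    unfolding v_def k_powr_dim martingale_limit_eq[OF assms that] by (simp add: cell_mass_def)
  let ?M = "\<mu> \<omega>"
  have M: "?M = extend_measure codes (words q) (cylinder q) v" unfolding v_def by (rule coding_measure_unfold)
  show thesis
  proof (cases "\<exists>\<mu>'. (\<forall>\<sigma>\<in>words q. \<mu>' (cylinder q \<sigma>) = v \<sigma>) \<and> measure_space codes (sigma_sets codes (cylinder q ` words q)) \<mu>'")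
    case True
    then obtain \<mu>' where \<mu>': "\<And>\<sigma>. \<sigma> \<in> words q \<Longrightarrow> \<mu>' (cylinder q \<sigma>) = v \<sigma>"
      "measure_space codes (sigma_sets codes (cylinder q ` words q)) \<mu>'" by blast
    have "emeasure ?M (cylinder q \<sigma>) = v \<sigma>" if "\<sigma> \<in> words q" for \<sigma>
      by (rule emeasure_extend_measure[OF M \<mu>'(1) cylinder_sub _ _ that])
         (use \<mu>'(2) in \<open>auto simp: sets_coding_measure measure_space_def\<close>)
    hence "charged \<omega>" using v by (simp add: charged_def)
    thus thesis by (rule that(2))
  next
    case False
    hence "?M = measure_of codes (cylinder q ` words q) (\<lambda>_. 0)"
      unfolding M extend_measure_def by (simp only: simp_thms if_False)
    hence "emeasure ?M codes = 0" by (simp add: emeasure_measure_of_conv)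
    thus thesis by (rule that(1))
  qed
qed

lemma map_prefix_words: "\<eta> \<in> codes \<Longrightarrow> map \<eta> [0..<n] \<in> words_at q n"
  using Pi_mem[of \<eta> UNIV "\<lambda>_. {1..q}"] by (auto simp: words_at_def words_def simp del: atLeastAtMost_iff)

lemma mem_cylinder: "\<eta> \<in> cylinder q \<sigma> \<longleftrightarrow> \<eta> \<in> codes \<and> map \<eta> [0..<length \<sigma>] = \<sigma>"
  by (simp add: cylinder_def)

lemma map_prefix_append: "map \<eta> [0..<i + n] = map \<eta> [0..<i] @ map \<eta> [i..<i + n]"
  by (simp only: upt_add_eq_append[OF le0, of i n] map_append)

lemma measurable_coding_point [measurable]: "coding_point k e \<in> \<mu> \<omega> \<rightarrow>\<^sub>M borel"
proof (rule borel_measurable_LIMSEQ_metric)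
  fix n
  show "(\<lambda>\<eta>. corner k e (map \<eta> [0..<n])) \<in> borel_measurable (\<mu> \<omega>)"
  proof (rule measurableI)
    fix A :: "(real ^ 'm) set"
    have "(\<lambda>\<eta>. corner k e (map \<eta> [0..<n])) -` A \<inter> space (\<mu> \<omega>)
        = (\<Union>\<sigma>\<in>{\<sigma> \<in> words_at q n. corner k e \<sigma> \<in> A}. cylinder q \<sigma>)"
    proof (intro equalityI subsetI)
      fix \<eta> assume "\<eta> \<in> (\<lambda>\<eta>. corner k e (map \<eta> [0..<n])) -` A \<inter> space (\<mu> \<omega>)"
      hence "\<eta> \<in> codes" "corner k e (map \<eta> [0..<n]) \<in> A" by (simp_all add: space_coding_measure)
      thus "\<eta> \<in> (\<Union>\<sigma>\<in>{\<sigma> \<in> words_at q n. corner k e \<sigma> \<in> A}. cylinder q \<sigma>)"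
        using map_prefix_words[of \<eta> n] by (intro UN_I[of "map \<eta> [0..<n]"]) (simp_all add: mem_cylinder)
    next
      fix \<eta> assume "\<eta> \<in> (\<Union>\<sigma>\<in>{\<sigma> \<in> words_at q n. corner k e \<sigma> \<in> A}. cylinder q \<sigma>)"
      then obtain \<sigma> where "\<sigma> \<in> words_at q n" "corner k e \<sigma> \<in> A" "\<eta> \<in> codes" "map \<eta> [0..<length \<sigma>] = \<sigma>"
        unfolding mem_cylinder UN_iff by blast
      thus "\<eta> \<in> (\<lambda>\<eta>. corner k e (map \<eta> [0..<n])) -` A \<inter> space (\<mu> \<omega>)"
        by (simp add: space_coding_measure words_at_def)
    qed
    also have "\<dots> \<in> sets (\<mu> \<omega>)"
      by (intro sets.finite_UN cylinder_sets) (auto simp: words_at_words)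
    finally show "(\<lambda>\<eta>. corner k e (map \<eta> [0..<n])) -` A \<inter> space (\<mu> \<omega>) \<in> sets (\<mu> \<omega>)" .
  qed simp
next
  fix \<eta> assume "\<eta> \<in> space (\<mu> \<omega>)"
  thus "(\<lambda>n. corner k e (map \<eta> [0..<n])) \<longlonglongrightarrow> coding_point k e \<eta>"
    unfolding space_coding_measure by (rule corner_tendsto_coding_point)
qed

lemma sets_natural_measure [simp, measurable_cong]: "sets (\<nu> \<omega>) = sets borel"
  by (simp add: natural_measure_def)

lemma emeasure_natural_measure:
  "A \<in> sets borel \<Longrightarrow> emeasure (\<nu> \<omega>) A = emeasure (\<mu> \<omega>) {\<eta> \<in> codes. coding_point k e \<eta> \<in> A}"
  unfolding natural_measure_def
  by (subst emeasure_distr[OF measurable_coding_point])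
     (auto intro!: arg_cong[where f = "emeasure _"] simp: space_coding_measure)

section \<open>Recurrence for the natural measure\<close>

text \<open>
  The set of codes behind \<open>avoiding_mass\<close>, for codes that extend \<open>\<sigma>\<close>.
\<close>

primrec avoiding_codes :: "nat \<Rightarrow> nat list \<Rightarrow> (nat list \<Rightarrow> bool) set \<Rightarrow> (nat list \<Rightarrow> bool) \<Rightarrow> nat \<Rightarrow> nat list \<Rightarrow> (nat \<Rightarrow> nat) set" where
  "avoiding_codes n \<tau>\<^sub>0 G \<omega> 0 \<sigma> = cylinder q \<sigma>"
| "avoiding_codes n \<tau>\<^sub>0 G \<omega> (Suc N) \<sigma> =
     (\<Union>\<tau>\<in>{\<tau> \<in> words_at q n. \<not> (\<tau> = \<tau>\<^sub>0 \<and> subtree \<sigma> \<omega> \<in> G)}. avoiding_codes n \<tau>\<^sub>0 G \<omega> N (\<sigma> @ \<tau>))"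

lemma avoiding_codes_sets: "\<sigma> \<in> words q \<Longrightarrow> avoiding_codes n \<tau>\<^sub>0 G \<omega> N \<sigma> \<in> sets (\<mu> \<omega>)"
proof (induction N arbitrary: \<sigma>)
  case (Suc N)
  show ?case unfolding avoiding_codes.simps
    by (intro sets.finite_UN Suc.IH) (use Suc.prems words_at_words in auto)
qed (simp add: cylinder_sets)

lemma cylinder_append_subset: "cylinder q (\<sigma> @ \<tau>) \<subseteq> cylinder q \<sigma>"
  by (auto simp: mem_cylinder map_prefix_append)

lemma avoiding_codes_subset: "avoiding_codes n \<tau>\<^sub>0 G \<omega> N \<sigma> \<subseteq> cylinder q \<sigma>"
proof (induction N arbitrary: \<sigma>)
  case (Suc N)
  show ?case unfolding avoiding_codes.simps using Suc cylinder_append_subset by blast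
qed simp

lemma emeasure_avoiding_codes:
  assumes typical: "typical \<omega>"
    and charged: "charged \<omega>"
    and \<sigma>: "\<sigma> \<in> words q"
  shows "emeasure (\<mu> \<omega>) (avoiding_codes n \<tau>\<^sub>0 G \<omega> N \<sigma>)
     \<le> ennreal (total * rate ^ length \<sigma> * avoiding_mass n \<tau>\<^sub>0 G N (subtree \<sigma> \<omega>))"
  using \<sigma>
proof (induction N arbitrary: \<sigma>)
  case 0
  thus ?case by (simp add: chargedD[OF charged] cell_mass_def)
next
  case (Suc N)
  let ?M = "\<mu> \<omega>"
  let ?T = "{\<tau> \<in> words_at q n. \<not> (\<tau> = \<tau>\<^sub>0 \<and> subtree \<sigma> \<omega> \<in> G)}"
  let ?c = "total * rate ^ length \<sigma> * rate ^ n"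
  have c: "0 \<le> ?c" using total_pos rate_pos by simp
  let ?g = "\<lambda>\<tau>. if \<omega> (\<sigma> @ \<tau>) then avoiding_mass n \<tau>\<^sub>0 G N (subtree (\<sigma> @ \<tau>) \<omega>) else 0"
  have "emeasure ?M (avoiding_codes n \<tau>\<^sub>0 G \<omega> (Suc N) \<sigma>) \<le> (\<Sum>\<tau>\<in>?T. emeasure ?M (avoiding_codes n \<tau>\<^sub>0 G \<omega> N (\<sigma> @ \<tau>)))"
    unfolding avoiding_codes.simps
    by (intro emeasure_subadditive_finite) (use Suc.prems words_at_words avoiding_codes_sets in auto)
  also have "\<dots> \<le> (\<Sum>\<tau>\<in>?T. ennreal (?c * ?g \<tau>))"
  proof (rule sum_mono)
    fix \<tau> assume \<tau>: "\<tau> \<in> ?T"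
    hence w: "\<sigma> @ \<tau> \<in> words q" "length \<tau> = n" using Suc.prems by (auto simp: words_at_def)
    show "emeasure ?M (avoiding_codes n \<tau>\<^sub>0 G \<omega> N (\<sigma> @ \<tau>)) \<le> ennreal (?c * ?g \<tau>)"
    proof (cases "\<omega> (\<sigma> @ \<tau>)")
      case True
      thus ?thesis using Suc.IH[OF w(1)] w(2) by (simp add: power_add mult.assoc)
    next
      case False
      have "emeasure ?M (avoiding_codes n \<tau>\<^sub>0 G \<omega> N (\<sigma> @ \<tau>)) \<le> emeasure ?M (cylinder q (\<sigma> @ \<tau>))"
        by (intro emeasure_mono avoiding_codes_subset cylinder_sets w)
      also have "\<dots> = 0" using typical False by (simp add: chargedD[OF charged w(1)] cell_mass_neglected[OF _ w(1)] typical_def)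
      finally show ?thesis by simp
    qed
  qed
  also have "\<dots> = ennreal (\<Sum>\<tau>\<in>?T. ?c * ?g \<tau>)"
    using c avoiding_mass_nonneg by (intro sum_ennreal) auto
  also have "(\<Sum>\<tau>\<in>?T. ?c * ?g \<tau>) = ?c * (\<Sum>\<tau>\<in>words_at q n. if \<not> (\<tau> = \<tau>\<^sub>0 \<and> subtree \<sigma> \<omega> \<in> G) then ?g \<tau> else 0)"
    unfolding sum_distrib_left[symmetric] by (simp only: sum.inter_filter finite_words_at)
  also have "(\<Sum>\<tau>\<in>words_at q n. if \<not> (\<tau> = \<tau>\<^sub>0 \<and> subtree \<sigma> \<omega> \<in> G) then ?g \<tau> else 0)
     = (\<Sum>\<tau>\<in>words_at q n. if subtree \<sigma> \<omega> \<tau> \<and> \<not> (\<tau> = \<tau>\<^sub>0 \<and> subtree \<sigma> \<omega> \<in> G) then avoiding_mass n \<tau>\<^sub>0 G N (subtree \<tau> (subtree \<sigma> \<omega>)) else 0)"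
    by (intro sum.cong refl) (auto simp: subtree_apply)
  finally show ?case by (simp add: mult.assoc)
qed

definition recurrent :: "nat \<Rightarrow> nat list \<Rightarrow> (nat list \<Rightarrow> bool) set \<Rightarrow> (nat list \<Rightarrow> bool) \<Rightarrow> bool" where
  "recurrent n \<tau>\<^sub>0 G \<omega> \<longleftrightarrow> (\<forall>\<sigma>\<in>words q. \<omega> \<sigma> \<longrightarrow> (\<lambda>N. avoiding_mass n \<tau>\<^sub>0 G N (subtree \<sigma> \<omega>)) \<longlonglongrightarrow> 0)"

text \<open>
  A code that does not meet the configuration from position \<open>i\<^sub>0\<close> on belongs to the avoiding codes of
  its prefix of length \<open>i\<^sub>0\<close> for every number of blocks, and these are null sets.
\<close>

lemma AE_codes_recur:
  assumes typical: "typical \<omega>"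
    and charged: "charged \<omega>"
    and rec: "recurrent n \<tau>\<^sub>0 G \<omega>"
  shows "AE \<eta> in \<mu> \<omega>. \<forall>i\<^sub>0. \<exists>i\<ge>i\<^sub>0. subtree (map \<eta> [0..<i]) \<omega> \<in> G \<and> map \<eta> [i..<i + n] = \<tau>\<^sub>0"
proof -
  let ?M = "\<mu> \<omega>"
  have null: "AE \<eta> in ?M. \<not> (\<forall>N. \<eta> \<in> avoiding_codes n \<tau>\<^sub>0 G \<omega> N \<sigma>)" if \<sigma>: "\<sigma> \<in> words q" for \<sigma>
  proof -
    let ?N = "\<Inter>N. avoiding_codes n \<tau>\<^sub>0 G \<omega> N \<sigma>"
    have meas: "?N \<in> sets ?M" using avoiding_codes_sets[OF \<sigma>] by auto
    have "emeasure ?M ?N = 0"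
    proof (cases "\<omega> \<sigma>")
      case True
      have lim: "(\<lambda>N. ennreal (total * rate ^ length \<sigma> * avoiding_mass n \<tau>\<^sub>0 G N (subtree \<sigma> \<omega>))) \<longlonglongrightarrow> ennreal (total * rate ^ length \<sigma> * 0)"
        using rec \<sigma> True unfolding recurrent_def by (intro tendsto_intros) auto
      have "emeasure ?M ?N \<le> ennreal (total * rate ^ length \<sigma> * avoiding_mass n \<tau>\<^sub>0 G N (subtree \<sigma> \<omega>))" for N
        by (rule order_trans[OF emeasure_mono emeasure_avoiding_codes[OF typical charged \<sigma>]]) (auto intro: avoiding_codes_sets \<sigma>)
      hence "emeasure ?M ?N \<le> ennreal (total * rate ^ length \<sigma> * 0)" by (intro LIMSEQ_le_const[OF lim]) blast
      thus ?thesis by simp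
    next
      case False
      have "?N \<subseteq> cylinder q \<sigma>" using avoiding_codes_subset[of n \<tau>\<^sub>0 G \<omega> 0 \<sigma>] by blast
      hence "emeasure ?M ?N \<le> emeasure ?M (cylinder q \<sigma>)" by (rule emeasure_mono[OF _ cylinder_sets[OF \<sigma>]])
      thus ?thesis using typical False \<sigma> by (simp add: chargedD[OF charged] cell_mass_neglected typical_def)
    qed
    hence "?N \<in> null_sets ?M" using meas by blast
    from AE_not_in[OF this] show ?thesis by eventually_elim simp
  qed
  hence "AE \<eta> in ?M. \<forall>\<sigma>\<in>words q. \<not> (\<forall>N. \<eta> \<in> avoiding_codes n \<tau>\<^sub>0 G \<omega> N \<sigma>)"
    unfolding AE_ball_countable[OF countable_words] by blast
  thus ?thesis using AE_space
  proof eventually_elim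
    case (elim \<eta>)
    hence \<eta>: "\<eta> \<in> codes" by (simp add: space_coding_measure)
    show ?case
    proof (intro allI, rule ccontr)
      fix i\<^sub>0 assume neg: "\<not> (\<exists>i\<ge>i\<^sub>0. subtree (map \<eta> [0..<i]) \<omega> \<in> G \<and> map \<eta> [i..<i + n] = \<tau>\<^sub>0)"
      have "\<eta> \<in> avoiding_codes n \<tau>\<^sub>0 G \<omega> N (map \<eta> [0..<i])" if "i\<^sub>0 \<le> i" for N i
        using that
      proof (induction N arbitrary: i)
        case 0
        show ?case using \<eta> by (simp add: mem_cylinder)
      next
        case (Suc N)
        have "map \<eta> [i..<i + n] \<in> words_at q n"
          using Pi_mem[OF \<eta>] by (auto simp: words_at_def words_def simp del: atLeastAtMost_iff)
        moreover have "\<eta> \<in> avoiding_codes n \<tau>\<^sub>0 G \<omega> N (map \<eta> [0..<i] @ map \<eta> [i..<i + n])"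
          using Suc.IH[of "i + n"] Suc.prems by (simp add: map_prefix_append)
        ultimately show ?case unfolding avoiding_codes.simps using neg Suc.prems by blast
      qed
      thus False using elim(1) map_prefix_words[OF \<eta>, of i\<^sub>0] words_at_words by blast
    qed
  qed
qed

text \<open>
  The recurrence is stated for points instead of codes, by means of closed cubes.  This
  makes the set Borel, as is needed for passing from the coding measure to its image.
\<close>

definition recurrent_points :: "nat list \<Rightarrow> (nat list \<Rightarrow> bool) set \<Rightarrow> (nat list \<Rightarrow> bool) \<Rightarrow> (real ^ 'm) set" where
  "recurrent_points \<tau>\<^sub>0 G \<omega> = {x. \<forall>i\<^sub>0. \<exists>i\<ge>i\<^sub>0. \<exists>\<sigma>\<in>words_at q i. subtree \<sigma> \<omega> \<in> G \<and> x \<in> cube k e (\<sigma> @ \<tau>\<^sub>0)}"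

lemma closed_cube: "closed (cube k e \<sigma>)" by (simp add: cube_def closed_cbox)

lemma recurrent_points_sets: "recurrent_points \<tau>\<^sub>0 G \<omega> \<in> sets borel"
proof -
  have "recurrent_points \<tau>\<^sub>0 G \<omega> = (\<Inter>i\<^sub>0. \<Union>i\<in>{i\<^sub>0..}. \<Union>\<sigma>\<in>{\<sigma> \<in> words_at q i. subtree \<sigma> \<omega> \<in> G}. cube k e (\<sigma> @ \<tau>\<^sub>0))"
    unfolding recurrent_points_def by blast
  also have "\<dots> \<in> sets borel"
    by (intro sets.countable_INT'' sets.countable_UN'' sets.finite_UN) (auto intro!: borel_closed closed_cube)
  finally show ?thesis .
qed

lemma AE_natural_measureI:
  assumes "A \<in> sets borel" "AE \<eta> in \<mu> \<omega>. coding_point k e \<eta> \<in> A"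
  shows "AE x in \<nu> \<omega>. x \<in> A"
  unfolding natural_measure_def using assms
  by (subst AE_distr_iff[OF measurable_coding_point]) auto

lemma AE_recurrent_points:
  assumes "typical \<omega>" "charged \<omega>"
    "recurrent n \<tau>\<^sub>0 G \<omega>"
  shows "AE x in \<nu> \<omega>. x \<in> recurrent_points \<tau>\<^sub>0 G \<omega>"
proof (rule AE_natural_measureI[OF recurrent_points_sets])
  have "AE \<eta> in \<mu> \<omega>. \<forall>i\<^sub>0. \<exists>i\<ge>i\<^sub>0. subtree (map \<eta> [0..<i]) \<omega> \<in> G \<and> map \<eta> [i..<i + n] = \<tau>\<^sub>0"
    by (rule AE_codes_recur[OF assms])
  from this AE_space
  show "AE \<eta> in \<mu> \<omega>. coding_point k e \<eta> \<in> recurrent_points \<tau>\<^sub>0 G \<omega>"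
  proof eventually_elim
    case (elim \<eta>)
    hence \<eta>: "\<eta> \<in> codes" by (simp add: space_coding_measure)
    show ?case
      unfolding recurrent_points_def
    proof (intro CollectI allI)
      fix i\<^sub>0
      obtain i where i: "i\<^sub>0 \<le> i" "subtree (map \<eta> [0..<i]) \<omega> \<in> G" "map \<eta> [i..<i + n] = \<tau>\<^sub>0" using elim by blast
      have "coding_point k e \<eta> \<in> cube k e (map \<eta> [0..<i] @ \<tau>\<^sub>0)"
        using coding_point_in_cube[OF \<eta>, of "i + n"] i by (simp add: map_prefix_append)
      thus "\<exists>i\<ge>i\<^sub>0. \<exists>\<sigma>\<in>words_at q i. subtree \<sigma> \<omega> \<in> G \<and> coding_point k e \<eta> \<in> cube k e (\<sigma> @ \<tau>\<^sub>0)"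
        using i map_prefix_words[OF \<eta>] by blast
    qed
  qed
qed

lemma limit_set_eq: "limit_set k e \<omega> = (\<Inter>i. \<Union>\<sigma>\<in>{\<sigma> \<in> words_at q i. \<omega> \<sigma>}. cube k e \<sigma>)"
  by (simp add: limit_set_def q_eq)

lemma limit_set_sets: "limit_set k e \<omega> \<in> sets borel"
  unfolding limit_set_eq
  by (intro sets.countable_INT'' sets.finite_UN) (auto intro!: borel_closed closed_cube)

lemma AE_limit_set:
  assumes typical: "typical \<omega>"
    and charged: "charged \<omega>"
  shows "AE x in \<nu> \<omega>. x \<in> limit_set k e \<omega>"
proof (rule AE_natural_measureI[OF limit_set_sets])
  let ?M = "\<mu> \<omega>"
  have "AE \<eta> in ?M. \<eta> \<in> cylinder q \<sigma> \<longrightarrow> \<omega> \<sigma>" if \<sigma>: "\<sigma> \<in> words q" for \<sigma>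
  proof (cases "\<omega> \<sigma>")
    case False
    hence "emeasure ?M (cylinder q \<sigma>) = 0" using typical \<sigma> by (simp add: chargedD[OF charged] cell_mass_neglected typical_def)
    hence "cylinder q \<sigma> \<in> null_sets ?M" using \<sigma> by (intro null_setsI) auto
    from AE_not_in[OF this] show ?thesis by eventually_elim simp
  qed simp
  hence "AE \<eta> in ?M. \<forall>\<sigma>\<in>words q. \<eta> \<in> cylinder q \<sigma> \<longrightarrow> \<omega> \<sigma>"
    unfolding AE_ball_countable[OF countable_words] by blast
  thus "AE \<eta> in ?M. coding_point k e \<eta> \<in> limit_set k e \<omega>" using AE_space
  proof eventually_elim
    case (elim \<eta>)
    hence \<eta>: "\<eta> \<in> codes" by (simp add: space_coding_measure)
    have "\<omega> (map \<eta> [0..<i])" for i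
      using elim(1) map_prefix_words[OF \<eta>, of i] \<eta> by (auto simp: mem_cylinder words_at_def)
    thus ?case unfolding limit_set_eq using map_prefix_words[OF \<eta>] coding_point_in_cube[OF \<eta>] by blast
  qed
qed

section \<open>Mass of sets inside a cube\<close>

lemma natural_measure_cube_ge:
  assumes charged: "charged \<omega>"
    and \<sigma>: "\<sigma> \<in> words q" and A: "cube k e \<sigma> \<subseteq> A" "A \<in> sets borel"
  shows "ennreal (cell_mass \<omega> \<sigma>) \<le> emeasure (\<nu> \<omega>) A"
proof -
  have "ennreal (cell_mass \<omega> \<sigma>) = emeasure (\<mu> \<omega>) (cylinder q \<sigma>)" by (simp add: chargedD[OF charged] \<sigma>)
  also have "\<dots> \<le> emeasure (\<mu> \<omega>) {\<eta> \<in> codes. coding_point k e \<eta> \<in> A}"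
  proof (rule emeasure_mono)
    show "cylinder q \<sigma> \<subseteq> {\<eta> \<in> codes. coding_point k e \<eta> \<in> A}"
    proof
      fix \<eta> assume "\<eta> \<in> cylinder q \<sigma>"
      hence \<eta>: "\<eta> \<in> codes" "map \<eta> [0..<length \<sigma>] = \<sigma>" by (auto simp: mem_cylinder)
      thus "\<eta> \<in> {\<eta> \<in> codes. coding_point k e \<eta> \<in> A}"
        using coding_point_in_cube[OF \<eta>(1), of "length \<sigma>"] A by auto
    qed
    have "{\<eta> \<in> codes. coding_point k e \<eta> \<in> A} = coding_point k e -` A \<inter> space (\<mu> \<omega>)"
      by (auto simp: space_coding_measure)
    also have "\<dots> \<in> sets (\<mu> \<omega>)" using A by measurable
    finally show "{\<eta> \<in> codes. coding_point k e \<eta> \<in> A} \<in> sets (\<mu> \<omega>)" .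
  qed
  finally show ?thesis by (simp add: emeasure_natural_measure A)
qed

definition meeting :: "nat \<Rightarrow> nat list \<Rightarrow> (real ^ 'm) set \<Rightarrow> nat list set" where
  "meeting n \<sigma> A = {\<tau> \<in> words_at q n. cube k e (\<sigma> @ \<tau>) \<inter> A \<noteq> {}}"

lemma finite_meeting [simp]: "finite (meeting n \<sigma> A)" by (simp add: meeting_def)

text \<open>
  Since \<open>A\<close> stays in the interior of the cube \<open>\<sigma>\<close>, no code of a neighbouring cube contributes,
  although the closed cubes overlap on their boundaries.
\<close>

lemma natural_measure_le:
  assumes charged: "charged \<omega>"
    and \<sigma>: "\<sigma> \<in> words q" and A: "A \<subseteq> open_cube \<sigma>" "A \<in> sets borel"
  shows "emeasure (\<nu> \<omega>) A \<le> ennreal (\<Sum>\<tau>\<in>meeting n \<sigma> A. cell_mass \<omega> (\<sigma> @ \<tau>))"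
proof -
  let ?T = "meeting n \<sigma> A"
  let ?M = "\<mu> \<omega>"
  have w: "\<sigma> @ \<tau> \<in> words q" if "\<tau> \<in> ?T" for \<tau> using that \<sigma> words_at_words by (auto simp: meeting_def)
  have "emeasure (\<nu> \<omega>) A = emeasure ?M {\<eta> \<in> codes. coding_point k e \<eta> \<in> A}"
    by (rule emeasure_natural_measure[OF A(2)])
  also have "\<dots> \<le> emeasure ?M (\<Union>\<tau>\<in>?T. cylinder q (\<sigma> @ \<tau>))"
  proof (rule emeasure_mono)
    show "(\<Union>\<tau>\<in>?T. cylinder q (\<sigma> @ \<tau>)) \<in> sets ?M" using w by (intro sets.finite_UN cylinder_sets) auto
    show "{\<eta> \<in> codes. coding_point k e \<eta> \<in> A} \<subseteq> (\<Union>\<tau>\<in>?T. cylinder q (\<sigma> @ \<tau>))"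
    proof safe
      fix \<eta> assume \<eta>: "\<eta> \<in> codes" and x: "coding_point k e \<eta> \<in> A"
      define i where "i = length \<sigma>"
      have "map \<eta> [0..<i] = \<sigma>"
      proof (rule ccontr)
        assume "map \<eta> [0..<i] \<noteq> \<sigma>"
        hence "open_cube \<sigma> \<inter> cube k e (map \<eta> [0..<i]) = {}"
          using map_prefix_words[OF \<eta>, of i] \<sigma> by (intro open_cube_disjoint) (auto simp: i_def words_at_def)
        thus False using coding_point_in_cube[OF \<eta>, of i] x A by blast
      qed
      hence *: "map \<eta> [0..<i + n] = \<sigma> @ map \<eta> [i..<i + n]" by (simp add: map_prefix_append)
      have "map \<eta> [i..<i + n] \<in> ?T"
        using Pi_mem[OF \<eta>] coding_point_in_cube[OF \<eta>, of "i + n"] x * by (auto simp: meeting_def words_at_def words_def simp del: atLeastAtMost_iff)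
      moreover have "\<eta> \<in> cylinder q (\<sigma> @ map \<eta> [i..<i + n])"
        using \<eta> * by (simp add: mem_cylinder i_def)
      ultimately show "\<eta> \<in> (\<Union>\<tau>\<in>?T. cylinder q (\<sigma> @ \<tau>))" by blast
    qed
  qed
  also have "\<dots> \<le> (\<Sum>\<tau>\<in>?T. emeasure ?M (cylinder q (\<sigma> @ \<tau>)))"
    by (rule emeasure_subadditive_finite) (auto simp del: append_in_words intro: cylinder_sets w)
  also have "\<dots> = (\<Sum>\<tau>\<in>?T. ennreal (cell_mass \<omega> (\<sigma> @ \<tau>)))" using w by (intro sum.cong refl chargedD[OF charged])
  also have "\<dots> = ennreal (\<Sum>\<tau>\<in>?T. cell_mass \<omega> (\<sigma> @ \<tau>))" by (intro sum_ennreal cell_mass_nonneg)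
  finally show ?thesis .
qed

end

section \<open>Elementary properties of porosities\<close>

lemma Liminf_at_right_le:
  fixes f :: "real \<Rightarrow> ereal"
  assumes "\<And>\<delta>. 0 < \<delta> \<Longrightarrow> \<exists>r. 0 < r \<and> r < \<delta> \<and> f r \<le> a"
  shows "Liminf (at_right 0) f \<le> a"
proof (rule ccontr)
  assume "\<not> ?thesis"
  hence "eventually (\<lambda>r. a < f r) (at_right 0)" by (intro less_LiminfD) simp
  then obtain b where b: "0 < b" "\<And>r. 0 < r \<Longrightarrow> r < b \<Longrightarrow> a < f r"
    unfolding eventually_at_right_field by blast
  thus False using assms[OF b(1)] by force
qed

lemma Limsup_at_right_ge:
  fixes f :: "real \<Rightarrow> ereal"
  assumes "\<And>\<delta>. 0 < \<delta> \<Longrightarrow> \<exists>r. 0 < r \<and> r < \<delta> \<and> a \<le> f r"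
  shows "a \<le> Limsup (at_right 0) f"
proof (rule ccontr)
  assume "\<not> ?thesis"
  hence "eventually (\<lambda>r. f r < a) (at_right 0)" by (intro Limsup_lessD) simp
  then obtain b where b: "0 < b" "\<And>r. 0 < r \<Longrightarrow> r < b \<Longrightarrow> f r < a"
    unfolding eventually_at_right_field by blast
  thus False using assms[OF b(1)] by force
qed

lemma ereal_le_by_smaller_reals:
  fixes y :: ereal
  assumes "\<And>a. a < b \<Longrightarrow> ereal a \<le> y"
  shows "ereal b \<le> y"
proof (rule dense_le)
  fix x assume "x < ereal b"
  thus "x \<le> y" using assms by (cases x) auto
qed

lemma eventually_at_right_pos: "eventually (\<lambda>r. 0 < r) (at_right (0::real))"
  by (simp add: eventually_at_right_less)

lemma set_por_leI:
  assumes "\<And>\<alpha> z. 0 \<le> \<alpha> \<Longrightarrow> ball z (\<alpha> * r) \<subseteq> ball x r - A \<Longrightarrow> ereal \<alpha> \<le> a"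
  shows "set_por A x r \<le> a"
  unfolding set_por_def using assms by (intro SUP_least) blast

lemma set_por_geI:
  assumes "0 \<le> \<alpha>" "ball z (\<alpha> * r) \<subseteq> ball x r - A"
  shows "ereal \<alpha> \<le> set_por A x r"
  unfolding set_por_def using assms by (intro SUP_upper) blast

lemma measure_por_leI:
  assumes "\<And>\<alpha> z. 0 \<le> \<alpha> \<Longrightarrow> ball z (\<alpha> * r) \<subseteq> ball x r \<Longrightarrow>
    emeasure M (ball z (\<alpha> * r)) \<le> ennreal \<epsilon> * emeasure M (ball x r) \<Longrightarrow> ereal \<alpha> \<le> a"
  shows "measure_por M x r \<epsilon> \<le> a"
  unfolding measure_por_def using assms by (intro SUP_least) blast

lemma measure_por_geI:
  assumes "0 \<le> \<alpha>" "ball z (\<alpha> * r) \<subseteq> ball x r"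
    "emeasure M (ball z (\<alpha> * r)) \<le> ennreal \<epsilon> * emeasure M (ball x r)"
  shows "ereal \<alpha> \<le> measure_por M x r \<epsilon>"
  unfolding measure_por_def using assms by (intro SUP_upper) blast

lemma set_por_nonneg: "0 \<le> set_por A x r"
  using set_por_geI[of 0] by (simp add: zero_ereal_def)

lemma measure_por_nonneg: "0 \<le> measure_por M x r \<epsilon>"
  using measure_por_geI[of 0] by (simp add: zero_ereal_def)

lemma measure_por_le_1:
  fixes x :: "real ^ 'm::finite"
  assumes "0 < r"
  shows "measure_por M x r \<epsilon> \<le> 1"
proof (rule measure_por_leI)
  fix \<alpha> z assume "ball z (\<alpha> * r) \<subseteq> ball x r"
  hence "dist z x + \<alpha> * r \<le> r \<or> \<alpha> * r \<le> 0" by (simp add: ball_subset_ball_iff)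
  hence "\<alpha> * r \<le> 1 * r" using assms zero_le_dist[of z x] by linarith
  thus "ereal \<alpha> \<le> 1" using assms by simp
qed

lemma measure_por_mono:
  assumes "\<epsilon> \<le> \<epsilon>'"
  shows "measure_por M x r \<epsilon> \<le> measure_por M x r \<epsilon>'"
proof (rule measure_por_leI, rule measure_por_geI)
  fix \<alpha> z assume "emeasure M (ball z (\<alpha> * r)) \<le> ennreal \<epsilon> * emeasure M (ball x r)"
  also have "\<dots> \<le> ennreal \<epsilon>' * emeasure M (ball x r)"
    using assms by (intro mult_right_mono ennreal_leI) auto
  finally show "emeasure M (ball z (\<alpha> * r)) \<le> ennreal \<epsilon>' * emeasure M (ball x r)" .
qed

text \<open>
  A hole of a set that contains \<open>x\<close> does not contain \<open>x\<close>, so twice its radius fits between \<open>x\<close> and the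
  sphere of radius \<open>r\<close>.
\<close>

lemma set_por_le_half:
  fixes x :: "real ^ 'm::finite"
  assumes "0 < r" "x \<in> A"
  shows "set_por A x r \<le> ereal (1/2)"
proof (rule set_por_leI)
  fix \<alpha> z assume "ball z (\<alpha> * r) \<subseteq> ball x r - A"
  hence z: "ball z (\<alpha> * r) \<subseteq> ball x r" "x \<notin> ball z (\<alpha> * r)" using assms by blast+
  hence "dist z x + \<alpha> * r \<le> r \<or> \<alpha> * r \<le> 0" by (simp add: ball_subset_ball_iff)
  moreover have "\<alpha> * r \<le> dist z x" using z by simp
  ultimately have "\<alpha> * r \<le> (1/2) * r" using assms by linarith
  thus "ereal \<alpha> \<le> ereal (1/2)" using assms by simp
qed

lemma set_por_le_measure_por:
  assumes "\<And>B. open B \<Longrightarrow> B \<inter> A = {} \<Longrightarrow> emeasure M B = 0"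
  shows "set_por A x r \<le> measure_por M x r \<epsilon>"
proof (rule set_por_leI, rule measure_por_geI)
  fix \<alpha> z assume "ball z (\<alpha> * r) \<subseteq> ball x r - A"
  hence "emeasure M (ball z (\<alpha> * r)) = 0" by (intro assms) auto
  thus "emeasure M (ball z (\<alpha> * r)) \<le> ennreal \<epsilon> * emeasure M (ball x r)" by simp
qed auto

lemma quarter_between: "0 < s \<Longrightarrow> s < \<delta> \<Longrightarrow> 0 < s / 4 \<and> s / 4 < (\<delta>::real)"
  by simp

section \<open>Porosities at the three configurations\<close>

context mandelbrot
begin

text \<open>
  A bound for the diameter of the descendants of generation \<open>n\<close> relative to the side of their
  ancestor.  The threshold in \<open>small_mesh\<close> keeps the radius \<open>1/8 + 3 \<cdot> mesh n\<close> of the third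
  configuration below \<open>1/4\<close>, and makes \<open>1 - 20 \<cdot> mesh n\<close> positive.
\<close>

definition mesh :: "nat \<Rightarrow> real" where "mesh n = real CARD('m) / real k ^ n"

definition small_mesh :: "nat \<Rightarrow> bool" where "small_mesh n \<longleftrightarrow> mesh n < 1 / 24"

lemma mesh_pos: "0 < mesh n" using k_pos by (simp add: mesh_def)

lemma mesh_tendsto: "mesh \<longlonglongrightarrow> 0" unfolding mesh_def[abs_def] by (rule side_tendsto_0)

lemma small_mesh_exists:
  assumes "0 < \<delta>" obtains n where "small_mesh n" "mesh n < \<delta>"
proof -
  have "eventually (\<lambda>n. mesh n < min \<delta> (1/24)) sequentially"
    using assms by (intro order_tendstoD(2)[OF mesh_tendsto]) auto
  then obtain n where "mesh n < min \<delta> (1/24)" by (auto simp: eventually_sequentially)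
  thus ?thesis by (intro that[of n]) (auto simp: small_mesh_def)
qed

lemma small_mesh_side: "small_mesh n \<Longrightarrow> 1 / real k ^ n \<le> 1 / 4"
proof -
  assume "small_mesh n"
  have "1 \<le> real CARD('m)" using zero_less_card_finite[where 'a = 'm] by linarith
  hence "1 / real k ^ n \<le> mesh n" unfolding mesh_def by (intro divide_right_mono) auto
  thus ?thesis using \<open>small_mesh n\<close> unfolding small_mesh_def by linarith
qed

lemma small_mesh_pos: "small_mesh n \<Longrightarrow> 0 < n"
  using small_mesh_side[of 0] by (cases n) auto

definition axis_index :: 'm where "axis_index = (SOME i. True)"

definition mid :: "nat \<Rightarrow> nat list" where
  "mid n = (SOME \<tau>. \<tau> \<in> words_at q n \<and> midpoint_word \<tau>)"

text \<open>
  A descendant whose cube contains the point at distance \<open>1/8\<close> from the centre of the unit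
  cube in a fixed coordinate direction.
\<close>

definition side :: "nat \<Rightarrow> nat list" where
  "side n = (SOME \<tau>. \<tau> \<in> words_at q n \<and> (\<chi> i. 1/2) + (1/8) *\<^sub>R axis axis_index 1 \<in> cube k e \<tau>)"

lemma mid: "mid n \<in> words_at q n" "midpoint_word (mid n)"
proof -
  obtain \<tau> where "\<tau> \<in> words_at q n" "(\<chi> i. 1/2) \<in> cube k e \<tau>" by (rule unit_cube_word[of "\<chi> i. 1/2" n]) auto
  hence "\<exists>\<tau>. \<tau> \<in> words_at q n \<and> midpoint_word \<tau>" by (auto simp: midpoint_word_def)
  from someI_ex[OF this] show "mid n \<in> words_at q n" "midpoint_word (mid n)" by (auto simp: mid_def)
qed

lemma side: "side n \<in> words_at q n" "(\<chi> i. 1/2) + (1/8) *\<^sub>R axis axis_index 1 \<in> cube k e (side n)"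
proof -
  have "0 \<le> ((\<chi> i. 1/2) + (1/8) *\<^sub>R axis axis_index 1 :: real ^ 'm) $ i \<and> ((\<chi> i. 1/2) + (1/8) *\<^sub>R axis axis_index 1 :: real ^ 'm) $ i \<le> 1" for i
    by (simp add: axis_def)
  then obtain \<tau> where "\<tau> \<in> words_at q n" "(\<chi> i. 1/2) + (1/8) *\<^sub>R axis axis_index 1 \<in> cube k e \<tau>"
    by (rule unit_cube_word)
  hence "\<exists>\<tau>. \<tau> \<in> words_at q n \<and> (\<chi> i. 1/2) + (1/8) *\<^sub>R axis axis_index 1 \<in> cube k e \<tau>" by blast
  from someI_ex[OF this]
  show "side n \<in> words_at q n" "(\<chi> i. 1/2) + (1/8) *\<^sub>R axis axis_index 1 \<in> cube k e (side n)" by (auto simp: side_def)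
qed

lemma mid_len: "length (mid n) = n" and side_len: "length (side n) = n"
  using mid(1) side(1) by (auto simp: words_at_def)

lemma mid_neq_side: "small_mesh n \<Longrightarrow> mid n \<noteq> side n"
proof
  assume f: "small_mesh n" and eq: "mid n = side n"
  have "norm (((\<chi> i. 1/2) + (1/8) *\<^sub>R axis axis_index 1) - (\<chi> i. 1/2) :: real ^ 'm) \<le> mesh n"
    using cube_diam(2)[OF side(2)[of n], of "\<chi> i. 1/2"] mid(2)[of n] eq
    by (simp add: mesh_def midpoint_word_def side_len)
  thus False using f by (simp add: small_mesh_def)
qed

lemma recurrent_pointsE:
  assumes "x \<in> recurrent_points \<tau>\<^sub>0 G \<omega>" "0 < \<delta>"
  obtains \<sigma> where "\<sigma> \<in> words q" "subtree \<sigma> \<omega> \<in> G" "x \<in> cube k e (\<sigma> @ \<tau>\<^sub>0)" "1 / real k ^ length \<sigma> < \<delta>"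
proof -
  have "eventually (\<lambda>i. 1 / real k ^ i < \<delta>) sequentially"
    using assms by (intro order_tendstoD(2)[OF side_tendsto_0]) auto
  then obtain i\<^sub>0 where i0: "\<And>i. i\<^sub>0 \<le> i \<Longrightarrow> 1 / real k ^ i < \<delta>" unfolding eventually_sequentially by blast
  obtain i \<sigma> where "i\<^sub>0 \<le> i" "\<sigma> \<in> words_at q i" "subtree \<sigma> \<omega> \<in> G" "x \<in> cube k e (\<sigma> @ \<tau>\<^sub>0)"
    using assms(1) unfolding recurrent_points_def by blast
  thus ?thesis using that[of \<sigma>] i0 by (simp add: words_at_def)
qed

definition mass_between :: "real \<Rightarrow> real \<Rightarrow> (nat list \<Rightarrow> bool) set" where
  "mass_between c C = {\<omega> \<in> space P. c \<le> limit_mass \<omega> \<and> limit_mass \<omega> \<le> C}"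

definition mass_below :: "real \<Rightarrow> (nat list \<Rightarrow> bool) set" where
  "mass_below \<delta> = {\<omega> \<in> space P. 0 < limit_mass \<omega> \<and> limit_mass \<omega> \<le> \<delta>}"

lemma measurable_mass_sets [measurable]: "mass_between c C \<in> sets P" "mass_below \<delta> \<in> sets P"
  unfolding mass_between_def mass_below_def by measurable

lemma AE_recurrent:
  assumes "0 < n" "S \<subseteq> words_at q n" "\<tau>\<^sub>0 \<in> S"
    and H: "\<And>\<tau>. \<tau> \<in> S \<Longrightarrow> H \<tau> \<in> sets P" "\<And>\<tau>. \<tau> \<in> S \<Longrightarrow> 0 < prob (H \<tau>)"
    and pos: "\<And>\<omega>. \<omega> \<in> H \<tau>\<^sub>0 \<Longrightarrow> 0 < limit_mass \<omega>"
  shows "AE \<omega> in P. recurrent n \<tau>\<^sub>0 (pattern n S H) \<omega>"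
proof -
  have "AE \<omega> in P. (\<lambda>N. avoiding_mass n \<tau>\<^sub>0 (pattern n S H) N \<omega>) \<longlonglongrightarrow> 0"
  proof (rule avoiding_mass_vanishes)
    show "pattern n S H \<in> sets P" by (rule measurable_pattern) (rule H)
    show "0 < prob (pattern n S H)" by (rule prob_pattern_pos) (use assms in auto)
    show "\<omega> \<tau>\<^sub>0 \<and> 0 < limit_mass (subtree \<tau>\<^sub>0 \<omega>)" if "\<omega> \<in> pattern n S H" for \<omega>
      using that assms(2,3) pos by (auto simp: pattern_def)
  qed (use assms in auto)
  from AE_all_subtrees[OF this] show ?thesis by (simp add: recurrent_def)
qed

text \<open>
  The ball \<open>B(x, r)\<close> has at most the mass of all descendants, each bounded by \<open>C\<close> in units of their
  common scaling factor \<open>M\<close>, while a ball of radius greater than \<open>\<alpha> r\<close> contains a descendant of mass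
  at least \<open>c\<close> in the same units.
\<close>

lemma measure_por_small_at_full_pattern:
  assumes charged: "charged \<omega>"
    and \<sigma>: "\<sigma> \<in> words q" and pat: "subtree \<sigma> \<omega> \<in> pattern n (words_at q n) (\<lambda>_. mass_between c C)"
    and x: "x \<in> cube k e (\<sigma> @ mid n)" and n: "small_mesh n" "mesh n < \<alpha> / 4"
    and c: "0 < c" and \<epsilon>: "0 < \<epsilon>" "\<epsilon> * (real (q ^ n) * C) < c"
    and r: "r = 1 / real k ^ length \<sigma> / 4"
  shows "measure_por (\<nu> \<omega>) x r \<epsilon> \<le> ereal \<alpha>"
proof (rule measure_por_leI, rule ccontr)
  let ?\<nu> = "\<nu> \<omega>"
  fix \<alpha>' z assume z: "ball z (\<alpha>' * r) \<subseteq> ball x r"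
    "emeasure ?\<nu> (ball z (\<alpha>' * r)) \<le> ennreal \<epsilon> * emeasure ?\<nu> (ball x r)"
  assume "\<not> ereal \<alpha>' \<le> ereal \<alpha>"
  hence \<alpha>: "\<alpha> < \<alpha>'" by simp
  have r0: "0 < r" using k_pos by (simp add: r)
  have sub: "ball x r \<subseteq> open_cube \<sigma>"
    by (rule ball_subset_open_cube[OF mid(2) x]) (use small_mesh_side[OF n(1)] mid_len r in auto)
  have "0 < \<alpha>" using n(2) mesh_pos[of n] by simp
  hence "z \<in> ball z (\<alpha>' * r)" using \<alpha> r0 by simp
  hence zc: "z \<in> cube k e \<sigma>" using z(1) sub open_cube_subset_cube by blast
  have "real CARD('m) / real k ^ n < \<alpha>' / 4" using n(2) \<alpha> by (simp add: mesh_def)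
  then obtain \<tau> where \<tau>: "\<tau> \<in> words_at q n" "cube k e (\<sigma> @ \<tau>) \<subseteq> ball z (\<alpha>' / 4 / real k ^ length \<sigma>)"
    by (rule ball_contains_cube[OF _ zc])
  define M where "M = total * rate ^ (length \<sigma> + n)"
  have M: "0 < M" using total_pos rate_pos by (simp add: M_def)
  have mass: "M * c \<le> cell_mass \<omega> (\<sigma> @ \<tau>)" "cell_mass \<omega> (\<sigma> @ \<tau>) \<le> M * C" if "\<tau> \<in> words_at q n" for \<tau>
  proof -
    have "subtree (\<sigma> @ \<tau>) \<omega> \<in> mass_between c C" using pat that by (auto simp: pattern_def)
    hence l: "c \<le> limit_mass (subtree (\<sigma> @ \<tau>) \<omega>)" "limit_mass (subtree (\<sigma> @ \<tau>) \<omega>) \<le> C" by (auto simp: mass_between_def)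
    have "cell_mass \<omega> (\<sigma> @ \<tau>) = M * limit_mass (subtree (\<sigma> @ \<tau>) \<omega>)"
      using that by (simp add: cell_mass_def M_def words_at_def)
    thus "M * c \<le> cell_mass \<omega> (\<sigma> @ \<tau>)" "cell_mass \<omega> (\<sigma> @ \<tau>) \<le> M * C" using l M by auto
  qed
  have "ennreal (M * c) \<le> ennreal (cell_mass \<omega> (\<sigma> @ \<tau>))" using mass(1)[OF \<tau>(1)] by (rule ennreal_leI)
  also have "\<dots> \<le> emeasure ?\<nu> (ball z (\<alpha>' * r))"
  proof (rule natural_measure_cube_ge[OF charged])
    show "cube k e (\<sigma> @ \<tau>) \<subseteq> ball z (\<alpha>' * r)" using \<tau>(2) by (simp add: r mult.commute)
  qed (use \<sigma> \<tau> words_at_words in auto)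
  also have "\<dots> \<le> ennreal \<epsilon> * emeasure ?\<nu> (ball x r)" by (rule z(2))
  also have "\<dots> \<le> ennreal \<epsilon> * ennreal (\<Sum>\<tau>\<in>meeting n \<sigma> (ball x r). cell_mass \<omega> (\<sigma> @ \<tau>))"
    by (intro mult_left_mono natural_measure_le[OF charged \<sigma> sub]) auto
  also have "\<dots> \<le> ennreal \<epsilon> * ennreal (real (q ^ n) * (M * C))"
  proof (intro mult_left_mono ennreal_leI)
    have "(\<Sum>\<tau>\<in>meeting n \<sigma> (ball x r). cell_mass \<omega> (\<sigma> @ \<tau>)) \<le> (\<Sum>\<tau>\<in>words_at q n. cell_mass \<omega> (\<sigma> @ \<tau>))"
      by (intro sum_mono2) (auto simp: cell_mass_nonneg meeting_def)
    also have "\<dots> \<le> (\<Sum>\<tau>\<in>words_at q n. M * C)" by (intro sum_mono mass)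
    also have "\<dots> = real (q ^ n) * (M * C)" by (simp add: card_words_at)
    finally show "(\<Sum>\<tau>\<in>meeting n \<sigma> (ball x r). cell_mass \<omega> (\<sigma> @ \<tau>)) \<le> real (q ^ n) * (M * C)" .
  qed simp
  also have "\<dots> = ennreal (M * (\<epsilon> * (real (q ^ n) * C)))"
    using \<epsilon> by (simp add: ennreal_mult'[symmetric] mult_ac)
  also have "\<dots> < ennreal (M * c)"
    using M \<epsilon>(2) c by (intro ennreal_lessI mult_strict_left_mono) auto
  finally show False by simp
qed

text \<open>
  A point of the limit set lies in a chosen cube of each level, and inside the open cube \<open>\<sigma>\<close> only the
  descendants of \<open>\<sigma>\<close> are available.
\<close>

lemma limit_set_in_chosen_cells:
  assumes "subtree \<sigma> \<omega> \<in> pattern n S H" "\<sigma> \<in> words q" "y \<in> limit_set k e \<omega>" "y \<in> open_cube \<sigma>"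
  obtains \<tau> where "\<tau> \<in> words_at q n" "\<tau> \<in> S" "y \<in> cube k e (\<sigma> @ \<tau>)"
proof -
  obtain \<rho> where \<rho>: "\<rho> \<in> words_at q (length \<sigma> + n)" "\<omega> \<rho>" "y \<in> cube k e \<rho>"
    using assms(3) unfolding limit_set_eq by blast
  define \<sigma>' \<tau> where "\<sigma>' = take (length \<sigma>) \<rho>" and "\<tau> = drop (length \<sigma>) \<rho>"
  have \<rho>_eq: "\<rho> = \<sigma>' @ \<tau>" by (simp add: \<sigma>'_def \<tau>_def)
  hence w: "\<sigma>' \<in> words q" "\<tau> \<in> words q" using words_at_words[OF \<rho>(1)] by simp_all
  have l: "length \<sigma>' = length \<sigma>" "length \<tau> = n" using \<rho>(1) by (auto simp: \<sigma>'_def \<tau>_def words_at_def)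
  have "\<sigma> = \<sigma>'"
  proof (rule ccontr)
    assume "\<sigma> \<noteq> \<sigma>'"
    hence "open_cube \<sigma> \<inter> cube k e \<sigma>' = {}" using w l assms(2) by (intro open_cube_disjoint) auto
    thus False using assms(4) \<rho>(3) cube_append_subset[OF w(2), of \<sigma>'] \<rho>_eq by blast
  qed
  hence "\<tau> \<in> S" using assms(1) \<rho>(2) \<rho>_eq w l by (auto simp: pattern_def words_at_def subtree_apply)
  thus ?thesis using that[of \<tau>] w l \<rho>(3) \<rho>_eq \<open>\<sigma> = \<sigma>'\<close> by (simp add: words_at_def)
qed

lemma set_por_large_at_single_cell:
  assumes pat: "subtree \<sigma> \<omega> \<in> pattern n {mid n} H" and \<sigma>: "\<sigma> \<in> words q"
    and x: "x \<in> cube k e (\<sigma> @ mid n)" and n: "small_mesh n"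
    and r: "r = 1 / real k ^ length \<sigma> / 4"
  shows "ereal ((1 - 4 * mesh n) / 2) \<le> set_por (limit_set k e \<omega>) x r"
proof -
  have sub: "ball x r \<subseteq> open_cube \<sigma>"
    by (rule ball_subset_open_cube[OF mid(2) x]) (use small_mesh_side[OF n] mid_len r in auto)
  have "\<exists>z. ball z ((1 - 4 * mesh n) / 2 * r) \<subseteq> ball x r - cube k e (\<sigma> @ mid n)"
    by (rule hole_next_to_cube[OF x mid_len mesh_def _ r]) (use n in \<open>simp add: small_mesh_def\<close>)
  then obtain z where z: "ball z ((1 - 4 * mesh n) / 2 * r) \<subseteq> ball x r - cube k e (\<sigma> @ mid n)" by blast
  have "limit_set k e \<omega> \<inter> open_cube \<sigma> \<subseteq> cube k e (\<sigma> @ mid n)"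
    using limit_set_in_chosen_cells[OF pat \<sigma>] by blast
  hence "ball z ((1 - 4 * mesh n) / 2 * r) \<subseteq> ball x r - limit_set k e \<omega>" using z sub by blast
  thus ?thesis using n by (intro set_por_geI) (auto simp: small_mesh_def)
qed

text \<open>
  The ball that misses the side cube has no more mass than the central cube, that is \<open>\<epsilon> c\<close> in units of
  the common scaling factor \<open>M\<close>, whereas the side cube alone has at least mass \<open>c\<close> and lies in
  \<open>B(x, r)\<close>.
\<close>

lemma measure_por_large_at_two_cells:
  assumes charged: "charged \<omega>"
    and hered: "hereditary \<omega>"
    and pat: "subtree \<sigma> \<omega> \<in> pattern n {mid n, side n} (\<lambda>\<tau>. if \<tau> = mid n then mass_below (\<epsilon> * c) else mass_between c C)"
    and \<sigma>: "\<sigma> \<in> words q" and x: "x \<in> cube k e (\<sigma> @ mid n)" and n: "small_mesh n" and c: "0 < c" "0 < \<epsilon>"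
    and r: "r = (1/8 + 3 * mesh n) / real k ^ length \<sigma>"
  shows "ereal (1 - 20 * mesh n) \<le> measure_por (\<nu> \<omega>) x r \<epsilon>"
proof -
  let ?\<nu> = "\<nu> \<omega>"
  have "1/8 + 3 * mesh n \<le> 1/4" using n by (simp add: small_mesh_def)
  hence "r \<le> (1/4) / real k ^ length \<sigma>" unfolding r by (intro divide_right_mono) auto
  hence sub: "ball x r \<subseteq> open_cube \<sigma>"
    by (intro ball_subset_open_cube[OF mid(2) x]) (use small_mesh_side[OF n] mid_len in auto)
  note shell = ball_missing_cube[OF mid(2) side(2) mid_len side_len x mesh_def r]
  obtain z where z: "ball z ((1 - 20 * mesh n) * r) \<subseteq> ball x r - cube k e (\<sigma> @ side n)" using shell(2) by blast
  let ?B = "ball z ((1 - 20 * mesh n) * r)"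
  define M where "M = total * rate ^ (length \<sigma> + n)"
  have M: "0 < M" using total_pos rate_pos by (simp add: M_def)
  have mass: "cell_mass \<omega> (\<sigma> @ \<tau>) = M * limit_mass (subtree (\<sigma> @ \<tau>) \<omega>)" if "\<tau> \<in> words_at q n" for \<tau>
    using that by (simp add: cell_mass_def M_def words_at_def)
  have "subtree (\<sigma> @ mid n) \<omega> \<in> mass_below (\<epsilon> * c)" using pat mid(1)[of n] by (auto simp: pattern_def)
  hence mid_mass: "cell_mass \<omega> (\<sigma> @ mid n) \<le> M * (\<epsilon> * c)" using M by (simp add: mass[OF mid(1)] mass_below_def)
  have "subtree (\<sigma> @ side n) \<omega> \<in> mass_between c C" using pat side(1)[of n] mid_neq_side[OF n] by (auto simp: pattern_def)
  hence side_mass: "M * c \<le> cell_mass \<omega> (\<sigma> @ side n)" using M by (simp add: mass[OF side(1)] mass_between_def)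
  have zero: "cell_mass \<omega> (\<sigma> @ \<tau>) = 0" if \<tau>: "\<tau> \<in> words_at q n" "\<tau> \<noteq> mid n" "\<tau> \<noteq> side n" for \<tau>
  proof (rule cell_mass_neglected[OF hered])
    show "\<sigma> @ \<tau> \<in> words q" using \<sigma> words_at_words[OF \<tau>(1)] by simp
    show "\<not> \<omega> (\<sigma> @ \<tau>)" using pat \<tau> by (auto simp: pattern_def subtree_apply)
  qed
  have "emeasure ?\<nu> ?B \<le> ennreal (\<Sum>\<tau>\<in>meeting n \<sigma> ?B. cell_mass \<omega> (\<sigma> @ \<tau>))"
    by (rule natural_measure_le[OF charged \<sigma>]) (use z sub in auto)
  also have "\<dots> \<le> ennreal (\<Sum>\<tau>\<in>{mid n}. cell_mass \<omega> (\<sigma> @ \<tau>))"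
  proof (intro ennreal_leI)
    let ?T = "meeting n \<sigma> ?B"
    have "side n \<notin> ?T" using z by (auto simp: meeting_def)
    hence "(\<Sum>\<tau>\<in>?T. cell_mass \<omega> (\<sigma> @ \<tau>)) = (\<Sum>\<tau>\<in>?T \<inter> {mid n}. cell_mass \<omega> (\<sigma> @ \<tau>))"
      using zero by (intro sum.mono_neutral_right) (auto simp: meeting_def)
    also have "\<dots> \<le> (\<Sum>\<tau>\<in>{mid n}. cell_mass \<omega> (\<sigma> @ \<tau>))"
      by (intro sum_mono2) (auto simp: cell_mass_nonneg)
    finally show "(\<Sum>\<tau>\<in>?T. cell_mass \<omega> (\<sigma> @ \<tau>)) \<le> (\<Sum>\<tau>\<in>{mid n}. cell_mass \<omega> (\<sigma> @ \<tau>))" .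
  qed
  also have "\<dots> \<le> ennreal (\<epsilon> * cell_mass \<omega> (\<sigma> @ side n))"
  proof (intro ennreal_leI)
    have "M * (\<epsilon> * c) \<le> \<epsilon> * cell_mass \<omega> (\<sigma> @ side n)"
      using mult_left_mono[OF side_mass, of \<epsilon>] c by (simp add: mult_ac)
    thus "(\<Sum>\<tau>\<in>{mid n}. cell_mass \<omega> (\<sigma> @ \<tau>)) \<le> \<epsilon> * cell_mass \<omega> (\<sigma> @ side n)" using mid_mass by simp
  qed
  also have "\<dots> = ennreal \<epsilon> * ennreal (cell_mass \<omega> (\<sigma> @ side n))" using c by (simp add: ennreal_mult')
  also have "\<dots> \<le> ennreal \<epsilon> * emeasure ?\<nu> (ball x r)"
    by (intro mult_left_mono natural_measure_cube_ge[OF charged _ shell(1)]) (use \<sigma> side(1) words_at_words in auto)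
  finally have "emeasure ?\<nu> ?B \<le> ennreal \<epsilon> * emeasure ?\<nu> (ball x r)" .
  moreover have "?B \<subseteq> ball x r" using z by blast
  ultimately show ?thesis
    using n by (intro measure_por_geI) (auto simp: small_mesh_def)
qed

section \<open>Porosities at almost every point\<close>

text \<open>
  The admissible \<open>\<epsilon>\<close> depends on \<open>\<alpha>\<close> through the generation \<open>n\<close> at which descendants become small
  compared with \<open>\<alpha> r\<close>, so the conclusion is a limit as \<open>\<epsilon>\<close> tends to zero.
\<close>

lemma Liminf_measure_por_tendsto_0:
  assumes charged: "charged \<omega>"
    and c: "0 < c" "c \<le> C"
    and x: "\<And>n. small_mesh n \<Longrightarrow>
      x \<in> recurrent_points (mid n) (pattern n (words_at q n) (\<lambda>_. mass_between c C)) \<omega>"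
  shows "((\<lambda>\<epsilon>. Liminf (at_right 0) (\<lambda>r. measure_por (\<nu> \<omega>) x r \<epsilon>)) \<longlongrightarrow> 0) (at_right 0)"
proof -
  define L where "L \<epsilon> = Liminf (at_right 0) (\<lambda>r. measure_por (\<nu> \<omega>) x r \<epsilon>)" for \<epsilon>
  have L_nonneg: "0 \<le> L \<epsilon>" for \<epsilon>
    unfolding L_def by (intro Liminf_bounded always_eventually allI measure_por_nonneg)
  have L_small: "eventually (\<lambda>\<epsilon>. L \<epsilon> \<le> ereal \<alpha>) (at_right 0)" if \<alpha>: "0 < \<alpha>" for \<alpha>
  proof -
    obtain n where n: "small_mesh n" "mesh n < \<alpha> / 4" by (rule small_mesh_exists[of "\<alpha> / 4"]) (use \<alpha> in auto)
    define b where "b = c / (real (q ^ n) * C)"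
    have qC: "0 < real (q ^ n) * C" using letters_pos c by simp
    have b: "0 < b" using c qC by (simp add: b_def)
    have "L \<epsilon> \<le> ereal \<alpha>" if \<epsilon>: "0 < \<epsilon>" "\<epsilon> < b" for \<epsilon>
      unfolding L_def
    proof (rule Liminf_at_right_le)
      fix \<delta> :: real assume "0 < \<delta>"
      with x[OF n(1)] obtain \<sigma> where \<sigma>: "\<sigma> \<in> words q"
        "subtree \<sigma> \<omega> \<in> pattern n (words_at q n) (\<lambda>_. mass_between c C)"
        "x \<in> cube k e (\<sigma> @ mid n)" "1 / real k ^ length \<sigma> < \<delta>"
        by (rule recurrent_pointsE)
      define r where "r = 1 / real k ^ length \<sigma> / 4"
      have "0 < r \<and> r < \<delta>" unfolding r_def by (rule quarter_between) (use k_pos \<sigma>(4) in auto)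
      moreover have "measure_por (\<nu> \<omega>) x r \<epsilon> \<le> ereal \<alpha>"
        by (rule measure_por_small_at_full_pattern[OF charged \<sigma>(1,2,3) n c(1) \<epsilon>(1) _ r_def])
           (use \<epsilon>(2) qC in \<open>auto simp: b_def pos_less_divide_eq\<close>)
      ultimately show "\<exists>r. 0 < r \<and> r < \<delta> \<and> measure_por (\<nu> \<omega>) x r \<epsilon> \<le> ereal \<alpha>" by blast
    qed
    thus ?thesis unfolding eventually_at_right_field using b by blast
  qed
  have "(L \<longlongrightarrow> 0) (at_right 0)"
  proof (rule order_tendstoI)
    fix a :: ereal assume "a < 0"
    thus "eventually (\<lambda>\<epsilon>. a < L \<epsilon>) (at_right 0)" by (intro always_eventually allI less_le_trans[OF _ L_nonneg])
  next
    fix a :: ereal assume "0 < a"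
    then obtain \<alpha> where \<alpha>: "0 < ereal \<alpha>" "ereal \<alpha> < a" using ereal_dense2 by blast
    hence "0 < \<alpha>" by simp
    from L_small[OF this] show "eventually (\<lambda>\<epsilon>. L \<epsilon> < a) (at_right 0)"
      by eventually_elim (use \<alpha>(2) in auto)
  qed
  thus ?thesis by (simp add: L_def[abs_def])
qed

lemma upper_set_por_eq_half:
  assumes x: "\<And>n. small_mesh n \<Longrightarrow> x \<in> recurrent_points (mid n) (pattern n {mid n} (H n)) \<omega>"
    and K: "x \<in> limit_set k e \<omega>"
  shows "upper_set_por (limit_set k e \<omega>) x = ereal (1 / 2)"
proof (rule antisym)
  show "upper_set_por (limit_set k e \<omega>) x \<le> ereal (1 / 2)"
    unfolding upper_set_por_def using K
    by (intro Limsup_bounded eventually_mono[OF eventually_at_right_pos] set_por_le_half)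
  show "ereal (1 / 2) \<le> upper_set_por (limit_set k e \<omega>) x"
  proof (rule ereal_le_by_smaller_reals)
    fix a :: real assume a: "a < 1 / 2"
    obtain n where n: "small_mesh n" "mesh n < (1 / 2 - a) / 2"
      by (rule small_mesh_exists[of "(1 / 2 - a) / 2"]) (use a in auto)
    have "ereal ((1 - 4 * mesh n) / 2) \<le> upper_set_por (limit_set k e \<omega>) x"
      unfolding upper_set_por_def
    proof (rule Limsup_at_right_ge)
      fix \<delta> :: real assume "0 < \<delta>"
      with x[OF n(1)] obtain \<sigma> where \<sigma>: "\<sigma> \<in> words q" "subtree \<sigma> \<omega> \<in> pattern n {mid n} (H n)"
        "x \<in> cube k e (\<sigma> @ mid n)" "1 / real k ^ length \<sigma> < \<delta>"
        by (rule recurrent_pointsE)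
      define r where "r = 1 / real k ^ length \<sigma> / 4"
      have "0 < r \<and> r < \<delta>" unfolding r_def by (rule quarter_between) (use k_pos \<sigma>(4) in auto)
      moreover have "ereal ((1 - 4 * mesh n) / 2) \<le> set_por (limit_set k e \<omega>) x r"
        by (rule set_por_large_at_single_cell[OF \<sigma>(2,1,3) n(1) r_def])
      ultimately show "\<exists>r. 0 < r \<and> r < \<delta> \<and> ereal ((1 - 4 * mesh n) / 2) \<le> set_por (limit_set k e \<omega>) x r" by blast
    qed
    moreover have "a \<le> (1 - 4 * mesh n) / 2" using n(2) by simp
    hence "ereal a \<le> ereal ((1 - 4 * mesh n) / 2)" by simp
    ultimately show "ereal a \<le> upper_set_por (limit_set k e \<omega>) x" by (rule order_trans[rotated])
  qed
qed

lemma upper_measure_por_eq_1: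
  assumes charged: "charged \<omega>"
    and hered: "hereditary \<omega>" and c: "0 < c"
    and x: "\<And>n l. small_mesh n \<Longrightarrow> x \<in> recurrent_points (mid n) (pattern n {mid n, side n}
      (\<lambda>\<tau>. if \<tau> = mid n then mass_below (1 / real (Suc l) * c) else mass_between c C)) \<omega>"
  shows "upper_measure_por (\<nu> \<omega>) x = 1"
proof -
  define U where "U \<epsilon> = Limsup (at_right 0) (\<lambda>r. measure_por (\<nu> \<omega>) x r \<epsilon>)" for \<epsilon>
  have U: "U \<epsilon> = 1" if \<epsilon>: "0 < \<epsilon>" for \<epsilon>
  proof (rule antisym)
    show "U \<epsilon> \<le> 1" unfolding U_def
      by (intro Limsup_bounded eventually_mono[OF eventually_at_right_pos] measure_por_le_1)
    obtain l where l: "1 / real (Suc l) < \<epsilon>" using reals_Archimedean[OF \<epsilon>] by (auto simp: inverse_eq_divide)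
    have "ereal 1 \<le> U \<epsilon>"
    proof (rule ereal_le_by_smaller_reals)
      fix a :: real assume a: "a < 1"
      obtain n where n: "small_mesh n" "mesh n < (1 - a) / 20"
        by (rule small_mesh_exists[of "(1 - a) / 20"]) (use a in auto)
      have "ereal (1 - 20 * mesh n) \<le> U \<epsilon>"
        unfolding U_def
      proof (rule Limsup_at_right_ge)
        fix \<delta> :: real assume "0 < \<delta>"
        with x[OF n(1), of l] obtain \<sigma> where \<sigma>: "\<sigma> \<in> words q" "subtree \<sigma> \<omega> \<in> pattern n {mid n, side n}
            (\<lambda>\<tau>. if \<tau> = mid n then mass_below (1 / real (Suc l) * c) else mass_between c C)"
          "x \<in> cube k e (\<sigma> @ mid n)" "1 / real k ^ length \<sigma> < \<delta>"
          by (rule recurrent_pointsE)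
        define r where "r = (1/8 + 3 * mesh n) / real k ^ length \<sigma>"
        have "r \<le> 1 / real k ^ length \<sigma>"
          unfolding r_def using n(1) by (intro divide_right_mono) (auto simp: small_mesh_def)
        hence "r < \<delta>" using \<sigma>(4) by linarith
        moreover have "0 < r" unfolding r_def using mesh_pos[of n] k_pos by (intro divide_pos_pos) auto
        moreover have "ereal (1 - 20 * mesh n) \<le> measure_por (\<nu> \<omega>) x r (1 / real (Suc l))"
          by (rule measure_por_large_at_two_cells[OF charged hered \<sigma>(2,1,3) n(1) c _ r_def]) auto
        hence "ereal (1 - 20 * mesh n) \<le> measure_por (\<nu> \<omega>) x r \<epsilon>"
          by (rule order_trans) (use l in \<open>auto intro: measure_por_mono\<close>)
        ultimately show "\<exists>r. 0 < r \<and> r < \<delta> \<and>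
            ereal (1 - 20 * mesh n) \<le> measure_por (\<nu> \<omega>) x r \<epsilon>" by blast
      qed
      moreover have "a \<le> 1 - 20 * mesh n" using n(2) by simp
      hence "ereal a \<le> ereal (1 - 20 * mesh n)" by simp
      ultimately show "ereal a \<le> U \<epsilon>" by (rule order_trans[rotated])
    qed
    thus "1 \<le> U \<epsilon>" by (simp add: one_ereal_def)
  qed
  have "(U \<longlongrightarrow> 1) (at_right 0)"
    by (rule tendsto_eventually, rule eventually_mono[OF eventually_at_right_pos]) (rule U)
  thus ?thesis unfolding upper_measure_por_def U_def by (intro tendsto_Lim) auto
qed

text \<open>
  The configurations form a countable family, so almost every realisation is recurrent for all of
  them, and so is almost every point.
\<close>

theorem porosities:
  "AE \<omega> in P. AE x in \<nu> \<omega>.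
     lower_set_por (limit_set k e \<omega>) x = 0 \<and>
     lower_measure_por (\<nu> \<omega>) x = 0 \<and>
     upper_set_por (limit_set k e \<omega>) x = 1 / 2 \<and>
     upper_measure_por (\<nu> \<omega>) x = 1"
proof -
  obtain c C where c: "0 < c" "c \<le> C" and pos: "0 < prob (mass_between c C)"
    using limit_mass_range unfolding mass_between_def by blast
  have mpos: "0 < limit_mass \<omega>" if "\<omega> \<in> mass_between c C" for \<omega>
    using that c by (auto simp: mass_between_def)
  define Full where "Full n = pattern n (words_at q n) (\<lambda>_. mass_between c C)" for n
  define Single where "Single n = pattern n {mid n} (\<lambda>_. mass_between c C)" for n
  define Two where "Two n l = pattern n {mid n, side n}
      (\<lambda>\<tau>. if \<tau> = mid n then mass_below (1 / real (Suc l) * c) else mass_between c C)" for n l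
  have small: "0 < prob (mass_below (1 / real (Suc l) * c))" for l
    unfolding mass_below_def by (rule limit_mass_small) (use c in auto)
  have AE_full: "AE \<omega> in P. \<forall>n. small_mesh n \<longrightarrow> recurrent n (mid n) (Full n) \<omega>"
    unfolding AE_all_countable Full_def
    by (intro allI AE_impI AE_recurrent) (use small_mesh_pos mid(1) pos mpos in auto)
  have AE_single: "AE \<omega> in P. \<forall>n. small_mesh n \<longrightarrow> recurrent n (mid n) (Single n) \<omega>"
    unfolding AE_all_countable Single_def
    by (intro allI AE_impI AE_recurrent) (use small_mesh_pos mid(1) pos mpos in auto)
  have AE_two: "AE \<omega> in P. \<forall>n l. small_mesh n \<longrightarrow> recurrent n (mid n) (Two n l) \<omega>"
    unfolding AE_all_countable Two_def
  proof (intro allI AE_impI AE_recurrent)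
    fix n l \<omega>
    assume "\<omega> \<in> (if mid n = mid n then mass_below (1 / real (Suc l) * c) else mass_between c C)"
    thus "0 < limit_mass \<omega>" by (simp add: mass_below_def)
  qed (use small_mesh_pos mid(1) side(1) pos small in auto)
  show ?thesis
    using AE_typical AE_full AE_single AE_two
  proof eventually_elim
    case (elim \<omega>)
    let ?\<nu> = "\<nu> \<omega>" and ?K = "limit_set k e \<omega>"
    have hered: "hereditary \<omega>" using elim(1) by (simp add: typical_def)
    show ?case
    proof (rule coding_measure_cases[OF elim(1)])
      assume "emeasure (\<mu> \<omega>) codes = 0"
      hence "emeasure ?\<nu> UNIV = 0" by (simp add: emeasure_natural_measure)
      hence null: "UNIV \<in> null_sets ?\<nu>" by (intro null_setsI) auto
      show ?thesis by (rule AE_I'[OF null]) auto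
    next
      assume charged: "charged \<omega>"
      have rec: "AE x in ?\<nu>. x \<in> recurrent_points \<tau>\<^sub>0 G \<omega>" if "recurrent n \<tau>\<^sub>0 G \<omega>" for n \<tau>\<^sub>0 G
        using elim(1) charged that by (rule AE_recurrent_points)
      have r1: "AE x in ?\<nu>. \<forall>n. small_mesh n \<longrightarrow> x \<in> recurrent_points (mid n) (Full n) \<omega>"
        unfolding AE_all_countable by (intro allI AE_impI rec) (use elim(2) in blast)
      have r2: "AE x in ?\<nu>. \<forall>n. small_mesh n \<longrightarrow> x \<in> recurrent_points (mid n) (Single n) \<omega>"
        unfolding AE_all_countable by (intro allI AE_impI rec) (use elim(3) in blast)
      have r3: "AE x in ?\<nu>. \<forall>n l. small_mesh n \<longrightarrow> x \<in> recurrent_points (mid n) (Two n l) \<omega>"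
        unfolding AE_all_countable by (intro allI AE_impI rec) (use elim(4) in blast)
      have r4: "AE x in ?\<nu>. x \<in> ?K" using elim(1) charged by (rule AE_limit_set)
      have null_K: "emeasure ?\<nu> B = 0" if "open B" "B \<inter> ?K = {}" for B
      proof -
        have "AE x in ?\<nu>. x \<notin> B" using r4 by eventually_elim (use that in blast)
        thus ?thesis using that(1) by (subst (asm) AE_iff_measurable[of B]) (auto simp: natural_measure_def)
      qed
      show ?thesis using r1 r2 r3 r4
      proof eventually_elim
        case (elim x)
        have L: "((\<lambda>\<epsilon>. Liminf (at_right 0) (\<lambda>r. measure_por ?\<nu> x r \<epsilon>)) \<longlongrightarrow> 0) (at_right 0)"
          by (rule Liminf_measure_por_tendsto_0[OF charged c]) (use elim(1) in \<open>auto simp: Full_def\<close>)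
        hence lower_measure: "lower_measure_por ?\<nu> x = 0"
          unfolding lower_measure_por_def by (intro tendsto_Lim) auto
        have "lower_set_por ?K x \<le> Liminf (at_right 0) (\<lambda>r. measure_por ?\<nu> x r \<epsilon>)" for \<epsilon>
          unfolding lower_set_por_def
          by (intro Liminf_mono always_eventually allI set_por_le_measure_por null_K)
        hence "lower_set_por ?K x \<le> 0"
          by (intro tendsto_lowerbound[OF L] always_eventually allI) auto
        moreover have "0 \<le> lower_set_por ?K x"
          unfolding lower_set_por_def by (intro Liminf_bounded always_eventually allI set_por_nonneg)
        ultimately have lower_set: "lower_set_por ?K x = 0" by (rule antisym)
        have upper_set: "upper_set_por ?K x = ereal (1 / 2)"
          by (rule upper_set_por_eq_half[of x "\<lambda>_ _. mass_between c C"]) (use elim(2,4) in \<open>auto simp: Single_def\<close>)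
        have upper_measure: "upper_measure_por ?\<nu> x = 1"
          by (rule upper_measure_por_eq_1[OF charged hered c(1), where C = C]) (use elim(3) in \<open>simp_all add: Two_def\<close>)
        have "(1 / 2 :: ereal) = ereal (1 / 2)" by (simp add: one_ereal_def numeral_eq_ereal)
        thus ?case using lower_set lower_measure upper_set upper_measure by simp
      qed
    qed
  qed
qed

end

theorem corollary4p14:
  fixes k :: nat and p :: real and e :: "nat \<Rightarrow> nat ^ 'm::finite"
    and P :: "(nat list \<Rightarrow> bool) measure"
  assumes "2 \<le> k"
    and "1 / real k ^ CARD('m) < p" and "p < 1"
    and "subcube_enumeration k e"
    and "percolation_measure (k ^ CARD('m)) p P"
  shows "AE \<omega> in P. AE x in natural_measure k p e \<omega>.
           lower_set_por (limit_set k e \<omega>) x = 0 \<and>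
           lower_measure_por (natural_measure k p e \<omega>) x = 0 \<and>
           upper_set_por (limit_set k e \<omega>) x = 1 / 2 \<and>
           upper_measure_por (natural_measure k p e \<omega>) x = 1"
proof -
  interpret mandelbrot "k ^ CARD('m)" p P k e
    using assms by unfold_locales auto
  show ?thesis by (rule porosities)
qed

end
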